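(* For each $\theta\in[0,2\pi)$ let $\pi^{(\theta)}$ be the representation of the Cuntz algebra $\mathcal{O}_2$ on $L^2(\mathbb{T})$ given by $\pi^{(\theta)}(s_i)=S_i^{(\theta)}$, $i=0,1$, where $$(S_i^{(\theta)}\xi)(z)=m_i^{(\theta)}(z)\,\xi(z^2),\qquad m_0^{(\theta)}(z)=a_0+a_1z+a_2z^2+a_3z^3,\qquad m_1^{(\theta)}(z)=a_3-a_2z+a_1z^2-a_0z^3,$$ and $$a_0=\tfrac{1}{2\sqrt2}(1-\cos\theta+\sin\theta),\quad a_1=\tfrac{1}{2\sqrt2}(1-\cos\theta-\sin\theta),\quad a_2=\tfrac{1}{2\sqrt2}(1+\cos\theta-\sin\theta),\quad a_3=\tfrac{1}{2\sqrt2}(1+\cos\theta+\sin\theta).$$ Then: (i) If $\theta\notin\{\frac{\pi}{2},\frac{3\pi}{2}\}$, then $\pi^{(\theta)}$ is irreducible. (ii) If $\theta\neq\theta'$ in $[0,2\pi)$ and $\{\theta,\theta'\}\neq\{\frac{\pi}{2},\frac{3\pi}{2}\}$, then $\pi^{(\theta)}$ and $\pi^{(\theta')}$ are disjoint. (iii) $\pi^{(3\pi/2)}$ is the direct sum of two mutually disjoint irreducible representations, and $\pi^{(\pi/2)}$ is the direct sum of three mutually disjoint irreducible representations. (iv) Each of the two irreducible summands of $\pi^{(3\pi/2)}$ is unitarily equivalent to one of the three irreducible summands of $\pi^{(\pi/2)}$.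
   Context: $\mathcal{O}_2$ is the Cuntz algebra: the universal $C^*$-algebra generated by $s_0,s_1$ with $s_i^*s_j=\delta_{ij}1$ and $s_0s_0^*+s_1s_1^*=1$. $\mathbb{T}$ is the unit circle in $\mathbb{C}$ with normalized Haar measure. For every $\theta$, the operators $S_0^{(\theta)},S_1^{(\theta)}$ satisfy the Cuntz relations, so they define a representation of $\mathcal{O}_2$. Two representations are disjoint if the only bounded operator intertwining them is $0$ (for irreducible representations: if they are not unitarily equivalent). *)

theory Defs
  imports "HOL-Analysis.Analysis"
begin

section \<open>Complex Hilbert spaces and C*-algebras\<close>

class complex_vector = real_vector +
  fixes scaleC :: "complex \<Rightarrow> 'a \<Rightarrow> 'a"  (infixr "*\<^sub>C" 75)
  assumes scaleC_add_right: "c *\<^sub>C (x + y) = c *\<^sub>C x + c *\<^sub>C y"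
    and scaleC_add_left: "(c + d) *\<^sub>C x = c *\<^sub>C x + d *\<^sub>C x"
    and scaleC_scaleC: "c *\<^sub>C d *\<^sub>C x = (c * d) *\<^sub>C x"
    and scaleC_of_real: "complex_of_real r *\<^sub>C x = r *\<^sub>R x"

text \<open>Inner products are linear in the second argument; the norm and the topology are those of
  the underlying real inner product, the real part of the complex one.\<close>

class complex_inner = complex_vector + real_inner +
  fixes cinner :: "'a \<Rightarrow> 'a \<Rightarrow> complex"
  assumes cinner_commute: "cinner x y = cnj (cinner y x)"
    and cinner_add_right: "cinner x (y + z) = cinner x y + cinner x z"
    and cinner_scaleC_right: "cinner x (c *\<^sub>C y) = c * cinner x y"
    and Re_cinner: "Re (cinner x y) = inner x y"

class chilbert_space = complex_inner + banach

text \<open>Unital, nonzero C*-algebras.\<close>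

class cstar_algebra = complex_vector + real_normed_algebra_1 + banach +
  fixes star :: "'a \<Rightarrow> 'a"
  assumes norm_scaleC: "norm (c *\<^sub>C x) = cmod c * norm x"
    and mult_scaleC_left: "(c *\<^sub>C x) * y = c *\<^sub>C (x * y)"
    and mult_scaleC_right: "x * (c *\<^sub>C y) = c *\<^sub>C (x * y)"
    and star_add: "star (x + y) = star x + star y"
    and star_scaleC: "star (c *\<^sub>C x) = cnj c *\<^sub>C star x"
    and star_mult: "star (x * y) = star y * star x"
    and star_star: "star (star x) = x"
    and cstar_identity: "norm (star x * x) = (norm x)\<^sup>2"

definition csubspace :: "'h::complex_vector set \<Rightarrow> bool" where
  "csubspace H \<longleftrightarrow> 0 \<in> H \<and> (\<forall>x\<in>H. \<forall>y\<in>H. x + y \<in> H) \<and> (\<forall>c. \<forall>x\<in>H. c *\<^sub>C x \<in> H)"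

definition bounded_clinear_on ::
    "'h::complex_inner set \<Rightarrow> 'k::complex_inner set \<Rightarrow> ('h \<Rightarrow> 'k) \<Rightarrow> bool" where
  "bounded_clinear_on H K T \<longleftrightarrow>
     (\<forall>x\<in>H. T x \<in> K) \<and>
     (\<forall>x\<in>H. \<forall>y\<in>H. T (x + y) = T x + T y) \<and>
     (\<forall>c. \<forall>x\<in>H. T (c *\<^sub>C x) = c *\<^sub>C T x) \<and>
     (\<exists>B. \<forall>x\<in>H. norm (T x) \<le> B * norm x)"

definition cadjoint :: "('h::chilbert_space \<Rightarrow> 'h) \<Rightarrow> 'h \<Rightarrow> 'h" where
  "cadjoint T = (THE T'. \<forall>x y. cinner (T x) y = cinner x (T' y))"


section \<open>Representations\<close>

text \<open>Representations are unital and act on a closed subspace \<open>H\<close> of a Hilbert space. The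
  values of \<open>\<pi> a\<close> outside \<open>H\<close> are irrelevant, so subrepresentations are obtained by shrinking
  \<open>H\<close>.\<close>

definition representation_on ::
    "'h::chilbert_space set \<Rightarrow> ('a::cstar_algebra \<Rightarrow> 'h \<Rightarrow> 'h) \<Rightarrow> bool" where
  "representation_on H \<pi> \<longleftrightarrow>
     csubspace H \<and> closed H \<and>
     (\<forall>a. bounded_clinear_on H H (\<pi> a)) \<and>
     (\<forall>x\<in>H. \<pi> 1 x = x) \<and>
     (\<forall>a b. \<forall>x\<in>H. \<pi> (a + b) x = \<pi> a x + \<pi> b x) \<and>
     (\<forall>c a. \<forall>x\<in>H. \<pi> (c *\<^sub>C a) x = c *\<^sub>C \<pi> a x) \<and>
     (\<forall>a b. \<forall>x\<in>H. \<pi> (a * b) x = \<pi> a (\<pi> b x)) \<and>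
     (\<forall>a. \<forall>x\<in>H. \<forall>y\<in>H. cinner (\<pi> (star a) x) y = cinner x (\<pi> a y))"

definition irreducible_on ::
    "'h::chilbert_space set \<Rightarrow> ('a::cstar_algebra \<Rightarrow> 'h \<Rightarrow> 'h) \<Rightarrow> bool" where
  "irreducible_on H \<pi> \<longleftrightarrow>
     representation_on H \<pi> \<and> H \<noteq> {0} \<and>
     (\<forall>K. K \<subseteq> H \<and> csubspace K \<and> closed K \<and> (\<forall>a. \<forall>x\<in>K. \<pi> a x \<in> K) \<longrightarrow> K = {0} \<or> K = H)"

definition intertwiner ::
    "'h::chilbert_space set \<Rightarrow> ('a::cstar_algebra \<Rightarrow> 'h \<Rightarrow> 'h) \<Rightarrow>
     'k::chilbert_space set \<Rightarrow> ('a \<Rightarrow> 'k \<Rightarrow> 'k) \<Rightarrow> ('h \<Rightarrow> 'k) \<Rightarrow> bool" where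
  "intertwiner H \<pi> K \<rho> T \<longleftrightarrow>
     bounded_clinear_on H K T \<and> (\<forall>a. \<forall>x\<in>H. T (\<pi> a x) = \<rho> a (T x))"

definition disjoint_reps ::
    "'h::chilbert_space set \<Rightarrow> ('a::cstar_algebra \<Rightarrow> 'h \<Rightarrow> 'h) \<Rightarrow>
     'k::chilbert_space set \<Rightarrow> ('a \<Rightarrow> 'k \<Rightarrow> 'k) \<Rightarrow> bool" where
  "disjoint_reps H \<pi> K \<rho> \<longleftrightarrow> (\<forall>T. intertwiner H \<pi> K \<rho> T \<longrightarrow> (\<forall>x\<in>H. T x = 0))"

definition unitarily_equivalent ::
    "'h::chilbert_space set \<Rightarrow> ('a::cstar_algebra \<Rightarrow> 'h \<Rightarrow> 'h) \<Rightarrow>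
     'k::chilbert_space set \<Rightarrow> ('a \<Rightarrow> 'k \<Rightarrow> 'k) \<Rightarrow> bool" where
  "unitarily_equivalent H \<pi> K \<rho> \<longleftrightarrow>
     (\<exists>U. intertwiner H \<pi> K \<rho> U \<and> U ` H = K \<and>
          (\<forall>x\<in>H. \<forall>y\<in>H. cinner (U x) (U y) = cinner x y))"

text \<open>\<open>(H, \<pi>)\<close> is the orthogonal direct sum of its subrepresentations on
  \<open>K 0, \<dots>, K (n - 1)\<close>.\<close>

definition direct_sum_of_reps ::
    "'h::chilbert_space set \<Rightarrow> ('a::cstar_algebra \<Rightarrow> 'h \<Rightarrow> 'h) \<Rightarrow> nat \<Rightarrow> (nat \<Rightarrow> 'h set) \<Rightarrow> bool"
  where
  "direct_sum_of_reps H \<pi> n K \<longleftrightarrow>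
     representation_on H \<pi> \<and>
     (\<forall>i<n. K i \<subseteq> H \<and> representation_on (K i) \<pi>) \<and>
     (\<forall>i<n. \<forall>j<n. i \<noteq> j \<longrightarrow> (\<forall>x\<in>K i. \<forall>y\<in>K j. cinner x y = 0)) \<and>
     (\<forall>x\<in>H. \<exists>y. (\<forall>i<n. y i \<in> K i) \<and> x = (\<Sum>i<n. y i))"


section \<open>The Hilbert space of square-integrable functions on the circle\<close>

text \<open>Normalized Haar measure on the unit circle.\<close>

definition circle_measure :: "complex measure" where
  "circle_measure =
     distr (uniform_measure lborel {0..<2 * pi}) (restrict_space borel (sphere 0 1)) cis"

definition square_integrable :: "(complex \<Rightarrow> complex) \<Rightarrow> bool" where
  "square_integrable f \<longleftrightarrow>
     f \<in> borel_measurable circle_measure \<and> integrable circle_measure (\<lambda>z. (cmod (f z))\<^sup>2)"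

definition L2_rel :: "(complex \<Rightarrow> complex) \<Rightarrow> (complex \<Rightarrow> complex) \<Rightarrow> bool" where
  "L2_rel f g \<longleftrightarrow>
     square_integrable f \<and> square_integrable g \<and> (AE z in circle_measure. f z = g z)"

lemma cis_measurable_circle:
  "cis \<in> measurable borel (restrict_space borel (sphere 0 1))"
  by (rule measurable_restrict_space2)
     (auto intro!: borel_measurable_continuous_onI continuous_intros)

lemma sets_circle_measure [measurable_cong]:
  "sets circle_measure = sets (restrict_space borel (sphere 0 1))"
  by (simp add: circle_measure_def)

lemma space_circle_measure: "space circle_measure = sphere 0 1"
  by (simp add: circle_measure_def space_restrict_space)

lemma borel_measurable_circle:
  "f \<in> borel_measurable borel \<Longrightarrow> f \<in> borel_measurable circle_measure"
  by (subst measurable_cong_sets[OF sets_circle_measure refl]) (rule measurable_restrict_space1)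

lemma emeasure_circle_space: "emeasure circle_measure (space circle_measure) = 1"
proof -
  have "emeasure circle_measure (space circle_measure)
      = emeasure (uniform_measure lborel {0..<2 * pi}) (cis -` sphere 0 1 \<inter> UNIV)"
    unfolding space_circle_measure unfolding circle_measure_def
    by (subst emeasure_distr)
       (auto intro!: sets.top cis_measurable_circle simp: sets_restrict_space image_iff
             measurable_cong_sets[OF sets_uniform_measure refl])
  also have "cis -` sphere 0 1 \<inter> UNIV = UNIV" by auto
  also have "emeasure (uniform_measure lborel {0..<2 * pi}) UNIV = 1"
    by (subst emeasure_uniform_measure) (auto intro!: ennreal_divide_self)
  finally show ?thesis .
qed

interpretation circle: finite_measure circle_measure
  by standard (simp add: emeasure_circle_space)

lemma nn_integral_circle:
  assumes f: "f \<in> borel_measurable circle_measure"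
  shows "(\<integral>\<^sup>+z. f z \<partial>circle_measure)
    = (\<integral>\<^sup>+t. f (cis t) * indicator {0..<2 * pi} t \<partial>lborel) / ennreal (2 * pi)"
proof -
  have f': "f \<in> borel_measurable (restrict_space borel (sphere 0 1))"
    using f by (simp add: measurable_cong_sets[OF sets_circle_measure refl])
  have fc: "(\<lambda>t. f (cis t)) \<in> borel_measurable borel"
    using measurable_compose[OF cis_measurable_circle f'] .
  have "(\<integral>\<^sup>+z. f z \<partial>circle_measure)
      = (\<integral>\<^sup>+t. f (cis t) \<partial>uniform_measure lborel {0..<2 * pi})"
    unfolding circle_measure_def
    by (rule nn_integral_distr) (use f' cis_measurable_circle in
      \<open>auto simp: measurable_cong_sets[OF sets_uniform_measure refl]\<close>)
  also have "\<dots> = (\<integral>\<^sup>+t. f (cis t) * indicator {0..<2 * pi} t \<partial>lborel) / ennreal (2 * pi)"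
    by (subst nn_integral_uniform_measure) (use fc in auto)
  finally show ?thesis .
qed

lemma square_measurable_circle:
  "(\<lambda>z. z\<^sup>2) \<in> measurable circle_measure circle_measure"
proof -
  have "(\<lambda>z::complex. z\<^sup>2) \<in> measurable (restrict_space borel (sphere 0 1))
      (restrict_space borel (sphere 0 1))"
    by (rule measurable_restrict_space2)
       (auto intro!: measurable_restrict_space1 simp: space_restrict_space norm_power)
  then show ?thesis
    by (simp add: measurable_cong_sets[OF sets_circle_measure sets_circle_measure])
qed

lemma nn_integral_circle_square:
  assumes f: "f \<in> borel_measurable circle_measure"
  shows "(\<integral>\<^sup>+z. f (z\<^sup>2) \<partial>circle_measure) = (\<integral>\<^sup>+z. f z \<partial>circle_measure)"
proof -
  let ?g = "\<lambda>t. f (cis t)"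
  have f': "f \<in> borel_measurable (restrict_space borel (sphere 0 1))"
    using f by (simp add: measurable_cong_sets[OF sets_circle_measure refl])
  have g [measurable]: "?g \<in> borel_measurable borel"
    using measurable_compose[OF cis_measurable_circle f'] .
  have per: "?g (2 * pi + t) = ?g t" for t
    by (simp only: cis_mult[symmetric] cis_2pi mult_1)
  have "(\<integral>\<^sup>+t. ?g t * indicator {0..<4 * pi} t \<partial>lborel)
      = (\<integral>\<^sup>+t. ?g t * indicator {0..<2 * pi} t + ?g t * indicator {2 * pi..<4 * pi} t \<partial>lborel)"
    by (intro nn_integral_cong) (auto simp: indicator_def)
  also have "\<dots> = (\<integral>\<^sup>+t. ?g t * indicator {0..<2 * pi} t \<partial>lborel)
      + (\<integral>\<^sup>+t. ?g t * indicator {2 * pi..<4 * pi} t \<partial>lborel)"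
    by (rule nn_integral_add) auto
  also have "(\<integral>\<^sup>+t. ?g t * indicator {2 * pi..<4 * pi} t \<partial>lborel)
      = (\<integral>\<^sup>+t. ?g (2 * pi + 1 * t) * indicator {2 * pi..<4 * pi} (2 * pi + 1 * t) \<partial>lborel)"
    by (subst nn_integral_real_affine[where c = 1 and t = "2 * pi"]) auto
  also have "\<dots> = (\<integral>\<^sup>+t. ?g t * indicator {0..<2 * pi} t \<partial>lborel)"
    by (intro nn_integral_cong) (auto simp: per indicator_def)
  also have "(\<integral>\<^sup>+t. ?g t * indicator {0..<2 * pi} t \<partial>lborel) + \<dots>
      = 2 * (\<integral>\<^sup>+t. ?g t * indicator {0..<2 * pi} t \<partial>lborel)"
    by (rule mult_2[symmetric])
  finally have *: "(\<integral>\<^sup>+t. ?g t * indicator {0..<4 * pi} t \<partial>lborel)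
      = 2 * (\<integral>\<^sup>+t. ?g t * indicator {0..<2 * pi} t \<partial>lborel)" .
  have "(\<integral>\<^sup>+t. ?g t * indicator {0..<4 * pi} t \<partial>lborel)
      = ennreal 2 * (\<integral>\<^sup>+t. ?g (0 + 2 * t) * indicator {0..<4 * pi} (0 + 2 * t) \<partial>lborel)"
    by (subst nn_integral_real_affine[where c = 2 and t = 0]) auto
  also have "(\<integral>\<^sup>+t. ?g (0 + 2 * t) * indicator {0..<4 * pi} (0 + 2 * t) \<partial>lborel)
      = (\<integral>\<^sup>+t. f ((cis t)\<^sup>2) * indicator {0..<2 * pi} t \<partial>lborel)"
    by (intro nn_integral_cong) (auto simp: Complex.DeMoivre indicator_def)
  finally have "2 * (\<integral>\<^sup>+t. f ((cis t)\<^sup>2) * indicator {0..<2 * pi} t \<partial>lborel)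
      = 2 * (\<integral>\<^sup>+t. ?g t * indicator {0..<2 * pi} t \<partial>lborel)"
    unfolding * by (simp only: ennreal_numeral)
  then have "(\<integral>\<^sup>+t. f ((cis t)\<^sup>2) * indicator {0..<2 * pi} t \<partial>lborel)
      = (\<integral>\<^sup>+t. ?g t * indicator {0..<2 * pi} t \<partial>lborel)"
    by (simp add: ennreal_mult_cancel_left)
  then show ?thesis
    unfolding nn_integral_circle[OF f]
      nn_integral_circle[OF measurable_compose[OF square_measurable_circle f]]
    by (rule arg_cong)
qed

lemma distr_circle_square: "distr circle_measure circle_measure (\<lambda>z. z\<^sup>2) = circle_measure"
proof (rule measure_eqI)
  fix A assume "A \<in> sets (distr circle_measure circle_measure (\<lambda>z::complex. z\<^sup>2))"
  then have A: "A \<in> sets circle_measure" by simp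
  have "emeasure (distr circle_measure circle_measure (\<lambda>z. z\<^sup>2)) A
      = (\<integral>\<^sup>+z. indicator A z \<partial>distr circle_measure circle_measure (\<lambda>z. z\<^sup>2))"
    using A by simp
  also have "\<dots> = (\<integral>\<^sup>+z. indicator A (z\<^sup>2) \<partial>circle_measure)"
    using A by (intro nn_integral_distr square_measurable_circle) auto
  also have "\<dots> = emeasure circle_measure A"
    using A by (subst nn_integral_circle_square) auto
  finally show "emeasure (distr circle_measure circle_measure (\<lambda>z. z\<^sup>2)) A
      = emeasure circle_measure A" .
qed simp

lemma AE_circle_square:
  assumes "AE z in circle_measure. P z"
  shows "AE z in circle_measure. P (z\<^sup>2)"
proof -
  have "AE z in distr circle_measure circle_measure (\<lambda>z. z\<^sup>2). P z"
    unfolding distr_circle_square by (rule assms)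
  then show ?thesis
    by (rule AE_distrD[OF square_measurable_circle])
qed

lemma square_integrable_iff:
  "square_integrable f \<longleftrightarrow> f \<in> borel_measurable circle_measure \<and>
     (\<integral>\<^sup>+z. ennreal ((cmod (f z))\<^sup>2) \<partial>circle_measure) < \<infinity>"
  by (auto simp: square_integrable_def integrable_iff_bounded)

lemma square_integrable_measurable [measurable_dest]:
  "square_integrable f \<Longrightarrow> f \<in> borel_measurable circle_measure"
  by (simp add: square_integrable_def)

lemma square_integrable_zero: "square_integrable (\<lambda>z. 0)"
  by (simp add: square_integrable_def)

lemma square_integrable_mult:
  assumes "square_integrable f" "square_integrable g"
  shows "integrable circle_measure (\<lambda>z. cnj (f z) * g z)"
proof (rule Bochner_Integration.integrable_bound)
  show "integrable circle_measure (\<lambda>z. (cmod (f z))\<^sup>2 + (cmod (g z))\<^sup>2)"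
    using assms by (simp add: square_integrable_def)
  have "f \<in> borel_measurable circle_measure" "g \<in> borel_measurable circle_measure"
    using assms by (simp_all add: square_integrable_def)
  moreover have "cnj \<in> borel_measurable borel"
    by (intro borel_measurable_continuous_onI continuous_intros)
  ultimately show "(\<lambda>z. cnj (f z) * g z) \<in> borel_measurable circle_measure"
    by (intro borel_measurable_times) (auto intro: measurable_compose)
  have "cmod a * cmod b \<le> (cmod a)\<^sup>2 + (cmod b)\<^sup>2" for a b
  proof -
    have "0 \<le> cmod a * cmod b" by simp
    with sum_squares_bound[of "cmod a" "cmod b"] show ?thesis by linarith
  qed
  then show "AE z in circle_measure.
      norm (cnj (f z) * g z) \<le> norm ((cmod (f z))\<^sup>2 + (cmod (g z))\<^sup>2)"
    by (simp add: norm_mult)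
qed

lemma square_integrable_scale:
  assumes "square_integrable f"
  shows "square_integrable (\<lambda>z. c * f z)"
  using assms by (auto simp: square_integrable_def norm_mult power_mult_distrib)

lemma square_integrable_add:
  assumes "square_integrable f" "square_integrable g"
  shows "square_integrable (\<lambda>z. f z + g z)"
  unfolding square_integrable_def
proof
  show meas: "(\<lambda>z. f z + g z) \<in> borel_measurable circle_measure"
    using assms by (auto simp: square_integrable_def)
  show "integrable circle_measure (\<lambda>z. (cmod (f z + g z))\<^sup>2)"
  proof (rule Bochner_Integration.integrable_bound)
    show "integrable circle_measure (\<lambda>z. 2 * (cmod (f z))\<^sup>2 + 2 * (cmod (g z))\<^sup>2)"
      using assms by (simp add: square_integrable_def)
    show "(\<lambda>z. (cmod (f z + g z))\<^sup>2) \<in> borel_measurable circle_measure"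
      using meas by simp
    have "(cmod (a + b))\<^sup>2 \<le> 2 * (cmod a)\<^sup>2 + 2 * (cmod b)\<^sup>2" for a b
    proof -
      have "(cmod (a + b))\<^sup>2 \<le> (cmod a + cmod b)\<^sup>2"
        by (intro power_mono norm_triangle_ineq) simp
      also have "\<dots> \<le> 2 * (cmod a)\<^sup>2 + 2 * (cmod b)\<^sup>2"
        using sum_squares_bound[of "cmod a" "cmod b"] by (simp add: power2_sum)
      finally show ?thesis .
    qed
    then show "AE z in circle_measure.
        norm ((cmod (f z + g z))\<^sup>2) \<le> norm (2 * (cmod (f z))\<^sup>2 + 2 * (cmod (g z))\<^sup>2)"
      by simp
  qed
qed

lemma square_integrable_uminus:
  "square_integrable f \<Longrightarrow> square_integrable (\<lambda>z. - f z)"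
  using square_integrable_scale[of f "-1"] by simp

lemma square_integrable_diff:
  "square_integrable f \<Longrightarrow> square_integrable g \<Longrightarrow> square_integrable (\<lambda>z. f z - g z)"
  using square_integrable_add[OF _ square_integrable_uminus, of f g] by simp

lemma square_integrable_compose_square:
  assumes m: "continuous_on UNIV m" and f: "square_integrable f"
  shows "square_integrable (\<lambda>z. m z * f (z\<^sup>2))"
proof -
  have fm: "f \<in> borel_measurable circle_measure"
    using f by (simp add: square_integrable_def)
  have fs: "(\<lambda>z. f (z\<^sup>2)) \<in> borel_measurable circle_measure"
    by (rule measurable_compose[OF square_measurable_circle fm])
  have meas: "(\<lambda>z. m z * f (z\<^sup>2)) \<in> borel_measurable circle_measure"
    by (rule borel_measurable_times[OF
        borel_measurable_circle[OF borel_measurable_continuous_onI[OF m]] fs])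
  have "bounded (m ` sphere 0 1)"
    using m by (intro compact_imp_bounded compact_continuous_image)
      (auto intro: continuous_on_subset)
  then obtain B where B: "\<And>z. z \<in> sphere 0 1 \<Longrightarrow> cmod (m z) \<le> B"
    unfolding bounded_iff by blast
  have "(\<integral>\<^sup>+z. ennreal ((cmod (m z * f (z\<^sup>2)))\<^sup>2) \<partial>circle_measure)
      \<le> (\<integral>\<^sup>+z. ennreal (B\<^sup>2) * ennreal ((cmod (f (z\<^sup>2)))\<^sup>2) \<partial>circle_measure)"
  proof (intro nn_integral_mono)
    fix z assume "z \<in> space circle_measure"
    then have "(cmod (m z))\<^sup>2 \<le> B\<^sup>2"
      using B by (intro power_mono) (auto simp: space_circle_measure)
    then show "ennreal ((cmod (m z * f (z\<^sup>2)))\<^sup>2)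
        \<le> ennreal (B\<^sup>2) * ennreal ((cmod (f (z\<^sup>2)))\<^sup>2)"
      by (auto simp: norm_mult power_mult_distrib ennreal_mult[symmetric]
          intro!: ennreal_leI mult_right_mono)
  qed
  also have "\<dots> = ennreal (B\<^sup>2) * (\<integral>\<^sup>+z. ennreal ((cmod (f (z\<^sup>2)))\<^sup>2) \<partial>circle_measure)"
    using fs by (intro nn_integral_cmult) simp
  also have "(\<integral>\<^sup>+z. ennreal ((cmod (f (z\<^sup>2)))\<^sup>2) \<partial>circle_measure)
      = (\<integral>\<^sup>+z. ennreal ((cmod (f z))\<^sup>2) \<partial>circle_measure)"
    using fm by (intro nn_integral_circle_square[where f = "\<lambda>z. ennreal ((cmod (f z))\<^sup>2)"]) simp
  also have "ennreal (B\<^sup>2) * \<dots> < \<infinity>"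
    using f by (simp add: square_integrable_iff ennreal_mult_less_top)
  finally show ?thesis
    using meas by (simp add: square_integrable_iff)
qed

quotient_type L2_circle = "complex \<Rightarrow> complex" / partial: L2_rel
proof (rule part_equivpI)
  show "\<exists>f. L2_rel f f"
    using square_integrable_zero by (auto simp: L2_rel_def)
  show "symp L2_rel"
    by (auto simp: symp_def L2_rel_def eq_commute)
  show "transp L2_rel"
  proof (rule transpI)
    fix f g h assume fg: "L2_rel f g" and gh: "L2_rel g h"
    have "AE z in circle_measure. f z = g z" "AE z in circle_measure. g z = h z"
      using fg gh by (simp_all add: L2_rel_def)
    then have "AE z in circle_measure. f z = h z"
      by eventually_elim simp
    with fg gh show "L2_rel f h"
      by (simp add: L2_rel_def)
  qed
qed

instantiation L2_circle :: complex_vector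
begin

lift_definition zero_L2_circle :: L2_circle is "\<lambda>z. 0"
  by (simp add: L2_rel_def square_integrable_zero)

lift_definition plus_L2_circle :: "L2_circle \<Rightarrow> L2_circle \<Rightarrow> L2_circle" is "\<lambda>f g z. f z + g z"
  by (auto simp: L2_rel_def square_integrable_add)

lift_definition minus_L2_circle :: "L2_circle \<Rightarrow> L2_circle \<Rightarrow> L2_circle" is "\<lambda>f g z. f z - g z"
  by (auto simp: L2_rel_def square_integrable_diff)

lift_definition uminus_L2_circle :: "L2_circle \<Rightarrow> L2_circle" is "\<lambda>f z. - f z"
  by (auto simp: L2_rel_def square_integrable_uminus)

lift_definition scaleC_L2_circle :: "complex \<Rightarrow> L2_circle \<Rightarrow> L2_circle" is "\<lambda>c f z. c * f z"
  by (auto simp: L2_rel_def square_integrable_scale)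

definition scaleR_L2_circle :: "real \<Rightarrow> L2_circle \<Rightarrow> L2_circle" where
  "scaleR_L2_circle r x = complex_of_real r *\<^sub>C x"

instance
proof
  fix x y z :: L2_circle and c d :: complex and r s :: real
  show "x + y + z = x + (y + z)"
    by transfer (auto simp: L2_rel_def add.assoc intro!: square_integrable_add)
  show "x + y = y + x"
    by transfer (auto simp: L2_rel_def add.commute intro!: square_integrable_add)
  show "0 + x = x"
    by transfer (auto simp: L2_rel_def)
  show "- x + x = 0"
    by transfer (auto simp: L2_rel_def square_integrable_zero)
  show "x - y = x + - y"
    by transfer (auto simp: L2_rel_def intro!: square_integrable_diff)
  show addr: "c *\<^sub>C (x + y) = c *\<^sub>C x + c *\<^sub>C y" for c and x y :: L2_circle
    by transfer (auto simp: L2_rel_def distrib_left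
        intro!: square_integrable_add square_integrable_scale)
  show addl: "(c + d) *\<^sub>C x = c *\<^sub>C x + d *\<^sub>C x" for c d and x :: L2_circle
    by transfer (auto simp: L2_rel_def distrib_right
        intro!: square_integrable_add square_integrable_scale)
  show scsc: "c *\<^sub>C d *\<^sub>C x = (c * d) *\<^sub>C x" for c d and x :: L2_circle
    by transfer (auto simp: L2_rel_def mult.assoc intro!: square_integrable_scale)
  show "complex_of_real r *\<^sub>C x = r *\<^sub>R x"
    by (simp add: scaleR_L2_circle_def)
  show "r *\<^sub>R (x + y) = r *\<^sub>R x + r *\<^sub>R y"
    by (simp add: scaleR_L2_circle_def addr)
  show "(r + s) *\<^sub>R x = r *\<^sub>R x + s *\<^sub>R x"
    by (simp add: scaleR_L2_circle_def addl)
  show "r *\<^sub>R s *\<^sub>R x = (r * s) *\<^sub>R x"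
    by (simp add: scaleR_L2_circle_def scsc)
  show "1 *\<^sub>R x = x"
    unfolding scaleR_L2_circle_def by transfer (auto simp: L2_rel_def)
qed

end

instantiation L2_circle :: complex_inner
begin

lift_definition cinner_L2_circle :: "L2_circle \<Rightarrow> L2_circle \<Rightarrow> complex" is
  "\<lambda>f g. \<integral>z. cnj (f z) * g z \<partial>circle_measure"
  by (auto simp: L2_rel_def intro!: integral_cong_AE
      borel_measurable_integrable[OF square_integrable_mult])

definition inner_L2_circle :: "L2_circle \<Rightarrow> L2_circle \<Rightarrow> real" where
  "inner_L2_circle x y = Re (cinner x y)"

definition norm_L2_circle :: "L2_circle \<Rightarrow> real" where
  "norm_L2_circle x = sqrt (inner x x)"

definition sgn_L2_circle :: "L2_circle \<Rightarrow> L2_circle" where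
  "sgn_L2_circle x = inverse (norm x) *\<^sub>R x"

definition dist_L2_circle :: "L2_circle \<Rightarrow> L2_circle \<Rightarrow> real" where
  "dist_L2_circle x y = norm (x - y)"

definition uniformity_L2_circle :: "(L2_circle \<times> L2_circle) filter" where
  "uniformity_L2_circle = (INF e\<in>{0<..}. principal {(x, y). dist x (y::L2_circle) < e})"

definition open_L2_circle :: "L2_circle set \<Rightarrow> bool" where
  "open_L2_circle U \<longleftrightarrow> (\<forall>x\<in>U. \<forall>\<^sub>F (x', y) in uniformity. x' = x \<longrightarrow> y \<in> U)"

instance
proof
  fix x y z :: L2_circle and c :: complex and r :: real
  show comm: "cinner x y = cnj (cinner y x)" for x y :: L2_circle
  proof transfer
    fix f g :: "complex \<Rightarrow> complex"
    have "cnj (\<integral>z. cnj (g z) * f z \<partial>circle_measure)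
        = (\<integral>z. cnj (cnj (g z) * f z) \<partial>circle_measure)"
      by (rule Bochner_Integration.integral_cnj[symmetric])
    then show "(\<integral>z. cnj (f z) * g z \<partial>circle_measure)
        = cnj (\<integral>z. cnj (g z) * f z \<partial>circle_measure)"
      by (simp add: mult.commute)
  qed
  show cadd: "cinner x (y + z) = cinner x y + cinner x z" for x y z :: L2_circle
    by transfer (auto simp: L2_rel_def distrib_left
        intro!: Bochner_Integration.integral_add square_integrable_mult)
  show cscale: "cinner x (c *\<^sub>C y) = c * cinner x y" for c and x y :: L2_circle
  proof transfer
    fix c and f g :: "complex \<Rightarrow> complex"
    have "(\<lambda>z. cnj (f z) * (c * g z)) = (\<lambda>z. c * (cnj (f z) * g z))"
      by (simp add: algebra_simps)
    then show "(\<integral>z. cnj (f z) * (c * g z) \<partial>circle_measure)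
        = c * (\<integral>z. cnj (f z) * g z \<partial>circle_measure)"
      by simp
  qed
  show "Re (cinner x y) = inner x y"
    by (simp add: inner_L2_circle_def)
  show ic: "inner x y = inner y x" for x y :: L2_circle
    unfolding inner_L2_circle_def by (subst comm) simp
  show "inner (x + y) z = inner x z + inner y z"
    using ic[of "x + y" z] ic[of x z] ic[of y z] by (simp add: inner_L2_circle_def cadd)
  show "inner (r *\<^sub>R x) y = r * inner x y"
    using ic[of "r *\<^sub>R x" y] ic[of x y]
    by (simp add: inner_L2_circle_def scaleR_L2_circle_def cscale)
  have self: "(\<integral>z. cnj (f z) * f z \<partial>circle_measure)
      = complex_of_real (\<integral>z. (cmod (f z))\<^sup>2 \<partial>circle_measure)" for f
  proof -
    have "cnj (f z) * f z = complex_of_real ((cmod (f z))\<^sup>2)" for z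
      by (metis complex_norm_square mult.commute)
    then show ?thesis by (simp del: of_real_power)
  qed
  show "0 \<le> inner x x"
    unfolding inner_L2_circle_def by transfer (simp add: self)
  show "(inner x x = 0) = (x = 0)"
    unfolding inner_L2_circle_def
  proof transfer
    fix f assume "L2_rel f f"
    then have f: "square_integrable f" by (simp add: L2_rel_def)
    then have "integrable circle_measure (\<lambda>z. (cmod (f z))\<^sup>2)"
      by (simp add: square_integrable_def)
    then have "(\<integral>z. (cmod (f z))\<^sup>2 \<partial>circle_measure) = 0
        \<longleftrightarrow> (AE z in circle_measure. (cmod (f z))\<^sup>2 = 0)"
      by (intro integral_nonneg_eq_0_iff_AE) auto
    then show "(Re (\<integral>z. cnj (f z) * f z \<partial>circle_measure) = 0) = L2_rel f (\<lambda>z. 0)"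
      using f by (simp add: self L2_rel_def square_integrable_zero)
  qed
  show "norm x = sqrt (inner x x)"
    by (simp add: norm_L2_circle_def)
  show "sgn x = inverse (norm x) *\<^sub>R x"
    by (simp add: sgn_L2_circle_def)
  show "dist x y = norm (x - y)"
    by (simp add: dist_L2_circle_def)
qed (simp_all add: uniformity_L2_circle_def open_L2_circle_def)

end

lemma L2_circle_cases:
  obtains f where "square_integrable f" "x = abs_L2_circle f"
proof -
  have "\<exists>f. square_integrable f \<and> x = abs_L2_circle f"
    by (rule L2_circle.abs_induct[of _ x]) (auto simp: L2_rel_def)
  then show ?thesis using that by blast
qed

lemma L2_rel_refl: "square_integrable f \<Longrightarrow> L2_rel f f"
  by (simp add: L2_rel_def)

lemma norm_abs_L2_circle:
  assumes "square_integrable f"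
  shows "ennreal ((norm (abs_L2_circle f))\<^sup>2) = (\<integral>\<^sup>+z. ennreal ((cmod (f z))\<^sup>2) \<partial>circle_measure)"
proof -
  have "cnj (f z) * f z = complex_of_real ((cmod (f z))\<^sup>2)" for z
    by (metis complex_norm_square mult.commute)
  then have "cinner (abs_L2_circle f) (abs_L2_circle f)
      = complex_of_real (\<integral>z. (cmod (f z))\<^sup>2 \<partial>circle_measure)"
    using assms by (simp add: cinner_L2_circle.abs_eq L2_rel_refl del: of_real_power)
  then have "(norm (abs_L2_circle f))\<^sup>2 = (\<integral>z. (cmod (f z))\<^sup>2 \<partial>circle_measure)"
    by (simp add: power2_norm_eq_inner inner_L2_circle_def)
  then show ?thesis
    using assms by (subst nn_integral_eq_integral) (auto simp: square_integrable_def)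
qed

lemma diff_abs_L2_circle:
  "square_integrable f \<Longrightarrow> square_integrable g \<Longrightarrow>
     abs_L2_circle f - abs_L2_circle g = abs_L2_circle (\<lambda>z. f z - g z)"
  by (simp add: minus_L2_circle.abs_eq L2_rel_refl)

text \<open>Riesz--Fischer.\<close>

instance L2_circle :: chilbert_space
proof
  fix X :: "nat \<Rightarrow> L2_circle"
  assume X: "Cauchy X"
  have "\<exists>f. square_integrable f \<and> X n = abs_L2_circle f" for n
    by (rule L2_circle_cases[of "X n"]) auto
  then obtain f where f: "\<And>n. square_integrable (f n)" "\<And>n. X n = abs_L2_circle (f n)"
    by metis
  have fm [measurable]: "f n \<in> borel_measurable circle_measure" for n
    using f(1) by (simp add: square_integrable_def)
  have dist_f: "(\<integral>\<^sup>+z. ennreal ((cmod (f m z - f n z))\<^sup>2) \<partial>circle_measure)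
      = ennreal ((dist (X m) (X n))\<^sup>2)" for m n
    using norm_abs_L2_circle[OF square_integrable_diff[OF f(1) f(1), of m n]]
    by (simp add: dist_norm f diff_abs_L2_circle)
  have "\<exists>N. \<forall>m\<ge>N. \<forall>n\<ge>N. dist (X m) (X n) < (1/2) ^ k" for k
    using X unfolding Cauchy_def by simp
  then obtain N where N: "\<And>k m n. m \<ge> N k \<Longrightarrow> n \<ge> N k \<Longrightarrow> dist (X m) (X n) < (1/2) ^ k"
    by metis
  define r where "r k = (\<Sum>j\<le>k. N j)" for k
  have rN: "r k \<ge> N j" if "j \<le> k" for j k
    unfolding r_def using that by (intro member_le_sum) auto
  have small: "(\<integral>\<^sup>+z. ennreal ((cmod (f m z - f n z))\<^sup>2) \<partial>circle_measure) \<le> ennreal (((1/2) ^ k)\<^sup>2)"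
    if "m \<ge> N k" "n \<ge> N k" for k m n
    unfolding dist_f using N[OF that] by (intro ennreal_leI power_mono) auto
  define d where "d k z = cmod (f (r (Suc k)) z - f (r k) z)" for k z
  have d_int: "(\<integral>\<^sup>+z. ennreal (d k z) \<partial>circle_measure) \<le> ennreal (2 * (1/2) ^ k)" for k
  proof -
    have "t \<le> 2 ^ k * t\<^sup>2 + (1/2) ^ k" for t :: real
    proof -
      have "0 \<le> (2 ^ k * t - 1)\<^sup>2 + 2 ^ k * t + 1" if "0 \<le> t" using that by simp
      moreover have "(2 ^ k * t - 1)\<^sup>2 + 2 ^ k * t
          = 2 ^ k * (2 ^ k * t\<^sup>2 + (1/2) ^ k - t)"
        by (simp add: power2_eq_square power_divide algebra_simps)
      moreover have "0 \<le> (2 ^ k * t - 1)\<^sup>2 + 2 ^ k * t" if "0 \<le> t" using that by simp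
      moreover have "(2::real) ^ k > 0" by simp
      ultimately have "0 \<le> 2 ^ k * t\<^sup>2 + (1/2) ^ k - t" if "0 \<le> t"
        using that by (metis zero_le_mult_iff not_le)
      moreover have "t \<le> 2 ^ k * t\<^sup>2 + (1/2) ^ k" if "t < 0"
      proof -
        have "0 \<le> 2 ^ k * t\<^sup>2 + (1/2) ^ k" by simp
        with that show ?thesis by linarith
      qed
      ultimately show ?thesis by (cases "0 \<le> t") auto
    qed
    then have "(\<integral>\<^sup>+z. ennreal (d k z) \<partial>circle_measure)
        \<le> (\<integral>\<^sup>+z. ennreal (2 ^ k) * ennreal ((d k z)\<^sup>2) + ennreal ((1/2) ^ k) \<partial>circle_measure)"
      by (intro nn_integral_mono)
         (auto simp: ennreal_mult[symmetric] ennreal_plus[symmetric] simp del: ennreal_plus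
               intro!: ennreal_leI)
    also have "\<dots> = ennreal (2 ^ k) * (\<integral>\<^sup>+z. ennreal ((d k z)\<^sup>2) \<partial>circle_measure) + ennreal ((1/2) ^ k)"
      unfolding d_def
      by (subst nn_integral_add) (auto simp: nn_integral_cmult emeasure_circle_space)
    also have "\<dots> \<le> ennreal (2 ^ k) * ennreal (((1/2) ^ k)\<^sup>2) + ennreal ((1/2) ^ k)"
      unfolding d_def by (intro add_mono mult_left_mono small rN) auto
    also have "\<dots> = ennreal (2 ^ k * ((1/2) ^ k)\<^sup>2 + (1/2) ^ k)"
      by (simp add: ennreal_mult[symmetric] ennreal_plus[symmetric] del: ennreal_plus)
    also have "2 ^ k * ((1/2) ^ k)\<^sup>2 + (1/2) ^ k = 2 * (1/2::real) ^ k"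
      by (simp add: power2_eq_square power_divide)
    finally show ?thesis .
  qed
  have "(\<integral>\<^sup>+z. (\<Sum>k. ennreal (d k z)) \<partial>circle_measure) = (\<Sum>k. \<integral>\<^sup>+z. ennreal (d k z) \<partial>circle_measure)"
    by (intro nn_integral_suminf) (simp add: d_def)
  also have "\<dots> \<le> (\<Sum>k. ennreal (2 * (1/2) ^ k))"
    by (intro suminf_le d_int summableI)
  also have "\<dots> = ennreal (\<Sum>k. 2 * (1/2) ^ k)"
    by (intro suminf_ennreal2 summable_mult) (auto intro!: summable_geometric)
  also have "\<dots> < \<infinity>" by simp
  finally have "AE z in circle_measure. (\<Sum>k. ennreal (d k z)) \<noteq> \<infinity>"
    by (intro nn_integral_PInf_AE) (auto simp: d_def)
  then have conv: "AE z in circle_measure. (\<lambda>k. f (r k) z) \<longlonglongrightarrow> lim (\<lambda>k. f (r k) z)"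
  proof eventually_elim
    case (elim z)
    have "summable (\<lambda>k. d k z)"
      using elim by (intro summable_suminf_not_top) (auto simp: d_def)
    then have "summable (\<lambda>k. f (r (Suc k)) z - f (r k) z)"
      unfolding d_def by (rule summable_norm_cancel)
    then have "convergent (\<lambda>n. \<Sum>k<n. f (r (Suc k)) z - f (r k) z)"
      by (simp add: summable_iff_convergent)
    then have "convergent (\<lambda>n. f (r n) z - f (r 0) z)"
      by (simp add: sum_lessThan_telescope[of "\<lambda>k. f (r k) z"])
    then have "convergent (\<lambda>n. (f (r n) z - f (r 0) z) + f (r 0) z)"
      by (rule convergent_add) (rule convergent_const)
    then show ?case by (simp add: convergent_LIMSEQ_iff)
  qed
  define g where "g z = lim (\<lambda>k. f (r k) z)" for z
  have gm [measurable]: "g \<in> borel_measurable circle_measure"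
    unfolding g_def[abs_def] by measurable
  have close: "(\<integral>\<^sup>+z. ennreal ((cmod (f m z - g z))\<^sup>2) \<partial>circle_measure) \<le> ennreal (((1/2) ^ k)\<^sup>2)"
    if m: "m \<ge> N k" for m k
  proof -
    have "AE z in circle_measure. ennreal ((cmod (f m z - g z))\<^sup>2)
        = liminf (\<lambda>j. ennreal ((cmod (f m z - f (r j) z))\<^sup>2))"
      using conv
    proof eventually_elim
      case (elim z)
      then have "(\<lambda>j. ennreal ((cmod (f m z - f (r j) z))\<^sup>2)) \<longlonglongrightarrow> ennreal ((cmod (f m z - g z))\<^sup>2)"
        unfolding g_def by (intro tendsto_intros) auto
      then show ?case
        by (intro lim_imp_Liminf[symmetric]) auto
    qed
    then have "(\<integral>\<^sup>+z. ennreal ((cmod (f m z - g z))\<^sup>2) \<partial>circle_measure)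
        = (\<integral>\<^sup>+z. liminf (\<lambda>j. ennreal ((cmod (f m z - f (r j) z))\<^sup>2)) \<partial>circle_measure)"
      by (rule nn_integral_cong_AE)
    also have "\<dots> \<le> liminf (\<lambda>j. \<integral>\<^sup>+z. ennreal ((cmod (f m z - f (r j) z))\<^sup>2) \<partial>circle_measure)"
      by (intro nn_integral_liminf) auto
    also have "\<dots> \<le> limsup (\<lambda>j. \<integral>\<^sup>+z. ennreal ((cmod (f m z - f (r j) z))\<^sup>2) \<partial>circle_measure)"
      by (intro Liminf_le_Limsup) auto
    also have "\<dots> \<le> ennreal (((1/2) ^ k)\<^sup>2)"
      using m by (intro Limsup_bounded eventually_sequentiallyI[of k] small rN) auto
    finally show ?thesis .
  qed
  have diff: "square_integrable (\<lambda>z. f m z - g z)" if "m \<ge> N k" for m k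
    using close[OF that] by (auto simp: square_integrable_iff le_less_trans)
  have g: "square_integrable g"
    using square_integrable_diff[OF f(1) diff[where m = "N 0" and k = 0, OF order_refl], of "N 0"] by simp
  have "dist (X m) (abs_L2_circle g) \<le> (1/2) ^ k" if "m \<ge> N k" for m k
  proof -
    have "ennreal ((dist (X m) (abs_L2_circle g))\<^sup>2) \<le> ennreal (((1/2) ^ k)\<^sup>2)"
      using close[OF that] norm_abs_L2_circle[OF diff[OF that]]
      by (simp add: dist_norm f diff_abs_L2_circle g)
    then have "(dist (X m) (abs_L2_circle g))\<^sup>2 \<le> ((1/2) ^ k)\<^sup>2"
      by (subst (asm) ennreal_le_iff) auto
    then show ?thesis by (rule power2_le_imp_le) simp
  qed
  moreover have "\<exists>k. (1/2) ^ k < e" if "e > 0" for e :: real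
    using real_arch_pow_inv[OF that, of "1/2"] by auto
  ultimately have "X \<longlonglongrightarrow> abs_L2_circle g"
    unfolding LIMSEQ_def by (meson le_less_trans)
  then show "convergent X" by (rule convergentI)
qed


section \<open>The Cuntz algebra and the representations \<open>\<pi>\<^sup>(\<^sup>\<theta>\<^sup>)\<close>\<close>

definition cuntz_relations :: "'a::cstar_algebra \<Rightarrow> 'a \<Rightarrow> bool" where
  "cuntz_relations s0 s1 \<longleftrightarrow>
     star s0 * s0 = 1 \<and> star s1 * s1 = 1 \<and> star s0 * s1 = 0 \<and> star s1 * s0 = 0 \<and>
     s0 * star s0 + s1 * star s1 = 1"

definition cuntz_operators :: "('h::chilbert_space \<Rightarrow> 'h) \<Rightarrow> ('h \<Rightarrow> 'h) \<Rightarrow> bool" where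
  "cuntz_operators T0 T1 \<longleftrightarrow>
     bounded_clinear_on UNIV UNIV T0 \<and> bounded_clinear_on UNIV UNIV T1 \<and>
     (\<forall>x. cadjoint T0 (T0 x) = x) \<and> (\<forall>x. cadjoint T1 (T1 x) = x) \<and>
     (\<forall>x. cadjoint T0 (T1 x) = 0) \<and> (\<forall>x. cadjoint T1 (T0 x) = 0) \<and>
     (\<forall>x. T0 (cadjoint T0 x) + T1 (cadjoint T1 x) = x)"

definition generates_cstar :: "'a::cstar_algebra set \<Rightarrow> bool" where
  "generates_cstar G \<longleftrightarrow>
     (\<forall>B. G \<subseteq> B \<and> 1 \<in> B \<and> csubspace B \<and> closed B \<and>
          (\<forall>x\<in>B. \<forall>y\<in>B. x * y \<in> B) \<and> (\<forall>x\<in>B. star x \<in> B) \<longrightarrow> B = UNIV)"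

text \<open>The ambient C*-algebra is the universal C*-algebra generated by \<open>s0\<close> and \<open>s1\<close> subject to
  the Cuntz relations: every pair of Hilbert space operators satisfying these relations comes from
  a representation. HOL cannot quantify over all Hilbert space types, but one separable
  infinite-dimensional Hilbert space suffices: an arbitrary pair is a direct sum of pairs on
  separable spaces, and the relations have no nonzero finite-dimensional solution.\<close>

definition cuntz_algebra :: "'a::cstar_algebra \<Rightarrow> 'a \<Rightarrow> bool" where
  "cuntz_algebra s0 s1 \<longleftrightarrow>
     cuntz_relations s0 s1 \<and> generates_cstar {s0, s1} \<and>
     (\<forall>T0 T1 :: L2_circle \<Rightarrow> L2_circle. cuntz_operators T0 T1 \<longrightarrow>
        (\<exists>\<pi>. representation_on UNIV \<pi> \<and> \<pi> s0 = T0 \<and> \<pi> s1 = T1))"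

definition coeff_a :: "real \<Rightarrow> nat \<Rightarrow> real" where
  "coeff_a \<theta> k = 1 / (2 * sqrt 2) *
     [1 - cos \<theta> + sin \<theta>, 1 - cos \<theta> - sin \<theta>, 1 + cos \<theta> - sin \<theta>, 1 + cos \<theta> + sin \<theta>] ! k"

definition filter_m0 :: "real \<Rightarrow> complex \<Rightarrow> complex" where
  "filter_m0 \<theta> z =
     of_real (coeff_a \<theta> 0) + of_real (coeff_a \<theta> 1) * z
     + of_real (coeff_a \<theta> 2) * z ^ 2 + of_real (coeff_a \<theta> 3) * z ^ 3"

definition filter_m1 :: "real \<Rightarrow> complex \<Rightarrow> complex" where
  "filter_m1 \<theta> z =
     of_real (coeff_a \<theta> 3) - of_real (coeff_a \<theta> 2) * z
     + of_real (coeff_a \<theta> 1) * z ^ 2 - of_real (coeff_a \<theta> 0) * z ^ 3"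

lemma L2_rel_filter:
  assumes m: "continuous_on UNIV m" and fg: "L2_rel f g"
  shows "L2_rel (\<lambda>z. m z * f (z\<^sup>2)) (\<lambda>z. m z * g (z\<^sup>2))"
proof -
  have "AE z in circle_measure. f (z\<^sup>2) = g (z\<^sup>2)"
    using fg by (intro AE_circle_square) (simp add: L2_rel_def)
  then have "AE z in circle_measure. m z * f (z\<^sup>2) = m z * g (z\<^sup>2)"
    by eventually_elim simp
  with fg show ?thesis
    by (simp add: L2_rel_def square_integrable_compose_square[OF m])
qed

lift_definition wavelet_S0 :: "real \<Rightarrow> L2_circle \<Rightarrow> L2_circle" is
  "\<lambda>\<theta> \<xi> z. filter_m0 \<theta> z * \<xi> (z\<^sup>2)"
  by (rule L2_rel_filter) (auto simp: filter_m0_def intro!: continuous_intros)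

lift_definition wavelet_S1 :: "real \<Rightarrow> L2_circle \<Rightarrow> L2_circle" is
  "\<lambda>\<theta> \<xi> z. filter_m1 \<theta> z * \<xi> (z\<^sup>2)"
  by (rule L2_rel_filter) (auto simp: filter_m1_def intro!: continuous_intros)

definition is_wavelet_rep ::
    "'a::cstar_algebra \<Rightarrow> 'a \<Rightarrow> real \<Rightarrow> ('a \<Rightarrow> L2_circle \<Rightarrow> L2_circle) \<Rightarrow> bool" where
  "is_wavelet_rep s0 s1 \<theta> \<pi> \<longleftrightarrow>
     representation_on UNIV \<pi> \<and> \<pi> s0 = wavelet_S0 \<theta> \<and> \<pi> s1 = wavelet_S1 \<theta>"

definition wavelet_rep ::
    "'a::cstar_algebra \<Rightarrow> 'a \<Rightarrow> real \<Rightarrow> 'a \<Rightarrow> L2_circle \<Rightarrow> L2_circle" where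
  "wavelet_rep s0 s1 \<theta> = (THE \<pi>. is_wavelet_rep s0 s1 \<theta> \<pi>)"

end

theory Submission
  imports Defs
begin

text \<open>Write \<open>e\<^sub>n\<close> for the function \<open>z\<^sup>n\<close> on the circle, \<open>n\<close> an integer, and \<open>h\<^sub>i\<^sub>j\<close> for the
  coefficient of \<open>z\<^sup>j\<close> in the filter \<open>m\<^sub>i\<close>. Then \<open>S\<^sub>i e\<^sub>n\<close> is the sum over \<open>j = 0, \<dots>, 3\<close> of
  \<open>h\<^sub>i\<^sub>j e\<^bsub>2n+j\<^esub>\<close>, and the adjoint of \<open>S\<^sub>i\<close> maps \<open>e\<^sub>n\<close> to a combination of the two vectors
  \<open>e\<^bsub>(n-j)/2\<^esub>\<close> with \<open>j\<close> of the parity of \<open>n\<close>. Iterating \<open>n \<mapsto> (n - j) / 2\<close> drives every index into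
  the window \<open>{-3, \<dots>, 0}\<close>.

  Let \<open>T\<close> intertwine the representations with parameters \<open>\<theta>\<close> and \<open>\<theta>'\<close>, and let
  \<open>b m n = \<langle>e\<^sub>m, T e\<^sub>n\<rangle>\<close> be its matrix. Inserting the Cuntz relation \<open>S\<^sub>0 S\<^sub>0\<^sup>* + S\<^sub>1 S\<^sub>1\<^sup>* = 1\<close>
  between \<open>T\<close> and \<open>e\<^sub>n\<close> shows that \<open>b\<close> is a fixed point of a linear map with real coefficients
  (lemma \<open>intertwiner_form\<close>), and by the contraction of indices \<open>b\<close> is determined by its sixteen
  entries over the window (lemma \<open>invariant_form_zero\<close>). The sixteen linear equations are
  triangular enough to be solved by hand: the entries over \<open>{-2, -1}\<close> satisfy a closed system
  (lemma \<open>invariant_form_middle\<close>), and once they vanish, a norm estimate disposes of the others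
  (lemma \<open>outer_pair_zero\<close>). The outcome is that \<open>b = 0\<close> when the parameters differ and are not the
  two exceptional ones \<open>\<pi>/2\<close> and \<open>3\<pi>/2\<close> (lemma \<open>invariant_form_distinct\<close>), which is disjointness,
  and that \<open>b\<close> is a multiple of the identity when \<open>\<theta> = \<theta>'\<close> is not exceptional (lemma
  \<open>invariant_form_scalar\<close>); applied to the orthogonal projection onto an invariant subspace, the
  latter gives irreducibility.

  At an exceptional parameter only two of the four coefficients of each filter survive, and the
  closed span of the \<open>e\<^sub>n\<close> with \<open>n\<close> in a suitable index set is invariant: \<open>n \<ge> -1\<close> and \<open>n \<le> -2\<close> for
  \<open>3\<pi>/2\<close>; the negative multiples of 3, the nonnegative multiples of 3 and the remaining integers for
  \<open>\<pi>/2\<close>. A matrix \<open>b\<close> as above is now diagonal over the window, with equal diagonal entries at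
  indices in the same set (lemma \<open>invariant_form_exceptional\<close>), so that the summands are irreducible
  and mutually disjoint. The isometry \<open>e\<^sub>n \<mapsto> e\<^bsub>-3(n+2)\<^esub>\<close> intertwines the representation at \<open>3\<pi>/2\<close>
  with the one at \<open>\<pi>/2\<close> and maps the two summands of the former onto two of the latter.

  The analytic prerequisites are orthogonal projections in Hilbert space, the totality of the \<open>e\<^sub>n\<close>
  (lemma \<open>total_fourier\<close>), and the contractivity of representations of C*-algebras (lemma
  \<open>representation_contractive\<close>), by which identities between representations need to be checked on
  generators and their adjoints only.\<close>

section \<open>Complex inner product spaces\<close>

lemma scaleC_zero_left [simp]: "0 *\<^sub>C (x::'a::complex_vector) = 0"
  using scaleC_of_real[of 0 x] by simp

lemma scaleC_one [simp]: "1 *\<^sub>C (x::'a::complex_vector) = x"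
  using scaleC_of_real[of 1 x] by simp

lemma scaleC_zero_right [simp]: "c *\<^sub>C (0::'a::complex_vector) = 0"
  using scaleC_add_right[of c "0::'a" 0] by simp

lemma scaleC_minus_left: "(- c) *\<^sub>C x = - (c *\<^sub>C (x::'a::complex_vector))"
  using scaleC_add_left[of c "- c" x] by (simp add: eq_neg_iff_add_eq_0 add.commute)

lemma scaleC_sum_right: "c *\<^sub>C (\<Sum>i\<in>A. f i) = (\<Sum>i\<in>A. c *\<^sub>C (f i::'a::complex_vector))"
  by (induction A rule: infinite_finite_induct) (simp_all add: scaleC_add_right)

lemma scaleR_scaleC_commute: "r *\<^sub>R c *\<^sub>C x = c *\<^sub>C r *\<^sub>R (x::'a::complex_vector)"
  by (simp add: scaleC_of_real[symmetric] scaleC_scaleC mult.commute)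

lemma cinner_add_left: "cinner (x + y) z = cinner x z + cinner y (z::'a::complex_inner)"
  using cinner_commute[of "x + y" z] cinner_commute[of x z] cinner_commute[of y z]
  by (simp add: cinner_add_right)

lemma cinner_scaleC_left: "cinner (c *\<^sub>C x) y = cnj c * cinner x (y::'a::complex_inner)"
  using cinner_commute[of "c *\<^sub>C x" y] cinner_commute[of x y]
  by (simp add: cinner_scaleC_right)

lemma cinner_zero_right [simp]: "cinner x (0::'a::complex_inner) = 0"
  using cinner_add_right[of x "0::'a" 0] by simp

lemma cinner_zero_left [simp]: "cinner (0::'a::complex_inner) x = 0"
  using cinner_add_left[of "0::'a" 0 x] by simp

lemma cinner_minus_right: "cinner x (- y) = - cinner x (y::'a::complex_inner)"
  using cinner_add_right[of x y "- y"] by (simp add: eq_neg_iff_add_eq_0 add.commute)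

lemma cinner_diff_right: "cinner x (y - z) = cinner x y - cinner x (z::'a::complex_inner)"
  using cinner_add_right[of x y "- z"] by (simp add: cinner_minus_right)

lemma cinner_scaleR_right: "cinner x (r *\<^sub>R y) = of_real r * cinner x (y::'a::complex_inner)"
  by (simp add: scaleC_of_real[symmetric] cinner_scaleC_right)

lemma cinner_scaleR_left: "cinner (r *\<^sub>R x) y = of_real r * cinner x (y::'a::complex_inner)"
  by (simp add: scaleC_of_real[symmetric] cinner_scaleC_left)

lemma cinner_sum_right: "cinner x (\<Sum>i\<in>A. f i) = (\<Sum>i\<in>A. cinner x (f i::'a::complex_inner))"
  by (induction A rule: infinite_finite_induct) (simp_all add: cinner_add_right)

lemma cinner_sum_left: "cinner (\<Sum>i\<in>A. f i) x = (\<Sum>i\<in>A. cinner (f i::'a::complex_inner) x)"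
  by (induction A rule: infinite_finite_induct) (simp_all add: cinner_add_left)

lemma cinner_self: "cinner x x = of_real ((norm (x::'a::complex_inner))\<^sup>2)"
proof (rule complex_eqI)
  show "Im (cinner x x) = Im (of_real ((norm x)\<^sup>2))"
    using arg_cong[OF cinner_commute[of x x], of Im] by simp
qed (simp only: Re_cinner Re_complex_of_real power2_norm_eq_inner)

lemma cinner_self_eq_0 [simp]: "cinner x x = 0 \<longleftrightarrow> x = (0::'a::complex_inner)"
  by (simp add: cinner_self)

lemma cinner_eqI:
  assumes "\<And>z. cinner z x = cinner z (y::'a::complex_inner)"
  shows "x = y"
  using assms[of "x - y"] cinner_self_eq_0[of "x - y"]
  by (simp add: cinner_diff_right del: cinner_self_eq_0)

lemma norm_scaleC_inner: "norm (c *\<^sub>C x) = cmod c * norm (x::'a::complex_inner)"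
proof -
  have "cinner (c *\<^sub>C x) (c *\<^sub>C x) = (c * cnj c) * cinner x x"
    by (simp add: cinner_scaleC_left cinner_scaleC_right)
  then have "complex_of_real ((norm (c *\<^sub>C x))\<^sup>2) = of_real ((cmod c)\<^sup>2) * of_real ((norm x)\<^sup>2)"
    unfolding cinner_self complex_norm_square[symmetric] by simp
  then have "(norm (c *\<^sub>C x))\<^sup>2 = (cmod c * norm x)\<^sup>2"
    unfolding power_mult_distrib by (simp only: of_real_eq_iff of_real_mult[symmetric])
  then show ?thesis
    by (rule power2_eq_imp_eq) auto
qed

lemma cinner_eq_inner:
  "cinner x y = of_real (inner x y) + \<i> * of_real (inner (\<i> *\<^sub>C x) (y::'a::complex_inner))"
  by (rule complex_eqI) (simp_all add: Re_cinner Re_cinner[of "\<i> *\<^sub>C x" y, symmetric] cinner_scaleC_left)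

lemma norm_cinner_le: "cmod (cinner x y) \<le> norm x * norm (y::'a::complex_inner)"
proof -
  \<comment> \<open>Rotating \<open>y\<close> by a phase reduces the claim to the real Cauchy--Schwarz inequality.\<close>
  define c where "c = cnj (sgn (cinner x y))"
  have "c * cinner x y = of_real (cmod (cinner x y))"
    unfolding c_def by (cases "cinner x y = 0")
      (auto simp: sgn_div_norm scaleR_conv_of_real complex_norm_square[symmetric] power2_eq_square
        mult.commute divide_simps simp flip: of_real_mult)
  then have "cmod (cinner x y) = Re (cinner x (c *\<^sub>C y))"
    by (simp add: cinner_scaleC_right)
  also have "\<dots> \<le> norm x * norm (c *\<^sub>C y)"
    by (simp add: Re_cinner norm_cauchy_schwarz)
  also have "\<dots> \<le> norm x * norm y"
    unfolding norm_scaleC_inner c_def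
    by (intro mult_left_mono) (auto simp: norm_sgn)
  finally show ?thesis .
qed

lemma tendsto_scaleC [tendsto_intros]:
  fixes f :: "'b \<Rightarrow> 'a::complex_inner"
  assumes "(f \<longlongrightarrow> l) F"
  shows "((\<lambda>n. c *\<^sub>C f n) \<longlongrightarrow> c *\<^sub>C l) F"
proof -
  have "bounded_linear (\<lambda>x::'a. c *\<^sub>C x)"
    by (rule bounded_linear_intro[where K = "cmod c"])
      (auto simp: scaleC_add_right scaleR_scaleC_commute norm_scaleC_inner)
  then show ?thesis
    using assms by (rule bounded_linear.tendsto)
qed

lemma tendsto_cinner [tendsto_intros]:
  fixes f g :: "'b \<Rightarrow> 'a::complex_inner"
  assumes "(f \<longlongrightarrow> l) F" "(g \<longlongrightarrow> m) F"
  shows "((\<lambda>n. cinner (f n) (g n)) \<longlongrightarrow> cinner l m) F"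
  unfolding cinner_eq_inner by (intro tendsto_intros assms)

lemma csubspace_diff: "csubspace M \<Longrightarrow> x \<in> M \<Longrightarrow> y \<in> M \<Longrightarrow> x - y \<in> M"
  unfolding csubspace_def
  by (metis scaleC_minus_left scaleC_one uminus_add_conv_diff add.commute)

lemma csubspace_scaleR: "csubspace M \<Longrightarrow> x \<in> M \<Longrightarrow> r *\<^sub>R x \<in> M"
  unfolding csubspace_def by (metis scaleC_of_real)

lemma csubspace_UNIV: "csubspace UNIV"
  by (simp add: csubspace_def)

lemma bounded_clinear_onD:
  assumes "bounded_clinear_on H K T"
  shows "x \<in> H \<Longrightarrow> T x \<in> K"
    and "x \<in> H \<Longrightarrow> y \<in> H \<Longrightarrow> T (x + y) = T x + T y"
    and "x \<in> H \<Longrightarrow> T (c *\<^sub>C x) = c *\<^sub>C T x"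
  using assms unfolding bounded_clinear_on_def by blast+

lemma bounded_clinear_on_diff:
  assumes "bounded_clinear_on H K T" "csubspace H" "x \<in> H" "y \<in> H"
  shows "T (x - y) = T x - T y"
proof -
  have "- y \<in> H"
    using assms(2,4) unfolding csubspace_def by (metis scaleC_minus_left scaleC_one)
  moreover have "T (- y) = - T y"
    using bounded_clinear_onD(3)[OF assms(1,4), of "-1"] by (simp add: scaleC_minus_left)
  ultimately show ?thesis
    using bounded_clinear_onD(2)[OF assms(1,3), of "- y"] by simp
qed

lemma bounded_clinear_on_tendsto:
  assumes T: "bounded_clinear_on H K T" and H: "csubspace H"
    and x: "\<And>n. x n \<in> H" "l \<in> H" "x \<longlonglongrightarrow> l"
  shows "(\<lambda>n. T (x n)) \<longlonglongrightarrow> T l"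
proof -
  obtain B where B: "\<And>x. x \<in> H \<Longrightarrow> norm (T x) \<le> B * norm x"
    using T unfolding bounded_clinear_on_def by blast
  have "norm (T (x n) - T l) \<le> B * norm (x n - l)" for n
    unfolding bounded_clinear_on_diff[OF T H x(1,2), symmetric]
    by (rule B) (rule csubspace_diff[OF H x(1,2)])
  then have "\<forall>\<^sub>F n in sequentially. norm (T (x n) - T l) \<le> B * norm (x n - l)"
    by simp
  moreover have "(\<lambda>n. B * norm (x n - l)) \<longlonglongrightarrow> 0"
    using tendsto_mult_left[OF tendsto_norm[OF LIM_zero[OF x(3)]], of B] by simp
  ultimately have "(\<lambda>n. T (x n) - T l) \<longlonglongrightarrow> 0"
    by (rule Lim_null_comparison)
  then show ?thesis
    by (rule LIM_zero_cancel)
qed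

lemma bounded_clinear_on_zero:
  "bounded_clinear_on H K T \<Longrightarrow> csubspace H \<Longrightarrow> T 0 = 0"
  using bounded_clinear_onD(3)[of H K T 0 0] by (simp add: csubspace_def)

lemma bounded_clinear_sum:
  "bounded_clinear_on UNIV K T \<Longrightarrow> T (\<Sum>i\<in>A. f i) = (\<Sum>i\<in>A. T (f i))"
  by (induction A rule: infinite_finite_induct)
    (simp_all add: bounded_clinear_on_zero csubspace_UNIV bounded_clinear_onD(2))


section \<open>Orthogonal projections\<close>

text \<open>Minimizing sequences for the distance to a closed subspace are Cauchy by the parallelogram
  law, and their limit is the foot of the perpendicular.\<close>

lemma ex_orthogonal_projection:
  fixes M :: "'h::chilbert_space set"
  assumes M: "csubspace M" and cl: "closed M"
  shows "\<exists>p\<in>M. \<forall>m\<in>M. cinner m (x - p) = 0"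
proof -
  have ne: "M \<noteq> {}" using M by (auto simp: csubspace_def)
  define d where "d = infdist x M"
  have d0: "0 \<le> d" by (simp add: d_def infdist_nonneg)
  have dle: "d \<le> norm (x - m)" if "m \<in> M" for m
    using infdist_le[OF that, of x] by (simp add: d_def dist_norm)
  have "\<exists>m\<in>M. norm (x - m) < d + inverse (real (Suc k))" for k
  proof -
    have "(INF m\<in>M. dist x m) < d + inverse (real (Suc k))"
      using ne by (simp add: d_def infdist_def)
    then show ?thesis
      using ne by (subst (asm) cINF_less_iff) (auto simp: dist_norm intro!: bdd_belowI2[of _ 0])
  qed
  then obtain m where m: "\<And>k. m k \<in> M" "\<And>k. norm (x - m k) < d + inverse (real (Suc k))"
    by metis
  have par: "(norm (a - b))\<^sup>2 = 2 * (norm (x - a))\<^sup>2 + 2 * (norm (x - b))\<^sup>2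
      - 4 * (norm (x - (1/2) *\<^sub>R (a + b)))\<^sup>2" for a b :: 'h
    unfolding power2_norm_eq_inner
    by (simp add: inner_diff_left inner_diff_right inner_add_left inner_add_right inner_commute
        algebra_simps)
  have close: "(norm (m i - m j))\<^sup>2 \<le> (8 * d + 4) * inverse (real (Suc k))" if "k \<le> i" "k \<le> j" for i j k
  proof -
    define t where "t = inverse (real (Suc k))"
    have t: "0 < t" "t \<le> 1" by (auto simp: t_def field_simps)
    have "norm (x - m i) \<le> d + t" if "k \<le> i" for i
    proof -
      have "inverse (real (Suc i)) \<le> t"
        unfolding t_def using that by (intro le_imp_inverse_le) auto
      with m(2)[of i] show ?thesis by linarith
    qed
    then have "(norm (x - m i))\<^sup>2 \<le> (d + t)\<^sup>2" if "k \<le> i" for i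
      using that by (intro power_mono) auto
    from this[of i] this[of j] that
    have 1: "(norm (x - m i))\<^sup>2 \<le> (d + t)\<^sup>2" "(norm (x - m j))\<^sup>2 \<le> (d + t)\<^sup>2" by auto
    have "(1/2) *\<^sub>R (m i + m j) \<in> M"
      using m(1) M by (intro csubspace_scaleR) (auto simp: csubspace_def)
    from power_mono[OF dle[OF this] d0, of 2] 1
    have "(norm (m i - m j))\<^sup>2 \<le> 4 * (d + t)\<^sup>2 - 4 * d\<^sup>2"
      unfolding par[of "m i" "m j"] by linarith
    also have "\<dots> = 8 * d * t + 4 * (t * t)"
      by (simp add: power2_eq_square algebra_simps)
    also have "\<dots> \<le> 8 * d * t + 4 * (t * 1)"
      using t d0 by (intro add_mono mult_left_mono) auto
    finally show ?thesis by (simp add: t_def algebra_simps)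
  qed
  have "Cauchy m"
    unfolding Cauchy_def
  proof (intro allI impI)
    fix e :: real assume e: "e > 0"
    then have "e\<^sup>2 / (8 * d + 4) > 0" using d0 by simp
    then obtain k where k: "inverse (real (Suc k)) < e\<^sup>2 / (8 * d + 4)"
      using reals_Archimedean by blast
    have "dist (m i) (m j) < e" if "i \<ge> k" "j \<ge> k" for i j
    proof -
      have "(norm (m i - m j))\<^sup>2 < e\<^sup>2"
        using close[OF that(1,2)] k d0 by (simp add: pos_less_divide_eq mult.commute)
      then show ?thesis
        using e by (simp add: dist_norm power2_less_imp_less)
    qed
    then show "\<exists>N. \<forall>i\<ge>N. \<forall>j\<ge>N. dist (m i) (m j) < e" by blast
  qed
  then obtain p where p: "m \<longlonglongrightarrow> p"
    using Cauchy_convergent convergent_def by blast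
  have pM: "p \<in> M"
    using cl m(1) p closed_sequentially by blast
  have "(\<lambda>k. d + inverse (real (Suc k))) \<longlonglongrightarrow> d + 0"
    by (intro tendsto_intros LIMSEQ_inverse_real_of_nat)
  then have "norm (x - p) \<le> d + 0"
    by (rule LIMSEQ_le[OF tendsto_norm[OF tendsto_diff[OF tendsto_const p]]])
      (use less_imp_le[OF m(2)] in blast)
  with dle[OF pM] have np: "norm (x - p) = d" by simp
  have orth: "inner n (x - p) = 0" if "n \<in> M" for n
  proof (rule ccontr)
    assume ne: "inner n (x - p) \<noteq> 0"
    define a where "a = inner n (x - p)"
    have n0: "inner n n > 0" using ne by auto
    \<comment> \<open>The minimum of the quadratic \<open>t \<mapsto> norm (x - p - t n)\<close> squared.\<close>
    define t where "t = a / inner n n"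
    have "p + t *\<^sub>R n \<in> M"
      using pM that csubspace_scaleR[OF M] M by (auto simp: csubspace_def)
    from power_mono[OF dle[OF this] d0, of 2]
    have "(norm (x - p))\<^sup>2 \<le> (norm ((x - p) - t *\<^sub>R n))\<^sup>2"
      by (simp add: np algebra_simps)
    also have "\<dots> = (norm (x - p))\<^sup>2 - 2 * t * a + t * t * inner n n"
      unfolding power2_norm_eq_inner a_def
      by (simp only: inner_diff_left inner_diff_right inner_scaleR_left inner_scaleR_right
          inner_commute[of "x - p" n] inner_commute[of x n] inner_commute[of p n] inner_commute[of x p])
        (simp add: algebra_simps)
    also have "t * t * inner n n = t * a"
      using n0 by (simp add: t_def)
    finally have "t * a \<le> 0" by (simp add: mult.commute)
    moreover have "t * a > 0"
      using n0 ne by (simp add: t_def a_def power2_eq_square[symmetric])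
    ultimately show False by simp
  qed
  have "cinner n (x - p) = 0" if "n \<in> M" for n
    using orth[OF that] orth[of "\<i> *\<^sub>C n"] that M
    by (subst cinner_eq_inner) (auto simp: csubspace_def)
  with pM show ?thesis by blast
qed

text \<open>The orthogonal projection onto \<open>M\<close>. For closed complex subspaces, the only ones considered, the
  vector chosen is the only one with the property.\<close>

definition orth_proj :: "'h::chilbert_space set \<Rightarrow> 'h \<Rightarrow> 'h" where
  "orth_proj M x = (SOME p. p \<in> M \<and> (\<forall>m\<in>M. cinner m (x - p) = 0))"

context
  fixes M :: "'h::chilbert_space set"
  assumes M: "csubspace M" and cl: "closed M"
begin

lemma orth_proj_mem: "orth_proj M x \<in> M"
  and orth_proj_orthogonal: "m \<in> M \<Longrightarrow> cinner m (x - orth_proj M x) = 0"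
  using someI_ex[of "\<lambda>p. p \<in> M \<and> (\<forall>m\<in>M. cinner m (x - p) = 0)"]
    ex_orthogonal_projection[OF M cl, of x]
  by (auto simp: orth_proj_def)

lemma orth_proj_unique:
  assumes "p \<in> M" "\<And>m. m \<in> M \<Longrightarrow> cinner m (x - p) = 0"
  shows "orth_proj M x = p"
proof -
  let ?q = "orth_proj M x"
  have "p - ?q \<in> M" using assms(1) orth_proj_mem by (rule csubspace_diff[OF M])
  then have "cinner (p - ?q) (x - ?q) - cinner (p - ?q) (x - p) = 0"
    using assms(2) orth_proj_orthogonal by simp
  then have "cinner (p - ?q) (p - ?q) = 0"
    by (simp add: cinner_diff_right)
  then show ?thesis by simp
qed

lemma orth_proj_fixed: "x \<in> M \<Longrightarrow> orth_proj M x = x"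
  by (rule orth_proj_unique) auto

lemma orth_proj_cinner: "m \<in> M \<Longrightarrow> cinner m (orth_proj M x) = cinner m x"
  using orth_proj_orthogonal[of m x] by (simp add: cinner_diff_right)

lemma orth_proj_selfadjoint: "cinner (orth_proj M x) y = cinner x (orth_proj M y)"
  by (metis cinner_commute orth_proj_cinner orth_proj_mem)

lemma orth_proj_bounded_clinear: "bounded_clinear_on UNIV M (orth_proj M)"
  unfolding bounded_clinear_on_def
proof (intro conjI ballI allI exI)
  fix x y :: 'h and c
  show "orth_proj M x \<in> M" by (rule orth_proj_mem)
  show "orth_proj M (x + y) = orth_proj M x + orth_proj M y"
    using orth_proj_mem[of x] orth_proj_mem[of y] M
    by (intro orth_proj_unique)
      (auto simp: csubspace_def cinner_diff_right cinner_add_right orth_proj_cinner)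
  show "orth_proj M (c *\<^sub>C x) = c *\<^sub>C orth_proj M x"
    using orth_proj_mem[of x] M
    by (intro orth_proj_unique)
      (auto simp: csubspace_def cinner_diff_right cinner_scaleC_right orth_proj_cinner)
  have "complex_of_real ((norm (orth_proj M x))\<^sup>2) = cinner (orth_proj M x) x"
    unfolding cinner_self[symmetric] using orth_proj_cinner[OF orth_proj_mem] .
  then have "(norm (orth_proj M x))\<^sup>2 \<le> norm (orth_proj M x) * norm x"
    using norm_cinner_le[of "orth_proj M x" x]
    by (metis norm_of_real abs_of_nonneg zero_le_power2)
  then show "norm (orth_proj M x) \<le> 1 * norm x"
    by (cases "orth_proj M x = 0") (auto simp: power2_eq_square)
qed

end


section \<open>Representations of C*-algebras\<close>

lemma star_zero [simp]: "star (0::'a::cstar_algebra) = 0"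
  using star_add[of "0::'a" 0] by simp

lemma star_minus: "star (- x) = - star (x::'a::cstar_algebra)"
  using star_add[of x "- x"] by (simp add: eq_neg_iff_add_eq_0 add.commute)

lemma star_diff: "star (x - y) = star x - star (y::'a::cstar_algebra)"
  using star_add[of x "- y"] by (simp add: star_minus)

lemma star_one [simp]: "star (1::'a::cstar_algebra) = 1"
  using star_mult[of "star 1" "1::'a"] by (simp add: star_star)

lemma star_scaleR: "star (r *\<^sub>R x) = r *\<^sub>R star (x::'a::cstar_algebra)"
  using star_scaleC[of "of_real r" x] by (simp add: scaleC_of_real)

lemma norm_star: "norm (star x) = norm (x::'a::cstar_algebra)"
proof -
  have *: "norm y \<le> norm (star y)" for y :: 'a
  proof -
    have "norm y * norm y \<le> norm (star y) * norm y"
      using norm_mult_ineq[of "star y" y] by (simp add: cstar_identity power2_eq_square)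
    then show ?thesis by (cases "y = 0") auto
  qed
  from *[of x] *[of "star x"] show ?thesis by (simp add: star_star)
qed

lemma tendsto_star:
  fixes f :: "'b \<Rightarrow> 'a::cstar_algebra"
  assumes "(f \<longlongrightarrow> l) F"
  shows "((\<lambda>n. star (f n)) \<longlongrightarrow> star l) F"
proof -
  have "bounded_linear (star :: 'a \<Rightarrow> 'a)"
    by (rule bounded_linear_intro[where K = 1]) (auto simp: star_add star_scaleR norm_star)
  then show ?thesis
    using assms by (rule bounded_linear.tendsto)
qed

text \<open>The square root \<open>1 - y\<close> of \<open>1 - h\<close>: solving \<open>(1 - y)\<^sup>2 = 1 - h\<close> amounts to finding a fixed
  point of \<open>y \<mapsto> (h + y\<^sup>2) / 2\<close>, a contraction of the ball of radius \<open>norm h < 1\<close>. The fixed point is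
  selfadjoint by uniqueness.\<close>

lemma cstar_sqrt_one_minus:
  fixes h :: "'a::cstar_algebra"
  assumes h: "norm h < 1" "star h = h"
  shows "\<exists>y. star y = y \<and> (1 - y) * (1 - y) = 1 - h"
proof -
  define r where "r = norm h"
  have r: "0 \<le> r" "r < 1" using h by (auto simp: r_def)
  define F where "F y = (1/2) *\<^sub>R (h + y * y)" for y
  have fp: "\<exists>!y\<in>cball 0 r. F y = y"
  proof (rule Banach_fix)
    show "complete (cball (0::'a) r)" by (simp add: complete_eq_closed)
    show "cball (0::'a) r \<noteq> {}" using r by simp
    show "0 \<le> r" "r < 1" by (fact r)+
    show "F ` cball 0 r \<subseteq> cball 0 r"
    proof safe
      fix y :: 'a assume "y \<in> cball 0 r"
      then have "norm y \<le> r" by simp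
      have "norm (y * y) \<le> r * 1"
        using norm_mult_ineq[of y y] mult_mono[of "norm y" r "norm y" 1] \<open>norm y \<le> r\<close> r
        by simp
      then have "norm (F y) \<le> (1/2) * (r + r)"
        using norm_triangle_ineq[of h "y * y"] by (simp add: F_def r_def)
      then show "F y \<in> cball 0 r" by simp
    qed
    show "dist (F y) (F z) \<le> r * dist y z" if "y \<in> cball 0 r" "z \<in> cball 0 r" for y z
    proof -
      have "F y - F z = (1/2) *\<^sub>R (y * (y - z) + (y - z) * z)"
        unfolding F_def scaleR_diff_right[symmetric] by (simp add: algebra_simps)
      then have "norm (F y - F z) \<le> (1/2) * (norm (y * (y - z)) + norm ((y - z) * z))"
        using norm_triangle_ineq[of "y * (y - z)" "(y - z) * z"] by simp
      also have "\<dots> \<le> (1/2) * (r * norm (y - z) + norm (y - z) * r)"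
        using that by (intro mult_left_mono add_mono order_trans[OF norm_mult_ineq] mult_mono)
          (auto intro: r)
      finally show ?thesis by (simp add: dist_norm)
    qed
  qed
  then obtain y where y: "norm y \<le> r" "F y = y"
    by (metis mem_cball_0)
  have uniq: "z = y" if "norm z \<le> r" "F z = z" for z
    using fp y that by (metis mem_cball_0)
  have "F (star y) = star (F y)"
    by (simp add: F_def star_scaleR star_add star_mult h(2))
  then have "star y = y"
    using y by (intro uniq) (auto simp: norm_star)
  moreover have "2 *\<^sub>R y = h + y * y"
    by (subst y(2)[symmetric]) (simp add: F_def)
  then have "(1 - y) * (1 - y) = 1 - h"
    by (simp add: algebra_simps scaleR_2)
  ultimately show ?thesis by blast
qed

lemma representation_onD:
  assumes "representation_on H \<pi>"
  shows "csubspace H" "closed H" "bounded_clinear_on H H (\<pi> a)"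
    and "x \<in> H \<Longrightarrow> \<pi> 1 x = x"
    and "x \<in> H \<Longrightarrow> \<pi> (a + b) x = \<pi> a x + \<pi> b x"
    and "x \<in> H \<Longrightarrow> \<pi> (c *\<^sub>C a) x = c *\<^sub>C \<pi> a x"
    and "x \<in> H \<Longrightarrow> \<pi> (a * b) x = \<pi> a (\<pi> b x)"
    and "x \<in> H \<Longrightarrow> y \<in> H \<Longrightarrow> cinner (\<pi> (star a) x) y = cinner x (\<pi> a y)"
  using assms unfolding representation_on_def by blast+

lemma representation_on_mem: "representation_on H \<pi> \<Longrightarrow> x \<in> H \<Longrightarrow> \<pi> a x \<in> H"
  using bounded_clinear_onD(1)[OF representation_onD(3)] by blast

lemma representation_on_diff:
  assumes "representation_on H \<pi>" "x \<in> H"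
  shows "\<pi> (a - b) x = \<pi> a x - \<pi> b x"
  using representation_onD(5)[OF assms, of "a - b" b] by simp

text \<open>For \<open>t > norm a\<close> the element \<open>h = a\<^sup>* a / t\<^sup>2\<close> has norm below 1, so \<open>1 - h\<close> is the square of a
  selfadjoint element and \<open>\<pi> (1 - h)\<close> is positive. This says that \<open>norm (\<pi> a x) \<le> t * norm x\<close>; let \<open>t\<close>
  tend to \<open>norm a\<close>.\<close>

lemma representation_contractive:
  assumes rep: "representation_on H \<pi>" and x: "x \<in> H"
  shows "norm (\<pi> a x) \<le> norm a * norm x"
proof -
  have "norm (\<pi> a x) \<le> t * norm x" if t: "norm a < t" for t
  proof -
    have t0: "0 < t" using t norm_ge_zero[of a] by linarith
    define h where "h = (1 / t\<^sup>2) *\<^sub>R (star a * a)"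
    have "norm h = (norm a / t)\<^sup>2"
      by (simp add: h_def cstar_identity power_divide)
    also have "\<dots> < 1"
      using t t0 by (simp add: abs_square_less_1)
    finally have "norm h < 1" .
    moreover have "star h = h"
      by (simp add: h_def star_scaleR star_mult star_star)
    ultimately obtain y where y: "star y = y" "(1 - y) * (1 - y) = 1 - h"
      using cstar_sqrt_one_minus by blast
    have s: "star (1 - y) = 1 - y" by (simp add: star_diff y(1))
    have "cinner x (\<pi> (1 - h) x) = cinner (\<pi> (1 - y) x) (\<pi> (1 - y) x)"
      using representation_onD(8)[OF rep x representation_on_mem[OF rep x], of "1 - y"]
      by (simp add: s y(2)[symmetric] representation_onD(7)[OF rep x])
    then have "0 \<le> Re (cinner x (\<pi> (1 - h) x))"
      by (simp add: cinner_self del: of_real_power)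
    also have "\<pi> (1 - h) x = x - (1 / t\<^sup>2) *\<^sub>R \<pi> (star a) (\<pi> a x)"
      using representation_onD(6)[OF rep x, of "of_real (1 / t\<^sup>2)" "star a * a"]
      unfolding scaleC_of_real
      by (simp add: representation_on_diff[OF rep x] representation_onD(4)[OF rep x] h_def
          representation_onD(7)[OF rep x])
    also have "cinner x \<dots> = of_real ((norm x)\<^sup>2 - (norm (\<pi> a x))\<^sup>2 / t\<^sup>2)"
      using representation_onD(8)[OF rep x representation_on_mem[OF rep x, of a], of "star a"]
      by (simp only: star_star cinner_diff_right cinner_scaleR_right cinner_self)
        (simp add: cinner_self)
    finally have "(norm (\<pi> a x))\<^sup>2 / t\<^sup>2 \<le> (norm x)\<^sup>2"
      by (simp only: Re_complex_of_real diff_ge_0_iff_ge)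
    then have "(norm (\<pi> a x))\<^sup>2 \<le> (t * norm x)\<^sup>2"
      using t0 by (simp add: pos_divide_le_eq power_mult_distrib mult.commute)
    then show ?thesis
      by (rule power2_le_imp_le) (use t0 in simp)
  qed
  then have "norm (\<pi> a x) \<le> (norm a + e) * norm x" if "e > 0" for e
    using that by simp
  then have *: "norm (\<pi> a x) \<le> norm a * norm x + e * norm x" if "e > 0" for e
    using that by (simp add: algebra_simps)
  show ?thesis
  proof (rule field_le_epsilon)
    fix e :: real assume "e > 0"
    have "norm (\<pi> a x) \<le> norm a * norm x + (e / (norm x + 1)) * norm x"
      using \<open>e > 0\<close> by (intro *) (simp add: add_nonneg_pos)
    also have "(e / (norm x + 1)) * norm x \<le> e"
    proof -
      have "e * norm x \<le> e * (norm x + 1)"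
        using \<open>e > 0\<close> by simp
      then show ?thesis
        by (simp add: pos_divide_le_eq add_nonneg_pos)
    qed
    finally show "norm (\<pi> a x) \<le> norm a * norm x + e" by simp
  qed
qed

lemma representation_tendsto:
  assumes rep: "representation_on H \<pi>" and x: "x \<in> H" and a: "a \<longlonglongrightarrow> b"
  shows "(\<lambda>n. \<pi> (a n) x) \<longlonglongrightarrow> \<pi> b x"
proof (rule LIM_zero_cancel, rule Lim_null_comparison)
  show "(\<lambda>n. norm (a n - b) * norm x) \<longlonglongrightarrow> 0"
    using tendsto_mult_right[OF tendsto_norm[OF LIM_zero[OF a]], of "norm x"] by simp
  show "\<forall>\<^sub>F n in sequentially. norm (\<pi> (a n) x - \<pi> b x) \<le> norm (a n - b) * norm x"
    using representation_contractive[OF rep x]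
    by (simp add: representation_on_diff[OF rep x, symmetric])
qed

text \<open>Statements about all elements of a C*-algebra follow from statements about generators and
  their adjoints, provided that they survive algebraic operations and limits.\<close>

lemma generates_cstar_induct [consumes 1, case_names gen gen_star one add scale mult closed]:
  fixes P :: "'a::cstar_algebra \<Rightarrow> bool"
  assumes G: "generates_cstar G"
    and gen: "\<And>g. g \<in> G \<Longrightarrow> P g" "\<And>g. g \<in> G \<Longrightarrow> P (star g)"
    and one: "P 1"
    and add: "\<And>a b. P a \<Longrightarrow> P b \<Longrightarrow> P (a + b)"
    and scale: "\<And>c a. P a \<Longrightarrow> P (c *\<^sub>C a)"
    and mult: "\<And>a b. P a \<Longrightarrow> P b \<Longrightarrow> P (a * b)"
    and lim: "\<And>a b. (\<And>n. P (a n)) \<Longrightarrow> a \<longlonglongrightarrow> b \<Longrightarrow> P b"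
  shows "P a"
proof -
  \<comment> \<open>Closed under \<open>star\<close> by construction.\<close>
  define B where "B = {a. P a \<and> P (star a)}"
  have "P 0" using scale[OF one, of 0] by simp
  have "closed B"
    unfolding closed_sequential_limits B_def
    using lim tendsto_star by (metis (mono_tags, lifting) mem_Collect_eq)
  moreover have "csubspace B"
    using \<open>P 0\<close> add scale by (auto simp: B_def csubspace_def star_add star_scaleC)
  ultimately have "B = UNIV"
    using G gen one mult unfolding generates_cstar_def
    by (elim allE[of _ B] mp) (auto simp: B_def star_star star_mult)
  then show ?thesis by (auto simp: B_def)
qed

lemma representation_unique:
  assumes "generates_cstar {s0, s1}" "representation_on UNIV \<pi>" "representation_on UNIV \<rho>"
    and "\<pi> s0 = \<rho> s0" "\<pi> s1 = \<rho> s1"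
  shows "\<pi> = \<rho>"
proof
  fix a
  have st: "\<pi> (star g) x = \<rho> (star g) x" if "\<pi> g = \<rho> g" for g x
    by (rule cinner_eqI) (metis UNIV_I assms(2,3) cinner_commute representation_onD(8) that)
  show "\<pi> a = \<rho> a"
  proof (rule ext, use assms(1) in \<open>induction rule: generates_cstar_induct\<close>)
    case (closed a b x)
    then show ?case
      using representation_tendsto[OF assms(2), of x a b] representation_tendsto[OF assms(3), of x a b]
      by (simp add: LIMSEQ_unique)
  qed (use assms st in \<open>auto simp: representation_onD\<close>)
qed

lemma representation_invariant_subspace:
  assumes gen: "generates_cstar {s0, s1}" and rep: "representation_on UNIV \<pi>"
    and M: "csubspace M" "closed M"
    and inv: "\<And>g x. g \<in> {s0, s1, star s0, star s1} \<Longrightarrow> x \<in> M \<Longrightarrow> \<pi> g x \<in> M"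
  shows "representation_on M \<pi>"
proof -
  have mem: "\<forall>x\<in>M. \<pi> a x \<in> M" for a
    using gen
  proof (induction rule: generates_cstar_induct)
    case (closed a b)
    show ?case
    proof
      fix x assume "x \<in> M"
      then show "\<pi> b x \<in> M"
        using closed(1)
        by (intro closed_sequentially[OF M(2) _ representation_tendsto[OF rep UNIV_I closed(2)]]) simp
    qed
  qed (use inv rep M(1) in \<open>auto simp: representation_onD csubspace_def\<close>)
  have "bounded_clinear_on M M (\<pi> a)" for a
    using mem representation_onD(3)[OF rep, of a] unfolding bounded_clinear_on_def by (simp, blast)
  then show ?thesis
    using rep M unfolding representation_on_def by simp
qed

lemma intertwiner_generators:
  assumes gen: "generates_cstar {s0, s1}"
    and rep: "representation_on H \<pi>" "representation_on K \<rho>"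
    and T: "bounded_clinear_on H K T"
    and tw: "\<And>g x. g \<in> {s0, s1, star s0, star s1} \<Longrightarrow> x \<in> H \<Longrightarrow> T (\<pi> g x) = \<rho> g (T x)"
  shows "intertwiner H \<pi> K \<rho> T"
proof -
  note TK = bounded_clinear_onD(1)[OF T]
  note mem = representation_on_mem[OF rep(1)]
  have "\<forall>x\<in>H. T (\<pi> a x) = \<rho> a (T x)" for a
    using gen
  proof (induction rule: generates_cstar_induct)
    case (closed a b)
    show ?case
    proof
      fix x assume x: "x \<in> H"
      have "(\<lambda>n. T (\<pi> (a n) x)) \<longlonglongrightarrow> T (\<pi> b x)"
        using representation_tendsto[OF rep(1) x closed(2)] mem[OF x]
        by (intro bounded_clinear_on_tendsto[OF T representation_onD(1)[OF rep(1)]])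
      moreover have "(\<lambda>n. \<rho> (a n) (T x)) \<longlonglongrightarrow> \<rho> b (T x)"
        by (rule representation_tendsto[OF rep(2) TK[OF x] closed(2)])
      ultimately show "T (\<pi> b x) = \<rho> b (T x)"
        using closed(1) x by (simp add: LIMSEQ_unique)
    qed
  qed (use tw TK mem in \<open>auto simp: representation_onD[OF rep(1)] representation_onD[OF rep(2)]
        bounded_clinear_onD[OF T]\<close>)
  with T show ?thesis by (simp add: intertwiner_def)
qed

lemma orth_proj_intertwines:
  assumes rep: "representation_on UNIV \<pi>" and M: "csubspace M" "closed M"
    and inv: "\<And>a x. x \<in> M \<Longrightarrow> \<pi> a x \<in> M"
  shows "orth_proj M (\<pi> a x) = \<pi> a (orth_proj M x)"
proof (rule orth_proj_unique[OF M])
  show "\<pi> a (orth_proj M x) \<in> M" by (intro inv orth_proj_mem M)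
  fix m assume m: "m \<in> M"
  have "cinner m (\<pi> a y) = cinner (\<pi> (star a) m) y" for y
    using representation_onD(8)[OF rep, of m y a] by simp
  then show "cinner m (\<pi> a x - \<pi> a (orth_proj M x)) = 0"
    using orth_proj_cinner[OF M inv[OF m]] by (simp add: cinner_diff_right)
qed

section \<open>Orthonormal sequences indexed by the integers\<close>

text \<open>Orthonormal families indexed by the integers, as for Fourier series; a family is
  total if no nonzero vector is orthogonal to it.\<close>

definition orthonormal_seq :: "(int \<Rightarrow> 'h::complex_inner) \<Rightarrow> bool" where
  "orthonormal_seq f \<longleftrightarrow> (\<forall>m n. cinner (f m) (f n) = (if m = n then 1 else 0))"

definition total_seq :: "(int \<Rightarrow> 'h::complex_inner) \<Rightarrow> bool" where
  "total_seq e \<longleftrightarrow> (\<forall>x. (\<forall>n. cinner (e n) x = 0) \<longrightarrow> x = 0)"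

lemma total_seq_eqI:
  "total_seq e \<Longrightarrow> (\<And>n. cinner (e n) x = cinner (e n) y) \<Longrightarrow> x = y"
  unfolding total_seq_def by (metis cinner_diff_right eq_iff_diff_eq_0)

lemma norm_orthonormal_sum:
  assumes f: "orthonormal_seq f" and F: "finite F"
  shows "(norm (\<Sum>n\<in>F. c n *\<^sub>C f n))\<^sup>2 = (\<Sum>n\<in>F. (cmod (c n))\<^sup>2)"
proof -
  have "complex_of_real ((norm (\<Sum>n\<in>F. c n *\<^sub>C f n))\<^sup>2)
      = (\<Sum>m\<in>F. c m * (\<Sum>n\<in>F. cnj (c n) * cinner (f n) (f m)))"
    by (simp only: cinner_self[symmetric] cinner_sum_left cinner_sum_right cinner_scaleC_left
        cinner_scaleC_right)
  also have "\<dots> = (\<Sum>m\<in>F. c m * (\<Sum>n\<in>F. if n = m then cnj (c n) else 0))"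
    using f by (intro sum.cong arg_cong2[of _ _ _ _ "(*)"] refl) (simp add: orthonormal_seq_def)
  also have "\<dots> = (\<Sum>m\<in>F. c m * cnj (c m))"
    using F by (intro sum.cong refl) (subst sum.delta, auto)
  also have "\<dots> = of_real (\<Sum>n\<in>F. (cmod (c n))\<^sup>2)"
    by (simp only: of_real_sum complex_norm_square)
  finally show ?thesis by (simp only: of_real_eq_iff)
qed

lemma bessel_inequality:
  assumes f: "orthonormal_seq f" and F: "finite F"
  shows "(\<Sum>n\<in>F. (cmod (cinner (f n) x))\<^sup>2) \<le> (norm x)\<^sup>2"
proof -
  define p where "p = (\<Sum>n\<in>F. cinner (f n) x *\<^sub>C f n)"
  have np: "(norm p)\<^sup>2 = (\<Sum>n\<in>F. (cmod (cinner (f n) x))\<^sup>2)"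
    unfolding p_def by (rule norm_orthonormal_sum[OF f F])
  have "cinner p x = (\<Sum>n\<in>F. cinner (f n) x * cnj (cinner (f n) x))"
    unfolding p_def cinner_sum_left cinner_scaleC_left by (simp only: mult.commute)
  also have "\<dots> = of_real ((norm p)\<^sup>2)"
    by (simp only: np of_real_sum complex_norm_square)
  finally have "(norm p)\<^sup>2 \<le> norm p * norm x"
    using norm_cinner_le[of p x] by (simp only: norm_of_real abs_of_nonneg zero_le_power2)
  then have "norm p \<le> norm x"
    by (cases "p = 0") (auto simp: power2_eq_square)
  then show ?thesis
    unfolding np[symmetric] by (intro power_mono) auto
qed

text \<open>The partial isometry that maps the orthonormal sequence \<open>f\<close> to \<open>g\<close> and annihilates the
  orthogonal complement of \<open>f\<close> is the limit of the symmetric partial sums \<open>partial_map f g N\<close>.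
  Exchanging \<open>f\<close> and \<open>g\<close> gives the adjoint.\<close>

definition partial_map :: "(int \<Rightarrow> 'h) \<Rightarrow> (int \<Rightarrow> 'h) \<Rightarrow> nat \<Rightarrow> 'h::chilbert_space \<Rightarrow> 'h" where
  "partial_map f g N x = (\<Sum>n\<in>{- int N..int N}. cinner (f n) x *\<^sub>C g n)"

definition orthonormal_map :: "(int \<Rightarrow> 'h) \<Rightarrow> (int \<Rightarrow> 'h) \<Rightarrow> 'h::chilbert_space \<Rightarrow> 'h" where
  "orthonormal_map f g x = lim (\<lambda>N. partial_map f g N x)"

lemma partial_map_tendsto:
  assumes f: "orthonormal_seq f" and g: "orthonormal_seq g"
  shows "(\<lambda>N. partial_map f g N x) \<longlonglongrightarrow> orthonormal_map f g x"
proof -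
  define a where "a N = (\<Sum>n\<in>{- int N..int N}. (cmod (cinner (f n) x))\<^sup>2)" for N
  have "incseq a"
    unfolding a_def by (intro incseq_SucI sum_mono2) auto
  moreover have "a N \<le> (norm x)\<^sup>2" for N
    unfolding a_def by (rule bessel_inequality[OF f]) simp
  ultimately have "convergent a"
    by (metis convergentI incseq_convergent)
  then have Ca: "Cauchy a" by (rule convergent_Cauchy)
  have *: "(dist (partial_map f g M x) (partial_map f g N x))\<^sup>2 = dist (a M) (a N)" if "M \<le> N" for M N
  proof -
    have sub: "{- int M..int M} \<subseteq> {- int N..int N}" using that by auto
    have "partial_map f g N x - partial_map f g M x
        = (\<Sum>n\<in>{- int N..int N} - {- int M..int M}. cinner (f n) x *\<^sub>C g n)"
      unfolding partial_map_def using sub by (subst sum_diff) auto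
    moreover have "a N - a M = (\<Sum>n\<in>{- int N..int N} - {- int M..int M}. (cmod (cinner (f n) x))\<^sup>2)"
      unfolding a_def using sub by (subst sum_diff) auto
    moreover have "a M \<le> a N" using \<open>incseq a\<close> that by (rule incseqD)
    ultimately show ?thesis
      unfolding dist_norm norm_minus_commute[of "partial_map f g M x"] norm_minus_commute[of "a M"]
      by (simp add: norm_orthonormal_sum[OF g] sum_nonneg)
  qed
  have "Cauchy (\<lambda>N. partial_map f g N x)"
    unfolding Cauchy_altdef2
  proof (intro allI impI)
    fix e :: real assume e: "e > 0"
    then obtain N where N: "\<And>n. n \<ge> N \<Longrightarrow> dist (a n) (a N) < e\<^sup>2"
      using Ca unfolding Cauchy_altdef2 by (meson zero_less_power)
    have "dist (partial_map f g n x) (partial_map f g N x) < e" if "n \<ge> N" for n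
      using N[OF that] *[OF that] e by (simp add: dist_commute power2_less_imp_less)
    then show "\<exists>N. \<forall>n\<ge>N. dist (partial_map f g n x) (partial_map f g N x) < e" by blast
  qed
  then show ?thesis
    unfolding orthonormal_map_def by (simp add: Cauchy_convergent_iff convergent_LIMSEQ_iff)
qed

lemma orthonormal_map_bounded_clinear:
  assumes f: "orthonormal_seq f" and g: "orthonormal_seq g"
  shows "bounded_clinear_on UNIV UNIV (orthonormal_map f g)"
  unfolding bounded_clinear_on_def
proof (intro conjI ballI allI exI)
  note lim = partial_map_tendsto[OF f g]
  fix x y :: 'a and c
  have "partial_map f g N (x + y) = partial_map f g N x + partial_map f g N y" for N
    by (simp add: partial_map_def cinner_add_right scaleC_add_left sum.distrib)
  then show "orthonormal_map f g (x + y) = orthonormal_map f g x + orthonormal_map f g y"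
    using lim[of "x + y"] tendsto_add[OF lim[of x] lim[of y]] by (simp add: LIMSEQ_unique)
  have "partial_map f g N (c *\<^sub>C x) = c *\<^sub>C partial_map f g N x" for N
    by (simp add: partial_map_def cinner_scaleC_right scaleC_sum_right scaleC_scaleC)
  then show "orthonormal_map f g (c *\<^sub>C x) = c *\<^sub>C orthonormal_map f g x"
    using lim[of "c *\<^sub>C x"] tendsto_scaleC[OF lim[of x], of c] by (simp add: LIMSEQ_unique)
  have "(norm (partial_map f g N x))\<^sup>2 \<le> (norm x)\<^sup>2" for N
    unfolding partial_map_def norm_orthonormal_sum[OF g finite_atLeastAtMost_int]
    by (rule bessel_inequality[OF f]) simp
  then have "norm (partial_map f g N x) \<le> norm x" for N
    by (rule power2_le_imp_le) simp
  then show "norm (orthonormal_map f g x) \<le> 1 * norm x"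
    using LIMSEQ_le_const2[OF tendsto_norm[OF lim[of x]]] by simp
qed simp

lemma orthonormal_map_adjoint:
  assumes f: "orthonormal_seq f" and g: "orthonormal_seq g"
  shows "cinner (orthonormal_map f g x) y = cinner x (orthonormal_map g f y)"
proof -
  have "cinner (partial_map f g N x) y = cinner x (partial_map g f N y)" for N
    unfolding partial_map_def cinner_sum_left cinner_sum_right cinner_scaleC_left cinner_scaleC_right
    by (intro sum.cong refl) (metis cinner_commute mult.commute)
  moreover have "(\<lambda>N. cinner (partial_map f g N x) y) \<longlonglongrightarrow> cinner (orthonormal_map f g x) y"
    by (intro tendsto_intros partial_map_tendsto f g)
  moreover have "(\<lambda>N. cinner x (partial_map g f N y)) \<longlonglongrightarrow> cinner x (orthonormal_map g f y)"
    by (intro tendsto_intros partial_map_tendsto f g)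
  ultimately show ?thesis by (simp add: LIMSEQ_unique)
qed

lemma orthonormal_map_apply:
  assumes f: "orthonormal_seq f" and g: "orthonormal_seq g"
  shows "orthonormal_map f g (f m) = g m"
proof -
  have "partial_map f g N (f m) = g m" if "N \<ge> nat \<bar>m\<bar>" for N
  proof -
    have "partial_map f g N (f m) = (\<Sum>n\<in>{- int N..int N}. if n = m then g n else 0)"
      unfolding partial_map_def using f by (intro sum.cong) (auto simp: orthonormal_seq_def)
    also have "\<dots> = g m" using that by (subst sum.delta) auto
    finally show ?thesis .
  qed
  then have "\<forall>\<^sub>F N in sequentially. partial_map f g N (f m) = g m"
    by (auto simp: eventually_sequentially)
  then have "(\<lambda>N. partial_map f g N (f m)) \<longlonglongrightarrow> g m"
    by (rule tendsto_eventually)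
  with partial_map_tendsto[OF f g] show ?thesis
    by (rule LIMSEQ_unique)
qed

lemma orthonormal_map_coeff:
  assumes f: "orthonormal_seq f" and g: "orthonormal_seq g"
  shows "cinner (g n) (orthonormal_map f g x) = cinner (f n) x"
  by (metis orthonormal_map_adjoint[OF g f] orthonormal_map_apply[OF g f])

lemma orthonormal_map_id:
  assumes "orthonormal_seq e" "total_seq e"
  shows "orthonormal_map e e x = x"
  using orthonormal_map_coeff[OF assms(1,1)] by (rule total_seq_eqI[OF assms(2)])

lemma bounded_clinear_eq_on_total:
  fixes e :: "int \<Rightarrow> 'h::chilbert_space"
  assumes e: "orthonormal_seq e" "total_seq e"
    and A: "bounded_clinear_on UNIV UNIV A" and B: "bounded_clinear_on UNIV UNIV B"
    and eq: "\<And>n. A (e n) = B (e n)"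
  shows "A x = B x"
proof -
  have "A (partial_map e e N x) = B (partial_map e e N x)" for N
    unfolding partial_map_def bounded_clinear_sum[OF A] bounded_clinear_sum[OF B]
    by (simp add: bounded_clinear_onD(3)[OF A] bounded_clinear_onD(3)[OF B] eq)
  moreover have "(\<lambda>N. partial_map e e N x) \<longlonglongrightarrow> x"
    using partial_map_tendsto[OF e(1,1), of x] orthonormal_map_id[OF e, of x] by simp
  then have "(\<lambda>N. A (partial_map e e N x)) \<longlonglongrightarrow> A x" "(\<lambda>N. B (partial_map e e N x)) \<longlonglongrightarrow> B x"
    by (auto intro!: bounded_clinear_on_tendsto[OF A csubspace_UNIV]
        bounded_clinear_on_tendsto[OF B csubspace_UNIV])
  ultimately show ?thesis by (simp add: LIMSEQ_unique)
qed


section \<open>The Fourier basis of the circle\<close>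

lemma borel_measurable_power_int [measurable]: "(\<lambda>z::complex. z powi n) \<in> borel_measurable borel"
  unfolding power_int_def by measurable

lemma cmod_power_int_circle: "cmod z = 1 \<Longrightarrow> cmod (z powi n) = 1"
  by (simp add: norm_power_int)

lemma cnj_eq_inverse: "cmod z = 1 \<Longrightarrow> cnj z = inverse z"
  by (metis complex_norm_square inverse_unique of_real_1 power_one)

lemma integrable_circle_mult_bounded:
  fixes f g :: "complex \<Rightarrow> complex"
  assumes f: "integrable circle_measure f" and g: "g \<in> borel_measurable borel"
    and B: "\<And>z. cmod z = 1 \<Longrightarrow> cmod (g z) \<le> B"
  shows "integrable circle_measure (\<lambda>z. g z * f z)"
proof (rule Bochner_Integration.integrable_bound)
  show "integrable circle_measure (\<lambda>z. of_real B * f z)" using f by simp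
  show "(\<lambda>z. g z * f z) \<in> borel_measurable circle_measure"
    using f borel_measurable_circle[OF g] by (intro borel_measurable_times) auto
  show "AE z in circle_measure. norm (g z * f z) \<le> norm (of_real B * f z)"
  proof (rule AE_I2)
    fix z assume "z \<in> space circle_measure"
    then have "cmod (g z) \<le> \<bar>B\<bar>" using B[of z] by (simp add: space_circle_measure)
    then show "norm (g z * f z) \<le> norm (of_real B * f z)"
      by (simp add: norm_mult mult_right_mono)
  qed
qed

lemma integrable_circle_mult_continuous:
  fixes f g :: "complex \<Rightarrow> complex"
  assumes f: "integrable circle_measure f" and g: "continuous_on UNIV g"
  shows "integrable circle_measure (\<lambda>z. g z * f z)"
proof -
  have "bounded (g ` sphere 0 1)"
    using g by (intro compact_imp_bounded compact_continuous_image) (auto intro: continuous_on_subset)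
  then obtain B where "\<And>z. z \<in> sphere 0 1 \<Longrightarrow> cmod (g z) \<le> B"
    unfolding bounded_iff by blast
  then show ?thesis
    by (intro integrable_circle_mult_bounded[OF f borel_measurable_continuous_onI[OF g]]) auto
qed

lemma integral_circle:
  fixes f :: "complex \<Rightarrow> complex"
  assumes f: "f \<in> borel_measurable circle_measure"
  shows "(\<integral>z. f z \<partial>circle_measure)
    = (1 / (2 * pi)) *\<^sub>R (\<integral>t. indicator {0..<2 * pi} t *\<^sub>R f (cis t) \<partial>lborel)"
proof -
  have f': "f \<in> borel_measurable (restrict_space borel (sphere 0 1))"
    using f by (simp add: measurable_cong_sets[OF sets_circle_measure refl])
  have fc [measurable]: "(\<lambda>t. f (cis t)) \<in> borel_measurable borel"
    using measurable_compose[OF cis_measurable_circle f'] .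
  have u: "uniform_measure lborel {0..<2 * pi}
      = density lborel (\<lambda>t. ennreal (indicator {0..<2 * pi} t / (2 * pi)))"
    unfolding uniform_measure_def
    by (intro density_cong AE_I2) (auto simp: indicator_def divide_ennreal[symmetric] ennreal_1[symmetric]
        simp del: ennreal_1)
  have "(\<integral>z. f z \<partial>circle_measure) = (\<integral>t. f (cis t) \<partial>uniform_measure lborel {0..<2 * pi})"
    unfolding circle_measure_def
    by (rule integral_distr) (use f' cis_measurable_circle in
      \<open>auto simp: measurable_cong_sets[OF sets_uniform_measure refl]\<close>)
  also have "\<dots> = (\<integral>t. (indicator {0..<2 * pi} t / (2 * pi)) *\<^sub>R f (cis t) \<partial>lborel)"
    unfolding u by (subst integral_density) auto
  also have "\<dots> = (\<integral>t. (1 / (2 * pi)) *\<^sub>R (indicator {0..<2 * pi} t *\<^sub>R f (cis t)) \<partial>lborel)"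
    by simp
  finally show ?thesis by (simp only: integral_scaleR_right)
qed

lemma integral_circle_power_int:
  "(\<integral>z. z powi n \<partial>circle_measure) = (if n = 0 then 1 else 0)"
proof (cases "n = 0")
  case True
  have "measure circle_measure (space circle_measure) = 1"
    using emeasure_circle_space by (simp add: measure_def)
  with True show ?thesis by simp
next
  case False
  define F where "F t = cis (of_int n * t) / (\<i> * of_int n)" for t
  have cisd: "(cis has_vector_derivative \<i> * cis t) (at t)" for t
  proof -
    have "((\<lambda>t. complex_of_real (cos t) + \<i> * complex_of_real (sin t)) has_vector_derivative
        complex_of_real (- sin t) + \<i> * complex_of_real (cos t)) (at t)"
      by (intro has_vector_derivative_add has_vector_derivative_mult_right has_vector_derivative_of_real)
        (auto intro!: derivative_eq_intros)
    moreover have "(\<lambda>t. complex_of_real (cos t) + \<i> * complex_of_real (sin t)) = cis"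
      by (auto simp: complex_eq_iff)
    moreover have "complex_of_real (- sin t) + \<i> * complex_of_real (cos t) = \<i> * cis t"
      by (auto simp: complex_eq_iff)
    ultimately show ?thesis by simp
  qed
  have Fd: "(F has_vector_derivative cis (of_int n * t)) (at t within {0..2 * pi})" for t
  proof -
    have "(cis \<circ> (\<lambda>t. of_int n * t) has_vector_derivative of_int n *\<^sub>R (\<i> * cis (of_int n * t))) (at t)"
      by (rule vector_diff_chain_at[OF _ cisd]) (auto intro!: derivative_eq_intros)
    then have "((\<lambda>t. (cis \<circ> (\<lambda>t. of_int n * t)) t / (\<i> * of_int n))
        has_vector_derivative (of_int n *\<^sub>R (\<i> * cis (of_int n * t))) / (\<i> * of_int n)) (at t)"
      by (rule has_vector_derivative_divide)
    moreover have "(of_int n *\<^sub>R (\<i> * cis (of_int n * t))) / (\<i> * of_int n) = cis (of_int n * t)"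
      using False by (simp add: scaleR_conv_of_real)
    ultimately show ?thesis
      unfolding F_def[abs_def] by (simp add: has_vector_derivative_at_within o_def)
  qed
  have cm: "(\<lambda>t. cis (of_int n * t)) \<in> borel_measurable borel"
    by (intro borel_measurable_continuous_onI continuous_intros)
  have "(\<integral>t. indicator {0..2 * pi} t *\<^sub>R cis (of_int n * t) \<partial>lborel) = F (2 * pi) - F 0"
    by (intro integral_FTC_Icc Fd) (auto intro!: continuous_intros)
  also have "cis (of_int n * (2 * pi)) = 1"
    using cis_power_int[of "2 * pi" n] by simp
  then have "F (2 * pi) - F 0 = 0" by (simp add: F_def)
  also have "(\<integral>t. indicator {0..2 * pi} t *\<^sub>R cis (of_int n * t) \<partial>lborel)
      = (\<integral>t. indicator {0..<2 * pi} t *\<^sub>R cis (of_int n * t) \<partial>lborel)"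
  proof (rule integral_cong_AE)
    show "AE t in lborel. indicator {0..2 * pi} t *\<^sub>R cis (of_int n * t)
        = indicator {0..<2 * pi} t *\<^sub>R cis (of_int n * t)"
      using AE_lborel_singleton[of "2 * pi"] by eventually_elim (auto simp: indicator_def)
  qed (use cm in auto)
  finally show ?thesis
    using False by (subst integral_circle) (auto simp: cis_power_int borel_measurable_circle)
qed

text \<open>Uniqueness of Fourier coefficients: an integrable function all of whose Fourier coefficients
  vanish is orthogonal to every polynomial in \<open>Re z\<close> and \<open>Im z\<close>, hence (Stone--Weierstrass) to every continuous function, hence
  to indicators of closed sets and then of all Borel sets. For the first step, multiplication by
  a polynomial preserves the class of functions with vanishing coefficients.\<close>

lemma circle_moments_polynomial:
  fixes f :: "complex \<Rightarrow> complex"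
  assumes p: "real_polynomial_function p" and f: "integrable circle_measure f"
    and mom: "\<And>n. (\<integral>z. z powi n * f z \<partial>circle_measure) = 0"
  shows "(\<integral>z. z powi n * (of_real (p z) * f z) \<partial>circle_measure) = 0"
  using assms
proof (induction p arbitrary: f n)
  case (linear p)
  \<comment> \<open>On the circle a real linear form is \<open>\<alpha> z + \<beta> / z\<close>, so it shifts the coefficients by 1.\<close>
  define \<alpha> where "\<alpha> = (of_real (p 1) - \<i> * of_real (p \<i>)) / 2"
  define \<beta> where "\<beta> = (of_real (p 1) + \<i> * of_real (p \<i>)) / 2"
  have int: "integrable circle_measure (\<lambda>z. z powi k * f z)" for k
    by (rule integrable_circle_mult_bounded[OF linear(2), of _ 1]) (auto simp: cmod_power_int_circle)
  have pz: "of_real (p z) = \<alpha> * z + \<beta> * cnj z" for z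
  proof -
    have "p z = p (Re z *\<^sub>R 1 + Im z *\<^sub>R \<i>)"
      by (rule arg_cong[of _ _ p]) (simp add: complex_eq_iff)
    also have "\<dots> = Re z * p 1 + Im z * p \<i>"
      using linear(1) by (simp add: linear_simps)
    finally show ?thesis
      by (simp add: \<alpha>_def \<beta>_def complex_eq_iff field_simps)
  qed
  have "(\<integral>z. z powi n * (of_real (p z) * f z) \<partial>circle_measure)
      = (\<integral>z. \<alpha> * (z powi (n + 1) * f z) + \<beta> * (z powi (n - 1) * f z) \<partial>circle_measure)"
  proof (rule Bochner_Integration.integral_cong)
    fix z assume "z \<in> space circle_measure"
    then have z: "cmod z = 1" by (simp add: space_circle_measure)
    then have "z \<noteq> 0" by auto
    moreover have "cnj z = inverse z"
      using z by (rule cnj_eq_inverse)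
    ultimately show "z powi n * (of_real (p z) * f z)
        = \<alpha> * (z powi (n + 1) * f z) + \<beta> * (z powi (n - 1) * f z)"
      by (simp add: pz power_int_add power_int_diff field_simps)
  qed simp
  then show ?case using int linear(3) by simp
next
  case (const c)
  then show ?case by (simp add: mult.left_commute[of _ "complex_of_real c"])
next
  case (add p q)
  have int: "integrable circle_measure (\<lambda>z. z powi n * (of_real (r z) * f z))"
    if "real_polynomial_function r" for r
    using that
    by (intro integrable_circle_mult_bounded[where B = 1] integrable_circle_mult_continuous add.prems)
      (auto simp: cmod_power_int_circle intro!: continuous_intros continuous_real_polymonial_function
        continuous_at_imp_continuous_on)
  have "z powi n * (of_real (p z + q z) * f z)
      = z powi n * (of_real (p z) * f z) + z powi n * (of_real (q z) * f z)" for z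
    by (simp add: algebra_simps)
  then show ?case using add int by simp
next
  case (mult p q)
  have "integrable circle_measure (\<lambda>z. of_real (q z) * f z)"
    using mult.hyps by (intro integrable_circle_mult_continuous mult.prems)
      (auto intro!: continuous_intros continuous_real_polymonial_function continuous_at_imp_continuous_on)
  then have "(\<integral>z. z powi n * (of_real (p z) * (of_real (q z) * f z)) \<partial>circle_measure) = 0"
    using mult by blast
  then show ?case by (simp add: mult.assoc)
qed

lemma circle_moments_continuous:
  fixes f :: "complex \<Rightarrow> complex"
  assumes f: "integrable circle_measure f"
    and mom: "\<And>n. (\<integral>z. z powi n * f z \<partial>circle_measure) = 0"
    and g: "continuous_on UNIV (g :: complex \<Rightarrow> real)"
  shows "(\<integral>z. of_real (g z) * f z \<partial>circle_measure) = 0"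
proof (rule ccontr)
  assume ne: "(\<integral>z. of_real (g z) * f z \<partial>circle_measure) \<noteq> 0"
  define I where "I = (\<integral>z. cmod (f z) \<partial>circle_measure)"
  have I0: "0 \<le> I" by (simp add: I_def)
  have int: "integrable circle_measure (\<lambda>z. of_real (h z) * f z)" if "continuous_on UNIV h" for h :: "complex \<Rightarrow> real"
    using that by (intro integrable_circle_mult_continuous f) (auto intro!: continuous_intros)
  define e where "e = cmod (\<integral>z. of_real (g z) * f z \<partial>circle_measure) / (I + 1)"
  have e: "e > 0" using ne I0 by (simp add: e_def)
  obtain p where p: "real_polynomial_function p" "\<And>z. z \<in> sphere 0 1 \<Longrightarrow> \<bar>g z - p z\<bar> < e"
    using Stone_Weierstrass_real_polynomial_function[of "sphere (0::complex) 1" g e] e g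
    by (auto intro: continuous_on_subset)
  have pc: "continuous_on UNIV p"
    using p(1) by (auto intro!: continuous_at_imp_continuous_on continuous_real_polymonial_function)
  have "(\<integral>z. of_real (p z) * f z \<partial>circle_measure) = 0"
    using circle_moments_polynomial[OF p(1) f mom, of 0] by simp
  then have "(\<integral>z. of_real (g z) * f z \<partial>circle_measure)
      = (\<integral>z. of_real (g z) * f z - of_real (p z) * f z \<partial>circle_measure)"
    using int[OF g] int[OF pc] by simp
  also have "cmod \<dots> \<le> (\<integral>z. e * cmod (f z) \<partial>circle_measure)"
  proof (rule Bochner_Integration.integral_norm_bound_integral)
    show "integrable circle_measure (\<lambda>z. of_real (g z) * f z - of_real (p z) * f z)"
      using int[OF g] int[OF pc] by simp
    show "integrable circle_measure (\<lambda>z. e * cmod (f z))" using f by simp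
    fix z assume "z \<in> space circle_measure"
    then have "\<bar>g z - p z\<bar> \<le> e" using p(2)[of z] by (simp add: space_circle_measure)
    moreover have "of_real (g z) * f z - of_real (p z) * f z = of_real (g z - p z) * f z"
      by (simp add: algebra_simps)
    ultimately show "cmod (of_real (g z) * f z - of_real (p z) * f z) \<le> e * cmod (f z)"
      by (simp only: norm_mult norm_of_real) (simp add: mult_right_mono)
  qed
  also have "\<dots> = e * I" by (simp add: I_def)
  also have "\<dots> < e * (I + 1)" using e by simp
  also have "\<dots> = cmod (\<integral>z. of_real (g z) * f z \<partial>circle_measure)"
    using I0 by (simp add: e_def)
  finally show False by simp
qed

lemma circle_moments_indicator:
  fixes f :: "complex \<Rightarrow> complex"
  assumes f: "integrable circle_measure f"
    and mom: "\<And>n. (\<integral>z. z powi n * f z \<partial>circle_measure) = 0"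
    and A: "A \<in> sets borel"
  shows "(\<integral>z. indicator A z * f z \<partial>circle_measure) = 0"
proof -
  have ind: "integrable circle_measure (\<lambda>z. indicator A z * f z)" if "A \<in> sets borel" for A
    using that by (intro integrable_circle_mult_bounded[OF f, where B = 1]) (auto simp: indicator_def)
  have sf: "Int_stable (Collect closed :: complex set set)"
    by (auto simp: Int_stable_def)
  have sP: "Collect closed \<subseteq> Pow (UNIV :: complex set)"
    by simp
  have A': "A \<in> sigma_sets UNIV (Collect closed)"
    using A by (simp add: borel_eq_closed)
  have sb: "sigma_sets UNIV (Collect closed) = sets (borel :: complex measure)"
    by (simp add: borel_eq_closed)
  show ?thesis
    using sf sP A'
  proof (induction rule: sigma_sets_induct_disjoint)
    case (basic A)
    then have cl: "closed A" by simp
    show ?case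
    proof (cases "A = {}")
      case False
      define g where "g k z = max 0 (1 - real k * infdist z A)" for k z
      have gc: "continuous_on UNIV (g k)" for k
        unfolding g_def[abs_def] by (intro continuous_intros)
      have g01: "0 \<le> g k z" "g k z \<le> 1" for k z
        by (auto simp: g_def infdist_nonneg)
      have lim: "(\<lambda>k. complex_of_real (g k z)) \<longlonglongrightarrow> indicator A z" for z
      proof (cases "z \<in> A")
        case True
        then show ?thesis by (simp add: g_def)
      next
        case False
        then have d: "infdist z A > 0"
          using in_closed_iff_infdist_zero[OF cl \<open>A \<noteq> {}\<close>, of z] infdist_nonneg[of z A] by linarith
        obtain N where N: "1 < real N * infdist z A"
          using reals_Archimedean3[OF d] by blast
        have "g k z = 0" if "k \<ge> N" for k
        proof -
          have "real N * infdist z A \<le> real k * infdist z A"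
            using that d by (intro mult_right_mono) auto
          with N show ?thesis by (simp add: g_def)
        qed
        then have "\<forall>\<^sub>F k in sequentially. complex_of_real (g k z) = 0"
          by (auto simp: eventually_sequentially)
        with False show ?thesis by (simp add: tendsto_eventually)
      qed
      have "(\<lambda>k. \<integral>z. of_real (g k z) * f z \<partial>circle_measure)
          \<longlonglongrightarrow> (\<integral>z. indicator A z * f z \<partial>circle_measure)"
      proof (rule integral_dominated_convergence[where w = "\<lambda>z. cmod (f z)"])
        show "(\<lambda>z. indicator A z * f z) \<in> borel_measurable circle_measure"
          using ind[of A] cl by auto
        show "(\<lambda>z. of_real (g k z) * f z) \<in> borel_measurable circle_measure" for k
          using integrable_circle_mult_continuous[OF f, of "\<lambda>z. of_real (g k z)"] gc
          by (auto intro!: continuous_intros)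
        show "integrable circle_measure (\<lambda>z. cmod (f z))" using f by simp
        show "AE z in circle_measure. (\<lambda>k. of_real (g k z) * f z) \<longlonglongrightarrow> indicator A z * f z"
          by (intro AE_I2 tendsto_intros lim)
        show "AE z in circle_measure. norm (of_real (g k z) * f z) \<le> cmod (f z)" for k
          using g01 by (intro AE_I2) (simp add: norm_mult mult_left_le_one_le)
      qed
      then show ?thesis
        by (simp add: circle_moments_continuous[OF f mom gc] LIMSEQ_const_iff)
    qed simp
  next
    case empty
    show ?case by simp
  next
    case (compl A)
    have "(\<integral>z. indicator (UNIV - A) z * f z \<partial>circle_measure)
        = (\<integral>z. f z - indicator A z * f z \<partial>circle_measure)"
      by (intro Bochner_Integration.integral_cong) (auto simp: indicator_def)
    then show ?case
      using f ind[of A] compl mom[of 0] by (simp add: sb)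
  next
    case (union A)
    have Ab: "A i \<in> sets borel" for i using union(2) by (auto simp: sb)
    have im: "A i \<inter> sphere 0 1 \<in> sets circle_measure" for i
      unfolding sets_circle_measure sets_restrict_space using Ab[of i] by auto
    have eq: "indicator (B \<inter> sphere 0 1) z *\<^sub>R f z = indicator B z * f z"
      if "z \<in> space circle_measure" for B z
      using that by (auto simp: indicator_def space_circle_measure)
    have "(\<integral>z\<in>(\<Union>i. A i \<inter> sphere 0 1). f z \<partial>circle_measure)
        = (\<Sum>i. (\<integral>z\<in>(A i \<inter> sphere 0 1). f z \<partial>circle_measure))"
    proof (rule lebesgue_integral_countable_add[OF im])
      show "A i \<inter> sphere 0 1 \<inter> (A j \<inter> sphere 0 1) = {}" if "i \<noteq> j" for i j
        using union(1) that by (auto simp: disjoint_family_on_def)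
      have "integrable circle_measure (\<lambda>z. indicator (\<Union> (range A)) z * f z)"
        using Ab by (intro ind) auto
      then show "set_integrable circle_measure (\<Union>i. A i \<inter> sphere 0 1) f"
        unfolding set_integrable_def
        by (subst Bochner_Integration.integrable_cong[OF refl, of _ _ "\<lambda>z. indicator (\<Union> (range A)) z * f z"])
          (auto simp: indicator_def space_circle_measure)
    qed
    moreover have "(\<integral>z\<in>(A i \<inter> sphere 0 1). f z \<partial>circle_measure) = 0" for i
      unfolding set_lebesgue_integral_def
      using union(3)[of i] by (subst Bochner_Integration.integral_cong[OF refl eq]) auto
    moreover have "(\<integral>z\<in>(\<Union>i. A i \<inter> sphere 0 1). f z \<partial>circle_measure)
        = (\<integral>z. indicator (\<Union> (range A)) z * f z \<partial>circle_measure)"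
      unfolding set_lebesgue_integral_def
      by (rule Bochner_Integration.integral_cong) (auto simp: indicator_def space_circle_measure)
    ultimately show ?case by simp
  qed
qed

lemma circle_moments_zero:
  fixes f :: "complex \<Rightarrow> complex"
  assumes f: "integrable circle_measure f"
    and mom: "\<And>n. (\<integral>z. z powi n * f z \<partial>circle_measure) = 0"
  shows "AE z in circle_measure. f z = 0"
proof -
  have zero: "(\<integral>z. indicator A z *\<^sub>R f z \<partial>circle_measure) = 0"
    "integrable circle_measure (\<lambda>z. indicator A z *\<^sub>R f z)" if A: "A \<in> sets circle_measure" for A
  proof -
    obtain B where B: "B \<in> sets borel" "A = B \<inter> sphere 0 1"
      using A by (auto simp: sets_circle_measure sets_restrict_space)
    have eq: "indicator A z *\<^sub>R f z = indicator B z * f z" if "z \<in> space circle_measure" for z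
      using that by (auto simp: B indicator_def space_circle_measure)
    show "(\<integral>z. indicator A z *\<^sub>R f z \<partial>circle_measure) = 0"
      using circle_moments_indicator[OF f mom B(1)]
      by (subst Bochner_Integration.integral_cong[OF refl eq]) auto
    show "integrable circle_measure (\<lambda>z. indicator A z *\<^sub>R f z)"
      using A f by (rule integrable_mult_indicator)
  qed
  have "AE z in circle_measure. Re (f z) = 0"
  proof (rule density_unique_real)
    fix A assume A: "A \<in> sets circle_measure"
    have "(\<integral>z\<in>A. Re (f z) \<partial>circle_measure) = Re (\<integral>z. indicator A z *\<^sub>R f z \<partial>circle_measure)"
      unfolding set_lebesgue_integral_def using zero(2)[OF A]
      by (subst integral_Re[symmetric]) auto
    then show "(\<integral>z\<in>A. Re (f z) \<partial>circle_measure) = (\<integral>z\<in>A. 0 \<partial>circle_measure)"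
      by (simp add: zero(1)[OF A])
  qed (use f in auto)
  moreover have "AE z in circle_measure. Im (f z) = 0"
  proof (rule density_unique_real)
    fix A assume A: "A \<in> sets circle_measure"
    have "(\<integral>z\<in>A. Im (f z) \<partial>circle_measure) = Im (\<integral>z. indicator A z *\<^sub>R f z \<partial>circle_measure)"
      unfolding set_lebesgue_integral_def using zero(2)[OF A]
      by (subst integral_Im[symmetric]) auto
    then show "(\<integral>z\<in>A. Im (f z) \<partial>circle_measure) = (\<integral>z\<in>A. 0 \<partial>circle_measure)"
      by (simp add: zero(1)[OF A])
  qed (use f in auto)
  ultimately show ?thesis
    by eventually_elim (simp add: complex_eq_iff)
qed

text \<open>The basis vector \<open>e\<^sub>n\<close>.\<close>

definition fourier :: "int \<Rightarrow> L2_circle" where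
  "fourier n = abs_L2_circle (\<lambda>z. z powi n)"

lemma square_integrable_power_int: "square_integrable (\<lambda>z. z powi n)"
  unfolding square_integrable_def
proof
  show "(\<lambda>z. z powi n) \<in> borel_measurable circle_measure"
    by (rule borel_measurable_circle) measurable
  show "integrable circle_measure (\<lambda>z. (cmod (z powi n))\<^sup>2)"
    by (subst Bochner_Integration.integrable_cong[OF refl, of _ _ "\<lambda>_. 1"])
      (auto simp: space_circle_measure cmod_power_int_circle)
qed

lemma cnj_power_int_circle:
  assumes "z \<in> space circle_measure"
  shows "cnj (z powi n) = z powi (- n)"
proof -
  have "cmod z = 1" using assms by (simp add: space_circle_measure)
  then have "cnj z = inverse z" by (rule cnj_eq_inverse)
  then show ?thesis by (simp add: power_int_minus power_int_inverse)
qed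

lemma cinner_fourier:
  assumes "square_integrable f"
  shows "cinner (fourier n) (abs_L2_circle f) = (\<integral>z. z powi (- n) * f z \<partial>circle_measure)"
proof -
  have "cinner (fourier n) (abs_L2_circle f) = (\<integral>z. cnj (z powi n) * f z \<partial>circle_measure)"
    unfolding fourier_def
    by (simp add: cinner_L2_circle.abs_eq L2_rel_refl square_integrable_power_int assms)
  also have "\<dots> = (\<integral>z. z powi (- n) * f z \<partial>circle_measure)"
    by (rule Bochner_Integration.integral_cong) (simp_all only: cnj_power_int_circle)
  finally show ?thesis .
qed

lemma orthonormal_fourier: "orthonormal_seq fourier"
  unfolding orthonormal_seq_def
proof (intro allI)
  fix m n
  have "cinner (fourier m) (fourier n) = (\<integral>z. z powi (- m) * z powi n \<partial>circle_measure)"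
    unfolding fourier_def[of n] by (rule cinner_fourier[OF square_integrable_power_int])
  also have "\<dots> = (\<integral>z. z powi (n - m) \<partial>circle_measure)"
  proof (rule Bochner_Integration.integral_cong)
    fix z assume "z \<in> space circle_measure"
    then have "z \<noteq> 0" by (auto simp: space_circle_measure)
    then show "z powi (- m) * z powi n = z powi (n - m)"
      by (simp flip: power_int_add)
  qed simp
  also have "\<dots> = (if m = n then 1 else 0)"
    by (simp add: integral_circle_power_int)
  finally show "cinner (fourier m) (fourier n) = (if m = n then 1 else 0)" .
qed

lemma total_fourier: "total_seq fourier"
  unfolding total_seq_def
proof (intro allI impI)
  fix x assume x: "\<forall>n. cinner (fourier n) x = 0"
  obtain f where f: "square_integrable f" "x = abs_L2_circle f" by (rule L2_circle_cases)
  have "square_integrable (\<lambda>_. 1)" using square_integrable_power_int[of 0] by simp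
  from square_integrable_mult[OF this f(1)] have "integrable circle_measure f" by simp
  moreover have "(\<integral>z. z powi n * f z \<partial>circle_measure) = 0" for n
    using cinner_fourier[OF f(1), of "- n"] x f(2) by simp
  ultimately have "AE z in circle_measure. f z = 0"
    by (rule circle_moments_zero)
  then have "L2_rel f (\<lambda>_. 0)"
    using f(1) by (simp add: L2_rel_def square_integrable_zero)
  then show "x = 0"
    unfolding f(2) zero_L2_circle_def by (simp add: Quotient_rel_abs[OF Quotient_L2_circle])
qed

section \<open>The wavelet operators in the Fourier basis\<close>

text \<open>The coefficient of \<open>z\<^sup>j\<close> in the filter \<open>m\<^sub>i\<close>, for \<open>i < 2\<close> and \<open>j < 4\<close>.\<close>

definition filter_coeff :: "real \<Rightarrow> nat \<Rightarrow> nat \<Rightarrow> real" where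
  "filter_coeff \<theta> i j = (if i = 0 then coeff_a \<theta> j else (- 1) ^ j * coeff_a \<theta> (3 - j))"

text \<open>The two generators as one family; any index other than 0 stands for the second one.\<close>

definition wavelet_S :: "real \<Rightarrow> nat \<Rightarrow> L2_circle \<Rightarrow> L2_circle" where
  "wavelet_S \<theta> i = (if i = 0 then wavelet_S0 \<theta> else wavelet_S1 \<theta>)"

text \<open>The coefficients of the linear map \<open>gram_step\<close> below, whose fixed points include the matrices of
  intertwiners.\<close>

definition filter_gram :: "real \<Rightarrow> real \<Rightarrow> nat \<Rightarrow> nat \<Rightarrow> real" where
  "filter_gram \<theta>' \<theta> j k = (\<Sum>i<2. filter_coeff \<theta>' i j * filter_coeff \<theta> i k)"

lemma coeff_a_mult:
  "coeff_a \<theta> j * coeff_a \<theta>' k = 1/8 *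
     ([1 - cos \<theta> + sin \<theta>, 1 - cos \<theta> - sin \<theta>, 1 + cos \<theta> - sin \<theta>, 1 + cos \<theta> + sin \<theta>] ! j
     * [1 - cos \<theta>' + sin \<theta>', 1 - cos \<theta>' - sin \<theta>', 1 + cos \<theta>' - sin \<theta>', 1 + cos \<theta>' + sin \<theta>'] ! k)"
  by (simp add: coeff_a_def)

lemma sum_lessThan_2: "(\<Sum>i<2. f i) = f 0 + f (Suc 0 :: nat)"
  by (simp add: numeral_2_eq_2)

lemma filter_gram_eqs:
  fixes \<theta> \<theta>' :: real
  defines "c \<equiv> cos \<theta>" and "s \<equiv> sin \<theta>" and "c' \<equiv> cos \<theta>'" and "s' \<equiv> sin \<theta>'"
  shows "filter_gram \<theta>' \<theta> 0 0 = ((1 + s') * (1 + s) + c' * c) / 4"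
    and "filter_gram \<theta>' \<theta> 3 3 = ((1 + s') * (1 + s) + c' * c) / 4"
    and "filter_gram \<theta>' \<theta> 1 1 = ((1 - s') * (1 - s) + c' * c) / 4"
    and "filter_gram \<theta>' \<theta> 2 2 = ((1 - s') * (1 - s) + c' * c) / 4"
    and "filter_gram \<theta>' \<theta> 0 3 = ((1 + s') * c - c' * (1 + s)) / 4"
    and "filter_gram \<theta>' \<theta> 3 0 = (c' * (1 + s) - (1 + s') * c) / 4"
    and "filter_gram \<theta>' \<theta> 1 2 = ((1 - s') * c - c' * (1 - s)) / 4"
    and "filter_gram \<theta>' \<theta> 2 1 = (c' * (1 - s) - (1 - s') * c) / 4"
    and "filter_gram \<theta>' \<theta> 0 2 = ((1 + s') * (1 - s) - c' * c) / 4"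
    and "filter_gram \<theta>' \<theta> 3 1 = ((1 + s') * (1 - s) - c' * c) / 4"
    and "filter_gram \<theta>' \<theta> 2 0 = ((1 - s') * (1 + s) - c' * c) / 4"
    and "filter_gram \<theta>' \<theta> 1 3 = ((1 - s') * (1 + s) - c' * c) / 4"
    and "filter_gram \<theta>' \<theta> 0 1 = (- (1 + s') * c - c' * (1 - s)) / 4"
    and "filter_gram \<theta>' \<theta> 3 2 = ((1 + s') * c + c' * (1 - s)) / 4"
    and "filter_gram \<theta>' \<theta> 2 3 = ((1 - s') * c + c' * (1 + s)) / 4"
    and "filter_gram \<theta>' \<theta> 1 0 = (- (1 - s') * c - c' * (1 + s)) / 4"
  unfolding filter_gram_def filter_coeff_def assms
  by (simp_all add: sum_lessThan_2 coeff_a_mult numeral_2_eq_2 numeral_3_eq_3 field_simps)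

lemma filter_coeff_orthogonal:
  assumes "i < 2" "k < 2"
  shows "filter_coeff \<theta> i 0 * filter_coeff \<theta> k 0 + filter_coeff \<theta> i 1 * filter_coeff \<theta> k 1
      + filter_coeff \<theta> i 2 * filter_coeff \<theta> k 2 + filter_coeff \<theta> i 3 * filter_coeff \<theta> k 3
      = (if i = k then 1 else 0)"
    and "filter_coeff \<theta> i 0 * filter_coeff \<theta> k 2 + filter_coeff \<theta> i 1 * filter_coeff \<theta> k 3 = 0"
proof -
  have *: "sin \<theta> * sin \<theta> = 1 - cos \<theta> * cos \<theta>"
    using sin_cos_squared_add[of \<theta>] by (simp add: power2_eq_square)
  have "i = 0 \<or> i = 1" "k = 0 \<or> k = 1" using assms by auto
  then show "filter_coeff \<theta> i 0 * filter_coeff \<theta> k 0 + filter_coeff \<theta> i 1 * filter_coeff \<theta> k 1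
      + filter_coeff \<theta> i 2 * filter_coeff \<theta> k 2 + filter_coeff \<theta> i 3 * filter_coeff \<theta> k 3
      = (if i = k then 1 else 0)"
    and "filter_coeff \<theta> i 0 * filter_coeff \<theta> k 2 + filter_coeff \<theta> i 1 * filter_coeff \<theta> k 3 = 0"
    unfolding filter_coeff_def
    by (auto simp add: coeff_a_mult numeral_2_eq_2 numeral_3_eq_3 algebra_simps *)
qed

lemma abs_L2_circle_eqI: "L2_rel f g \<Longrightarrow> abs_L2_circle f = abs_L2_circle g"
  by (rule Quotient_rel_abs[OF Quotient_L2_circle])

lemma continuous_on_filter: "continuous_on UNIV (filter_m0 \<theta>)" "continuous_on UNIV (filter_m1 \<theta>)"
  unfolding filter_m0_def[abs_def] filter_m1_def[abs_def] by (intro continuous_intros)+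

lemma wavelet_S_abs:
  assumes "square_integrable f"
  shows "wavelet_S \<theta> i (abs_L2_circle f)
    = abs_L2_circle (\<lambda>z. (if i = 0 then filter_m0 \<theta> z else filter_m1 \<theta> z) * f (z\<^sup>2))"
  using assms by (simp add: wavelet_S_def wavelet_S0.abs_eq wavelet_S1.abs_eq L2_rel_refl)

lemma wavelet_S_bounded_clinear: "bounded_clinear_on UNIV UNIV (wavelet_S \<theta> i)"
proof -
  define m where "m = (if i = 0 then filter_m0 \<theta> else filter_m1 \<theta>)"
  have mc: "continuous_on UNIV m" by (simp add: m_def continuous_on_filter)
  have S: "wavelet_S \<theta> i (abs_L2_circle f) = abs_L2_circle (\<lambda>z. m z * f (z\<^sup>2))"
    if "square_integrable f" for f
    using wavelet_S_abs[OF that, of \<theta> i] by (simp add: m_def if_distribR if_distrib cong: if_cong)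
  note sq = square_integrable_compose_square[OF mc]
  have "bounded (m ` sphere 0 1)"
    using mc by (intro compact_imp_bounded compact_continuous_image) (auto intro: continuous_on_subset)
  then obtain B where B: "\<And>z. z \<in> sphere 0 1 \<Longrightarrow> cmod (m z) \<le> B"
    unfolding bounded_iff by blast
  have B0: "0 \<le> B" using order_trans[OF norm_ge_zero B[of 1]] by simp
  show ?thesis
    unfolding bounded_clinear_on_def
  proof (intro conjI ballI allI exI)
    fix x y c
    obtain f where f: "square_integrable f" "x = abs_L2_circle f" by (rule L2_circle_cases)
    obtain g where g: "square_integrable g" "y = abs_L2_circle g" by (rule L2_circle_cases)
    show "wavelet_S \<theta> i (x + y) = wavelet_S \<theta> i x + wavelet_S \<theta> i y"
      by (simp add: f g plus_L2_circle.abs_eq L2_rel_refl S square_integrable_add sq distrib_left)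
    show "wavelet_S \<theta> i (c *\<^sub>C x) = c *\<^sub>C wavelet_S \<theta> i x"
      by (simp add: f scaleC_L2_circle.abs_eq L2_rel_refl S square_integrable_scale sq mult.left_commute)
    have fm: "f \<in> borel_measurable circle_measure"
      using f(1) by (simp add: square_integrable_def)
    have fs: "(\<lambda>z. f (z\<^sup>2)) \<in> borel_measurable circle_measure"
      by (rule measurable_compose[OF square_measurable_circle fm])
    have "ennreal ((norm (wavelet_S \<theta> i x))\<^sup>2)
        = (\<integral>\<^sup>+z. ennreal ((cmod (m z * f (z\<^sup>2)))\<^sup>2) \<partial>circle_measure)"
      by (simp add: f(2) S[OF f(1)] norm_abs_L2_circle[OF sq[OF f(1)]])
    also have "\<dots> \<le> (\<integral>\<^sup>+z. ennreal (B\<^sup>2) * ennreal ((cmod (f (z\<^sup>2)))\<^sup>2) \<partial>circle_measure)"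
    proof (intro nn_integral_mono)
      fix z assume "z \<in> space circle_measure"
      then have "(cmod (m z))\<^sup>2 \<le> B\<^sup>2"
        using B by (intro power_mono) (auto simp: space_circle_measure)
      then show "ennreal ((cmod (m z * f (z\<^sup>2)))\<^sup>2) \<le> ennreal (B\<^sup>2) * ennreal ((cmod (f (z\<^sup>2)))\<^sup>2)"
        by (auto simp: norm_mult power_mult_distrib ennreal_mult[symmetric]
            intro!: ennreal_leI mult_right_mono)
    qed
    also have "\<dots> = ennreal (B\<^sup>2) * (\<integral>\<^sup>+z. ennreal ((cmod (f (z\<^sup>2)))\<^sup>2) \<partial>circle_measure)"
      using fs by (intro nn_integral_cmult) simp
    also have "(\<integral>\<^sup>+z. ennreal ((cmod (f (z\<^sup>2)))\<^sup>2) \<partial>circle_measure)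
        = (\<integral>\<^sup>+z. ennreal ((cmod (f z))\<^sup>2) \<partial>circle_measure)"
      using fm by (intro nn_integral_circle_square[where f = "\<lambda>z. ennreal ((cmod (f z))\<^sup>2)"]) simp
    also have "\<dots> = ennreal ((norm x)\<^sup>2)"
      by (simp add: f(2) norm_abs_L2_circle[OF f(1)])
    also have "ennreal (B\<^sup>2) * \<dots> = ennreal ((B * norm x)\<^sup>2)"
      by (simp add: ennreal_mult[symmetric] power_mult_distrib)
    finally have "(norm (wavelet_S \<theta> i x))\<^sup>2 \<le> (B * norm x)\<^sup>2"
      by (subst (asm) ennreal_le_iff) auto
    then show "norm (wavelet_S \<theta> i x) \<le> B * norm x"
      by (rule power2_le_imp_le) (simp add: B0)
  qed simp
qed

lemma wavelet_S_fourier: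
  "wavelet_S \<theta> i (fourier n)
    = of_real (filter_coeff \<theta> i 0) *\<^sub>C fourier (2 * n) + of_real (filter_coeff \<theta> i 1) *\<^sub>C fourier (2 * n + 1)
    + of_real (filter_coeff \<theta> i 2) *\<^sub>C fourier (2 * n + 2) + of_real (filter_coeff \<theta> i 3) *\<^sub>C fourier (2 * n + 3)"
  (is "_ = ?rhs")
proof -
  define m where "m = (if i = 0 then filter_m0 \<theta> else filter_m1 \<theta>)"
  have mc: "continuous_on UNIV m" by (simp add: m_def continuous_on_filter)
  let ?h = "\<lambda>j. complex_of_real (filter_coeff \<theta> i j)"
  have m: "m z = ?h 0 + ?h 1 * z + ?h 2 * z ^ 2 + ?h 3 * z ^ 3" for z
    by (simp add: m_def filter_coeff_def filter_m0_def filter_m1_def eval_nat_numeral)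
  have "wavelet_S \<theta> i (fourier n) = abs_L2_circle (\<lambda>z. m z * (z\<^sup>2) powi n)"
    unfolding fourier_def using wavelet_S_abs[OF square_integrable_power_int, of \<theta> i n]
    by (simp add: m_def if_distribR if_distrib cong: if_cong)
  also have "\<dots> = abs_L2_circle (\<lambda>z. ?h 0 * z powi (2 * n) + ?h 1 * z powi (2 * n + 1)
      + ?h 2 * z powi (2 * n + 2) + ?h 3 * z powi (2 * n + 3))"
  proof (rule abs_L2_circle_eqI)
    have "AE z in circle_measure. m z * (z\<^sup>2) powi n = ?h 0 * z powi (2 * n)
        + ?h 1 * z powi (2 * n + 1) + ?h 2 * z powi (2 * n + 2) + ?h 3 * z powi (2 * n + 3)"
    proof (rule AE_I2)
      fix z assume "z \<in> space circle_measure"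
      then have z: "z \<noteq> 0" by (auto simp: space_circle_measure)
      have "(z\<^sup>2) powi n = z powi (2 * n)"
        by (simp add: power_int_mult)
      then show "m z * (z\<^sup>2) powi n = ?h 0 * z powi (2 * n)
        + ?h 1 * z powi (2 * n + 1) + ?h 2 * z powi (2 * n + 2) + ?h 3 * z powi (2 * n + 3)"
        using z by (simp add: m power_int_add algebra_simps)
    qed
    then show "L2_rel (\<lambda>z. m z * (z\<^sup>2) powi n) (\<lambda>z. ?h 0 * z powi (2 * n)
        + ?h 1 * z powi (2 * n + 1) + ?h 2 * z powi (2 * n + 2) + ?h 3 * z powi (2 * n + 3))"
      unfolding L2_rel_def
      by (intro conjI square_integrable_compose_square[OF mc] square_integrable_add
          square_integrable_scale square_integrable_power_int)
  qed
  also have "\<dots> = ?rhs"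
    unfolding fourier_def
    by (simp add: scaleC_L2_circle.abs_eq plus_L2_circle.abs_eq L2_rel_refl square_integrable_add
        square_integrable_scale square_integrable_power_int)
  finally show ?thesis .
qed

lemma cinner_fourier_fourier: "cinner (fourier m) (fourier n) = (if m = n then 1 else 0)"
  using orthonormal_fourier by (simp add: orthonormal_seq_def)

lemma cinner_wavelet_S_fourier:
  assumes "i < 2" "k < 2"
  shows "cinner (wavelet_S \<theta> i (fourier m)) (wavelet_S \<theta> k (fourier n))
    = (if i = k \<and> m = n then 1 else 0)"
proof -
  note o = filter_coeff_orthogonal[OF assms, of \<theta>] filter_coeff_orthogonal(2)[OF assms(2,1), of \<theta>]
  note o' = o[THEN arg_cong[of _ _ complex_of_real], unfolded of_real_add of_real_mult]
  consider "n = m" | "n = m + 1" | "m = n + 1" | "n \<noteq> m" "n \<noteq> m + 1" "m \<noteq> n + 1" by blast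
  then show ?thesis
  proof cases
    case 1
    then show ?thesis
      using o'(1) by (auto simp: wavelet_S_fourier cinner_add_left cinner_add_right cinner_scaleC_left
        cinner_scaleC_right cinner_fourier_fourier mult.commute split: if_splits)
  next
    case 2
    then show ?thesis
      using o'(3) by (simp add: wavelet_S_fourier cinner_add_left cinner_add_right cinner_scaleC_left
        cinner_scaleC_right cinner_fourier_fourier mult.commute)
  next
    case 3
    then show ?thesis
      using o'(2) by (simp add: wavelet_S_fourier cinner_add_left cinner_add_right cinner_scaleC_left
        cinner_scaleC_right cinner_fourier_fourier mult.commute)
  next
    case 4
    have "2 * m \<noteq> 2 * n + 1" "2 * m + 1 \<noteq> 2 * n" "2 * m \<noteq> 2 * n + 3" "2 * m + 3 \<noteq> 2 * n"
      "2 * m + 1 \<noteq> 2 * n + 2" "2 * m + 2 \<noteq> 2 * n + 1" "2 * m + 3 \<noteq> 2 * n + 2" "2 * m + 2 \<noteq> 2 * n + 3"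
      "2 * m \<noteq> 2 * n + 2" "2 * m + 2 \<noteq> 2 * n" "2 * m + 1 \<noteq> 2 * n + 3" "2 * m + 3 \<noteq> 2 * n + 1"
      using 4 by presburger+
    with 4 show ?thesis
      by (simp add: wavelet_S_fourier cinner_add_left cinner_add_right cinner_scaleC_left
        cinner_scaleC_right cinner_fourier_fourier)
  qed
qed

lemma orthonormal_wavelet_S: "i < 2 \<Longrightarrow> orthonormal_seq (\<lambda>n. wavelet_S \<theta> i (fourier n))"
  by (simp add: orthonormal_seq_def cinner_wavelet_S_fourier)

lemma wavelet_S_eq_orthonormal_map:
  assumes "i < 2"
  shows "wavelet_S \<theta> i x = orthonormal_map fourier (\<lambda>n. wavelet_S \<theta> i (fourier n)) x"
  by (rule bounded_clinear_eq_on_total[OF orthonormal_fourier total_fourier wavelet_S_bounded_clinear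
        orthonormal_map_bounded_clinear])
    (simp_all add: orthonormal_fourier orthonormal_wavelet_S assms orthonormal_map_apply)

text \<open>The adjoint of \<open>wavelet_S\<close>. As \<open>wavelet_S\<close> maps the Fourier basis to an orthonormal sequence, its
  adjoint maps this sequence back.\<close>

definition wavelet_adj :: "real \<Rightarrow> nat \<Rightarrow> L2_circle \<Rightarrow> L2_circle" where
  "wavelet_adj \<theta> i = orthonormal_map (\<lambda>n. wavelet_S \<theta> i (fourier n)) fourier"

lemma wavelet_adj:
  "i < 2 \<Longrightarrow> cinner (wavelet_S \<theta> i x) y = cinner x (wavelet_adj \<theta> i y)"
  unfolding wavelet_adj_def wavelet_S_eq_orthonormal_map[of i \<theta> x]
  by (rule orthonormal_map_adjoint[OF orthonormal_fourier orthonormal_wavelet_S])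

lemma wavelet_adj':
  "i < 2 \<Longrightarrow> cinner (wavelet_adj \<theta> i x) y = cinner x (wavelet_S \<theta> i y)"
  by (metis cinner_commute wavelet_adj)

lemma cadjoint_wavelet_S: "i < 2 \<Longrightarrow> cadjoint (wavelet_S \<theta> i) = wavelet_adj \<theta> i"
  unfolding cadjoint_def
proof (rule the_equality)
  fix T' assume i: "i < 2" and T': "\<forall>x y. cinner (wavelet_S \<theta> i x) y = cinner x (T' y)"
  show "T' = wavelet_adj \<theta> i"
    using T' by (intro ext cinner_eqI) (simp add: wavelet_adj[OF i])
qed (simp add: wavelet_adj)

lemma wavelet_adj_fourier:
  assumes i: "i < 2"
  shows "wavelet_adj \<theta> i (fourier n)
      = filter_coeff \<theta> i (nat (n mod 2)) *\<^sub>R fourier (n div 2)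
      + filter_coeff \<theta> i (nat (n mod 2) + 2) *\<^sub>R fourier (n div 2 - 1)"
proof (rule total_seq_eqI[OF total_fourier])
  fix m
  show "cinner (fourier m) (wavelet_adj \<theta> i (fourier n)) = cinner (fourier m)
      (filter_coeff \<theta> i (nat (n mod 2)) *\<^sub>R fourier (n div 2)
      + filter_coeff \<theta> i (nat (n mod 2) + 2) *\<^sub>R fourier (n div 2 - 1))"
  proof (cases "even n")
    case True
    then obtain r where r: "n = 2 * r" by blast
    have e: "2 * m + 3 \<noteq> 2 * r" "2 * m + 1 \<noteq> 2 * r" "2 * m + 2 = 2 * r \<longleftrightarrow> m = r - 1" by presburger+
    show ?thesis
      by (simp add: r wavelet_adj[OF i, symmetric] wavelet_S_fourier cinner_add_left cinner_add_right
          cinner_scaleC_left cinner_scaleR_right cinner_fourier_fourier e numeral_2_eq_2[symmetric])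
  next
    case False
    then obtain r where r: "n = 2 * r + 1" by (elim oddE)
    have e: "2 * m \<noteq> 2 * r + 1" "2 * m + 2 \<noteq> 2 * r + 1" "2 * m + 3 = 2 * r + 1 \<longleftrightarrow> m = r - 1" by presburger+
    have d: "(2 * r + 1) div 2 = r" "nat ((2 * r + 1) mod 2) = 1" by simp_all
    show ?thesis
      unfolding r d
      by (simp add: wavelet_adj[OF i, symmetric] wavelet_S_fourier cinner_add_left cinner_add_right
          cinner_scaleC_left cinner_scaleR_right cinner_fourier_fourier e numeral_3_eq_3)
  qed
qed

text \<open>The entry at \<open>(m, n)\<close> becomes the sum, over all \<open>j, k < 4\<close> with the parities of \<open>m\<close> and \<open>n\<close>, of
  \<open>filter_gram \<theta>' \<theta> j k\<close> times the entry at \<open>((m - j) / 2, (n - k) / 2)\<close>. This is the effect on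
  matrices of \<open>T \<mapsto> S\<^sub>0' T S\<^sub>0\<^sup>* + S\<^sub>1' T S\<^sub>1\<^sup>*\<close>, where the \<open>S\<^sub>i\<close> belong to \<open>\<theta>\<close> and the \<open>S\<^sub>i'\<close> to
  \<open>\<theta>'\<close>.\<close>

definition gram_step ::
    "real \<Rightarrow> real \<Rightarrow> (int \<Rightarrow> int \<Rightarrow> 'a::real_vector) \<Rightarrow> int \<Rightarrow> int \<Rightarrow> 'a" where
  "gram_step \<theta>' \<theta> b m n = (let p = m div 2; q = n div 2; j = nat (m mod 2); k = nat (n mod 2) in
     filter_gram \<theta>' \<theta> j k *\<^sub>R b p q + filter_gram \<theta>' \<theta> j (k + 2) *\<^sub>R b p (q - 1)
     + filter_gram \<theta>' \<theta> (j + 2) k *\<^sub>R b (p - 1) q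
     + filter_gram \<theta>' \<theta> (j + 2) (k + 2) *\<^sub>R b (p - 1) (q - 1))"

lemma int_parity_simps:
  "(2 * p) div 2 = p" "nat ((2 * p) mod 2) = 0" "(2 * p + 1) div 2 = p" "nat ((2 * p + 1) mod 2) = 1"
  "(0::nat) + 2 = 2" "(1::nat) + 2 = 3" for p :: int
  by simp_all

lemma gram_step_parity:
  "gram_step \<theta>' \<theta> b (2 * p) (2 * q) = filter_gram \<theta>' \<theta> 0 0 *\<^sub>R b p q
     + filter_gram \<theta>' \<theta> 0 2 *\<^sub>R b p (q - 1) + filter_gram \<theta>' \<theta> 2 0 *\<^sub>R b (p - 1) q
     + filter_gram \<theta>' \<theta> 2 2 *\<^sub>R b (p - 1) (q - 1)"
  "gram_step \<theta>' \<theta> b (2 * p) (2 * q + 1) = filter_gram \<theta>' \<theta> 0 1 *\<^sub>R b p q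
     + filter_gram \<theta>' \<theta> 0 3 *\<^sub>R b p (q - 1) + filter_gram \<theta>' \<theta> 2 1 *\<^sub>R b (p - 1) q
     + filter_gram \<theta>' \<theta> 2 3 *\<^sub>R b (p - 1) (q - 1)"
  "gram_step \<theta>' \<theta> b (2 * p + 1) (2 * q) = filter_gram \<theta>' \<theta> 1 0 *\<^sub>R b p q
     + filter_gram \<theta>' \<theta> 1 2 *\<^sub>R b p (q - 1) + filter_gram \<theta>' \<theta> 3 0 *\<^sub>R b (p - 1) q
     + filter_gram \<theta>' \<theta> 3 2 *\<^sub>R b (p - 1) (q - 1)"
  "gram_step \<theta>' \<theta> b (2 * p + 1) (2 * q + 1) = filter_gram \<theta>' \<theta> 1 1 *\<^sub>R b p q
     + filter_gram \<theta>' \<theta> 1 3 *\<^sub>R b p (q - 1) + filter_gram \<theta>' \<theta> 3 1 *\<^sub>R b (p - 1) q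
     + filter_gram \<theta>' \<theta> 3 3 *\<^sub>R b (p - 1) (q - 1)"
  unfolding gram_step_def Let_def int_parity_simps by (rule refl)+

lemma int_parity_cases [case_names even odd]:
  obtains p :: int where "m = 2 * p" | p where "m = 2 * p + 1"
  by (metis evenE oddE)

text \<open>The identity matrix is fixed: this is the relation \<open>S\<^sub>0 S\<^sub>0\<^sup>* + S\<^sub>1 S\<^sub>1\<^sup>* = 1\<close> in coordinates.\<close>

lemma gram_step_delta:
  "gram_step \<theta> \<theta> (\<lambda>m n. if m = n then x else 0) m n = (if m = n then x else 0)"
proof -
  have ss: "sin \<theta> * sin \<theta> = 1 - cos \<theta> * cos \<theta>"
    using sin_cos_squared_add[of \<theta>] by (simp add: power2_eq_square)
  let ?g = "filter_gram \<theta> \<theta>"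
  have "?g 0 0 + ?g 2 2 = 1" "?g 1 1 + ?g 3 3 = 1" "?g 0 1 + ?g 2 3 = 0" "?g 1 0 + ?g 3 2 = 0"
    by (simp_all only: filter_gram_eqs) (simp_all add: field_simps ss)
  then have d: "?g 0 0 *\<^sub>R x + ?g 2 2 *\<^sub>R x = x" "?g 1 1 *\<^sub>R x + ?g 3 3 *\<^sub>R x = x"
    "?g 0 1 *\<^sub>R x + ?g 2 3 *\<^sub>R x = 0" "?g 1 0 *\<^sub>R x + ?g 3 2 *\<^sub>R x = 0"
    by (simp_all only: scaleR_left_distrib[symmetric]) simp_all
  have z: "?g 0 2 = 0" "?g 2 0 = 0" "?g 1 3 = 0" "?g 3 1 = 0" "?g 0 3 = 0" "?g 3 0 = 0" "?g 1 2 = 0" "?g 2 1 = 0"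
    by (simp_all only: filter_gram_eqs) (simp_all add: algebra_simps ss)
  have *: "2 * p \<noteq> 2 * q + 1" "2 * p + 1 \<noteq> 2 * q" for p q :: int by presburger+
  show ?thesis
    by (cases m rule: int_parity_cases; cases n rule: int_parity_cases)
      (auto simp only: gram_step_parity z, auto simp: d d[unfolded One_nat_def] *)
qed

lemma sum_cinner_wavelet_adj:
  assumes T: "bounded_clinear_on UNIV UNIV T"
  shows "(\<Sum>i<2. cinner (wavelet_adj \<theta>' i (fourier m)) (T (wavelet_adj \<theta> i (fourier n))))
    = gram_step \<theta>' \<theta> (\<lambda>m n. cinner (fourier m) (T (fourier n))) m n"
proof -
  have TR: "T (r *\<^sub>R x) = r *\<^sub>R T x" for r x
    using bounded_clinear_onD(3)[OF T, of x "of_real r"] by (simp add: scaleC_of_real)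
  show ?thesis
    by (simp add: sum_lessThan_2 wavelet_adj_fourier gram_step_def Let_def filter_gram_def TR
        bounded_clinear_onD(2)[OF T] cinner_add_left cinner_add_right cinner_scaleR_left
        cinner_scaleR_right scaleR_conv_of_real algebra_simps)
qed

lemma wavelet_adj_S:
  assumes "i < 2" "k < 2"
  shows "wavelet_adj \<theta> i (wavelet_S \<theta> k x) = (if i = k then x else 0)"
proof -
  have "wavelet_adj \<theta> k (wavelet_S \<theta> i (fourier n)) = (if i = k then fourier n else 0)" for n
    using assms by (intro total_seq_eqI[OF total_fourier])
      (simp add: wavelet_adj[symmetric] cinner_wavelet_S_fourier cinner_fourier_fourier)
  then show ?thesis
    using assms by (intro total_seq_eqI[OF total_fourier])
      (simp add: wavelet_adj[symmetric] wavelet_adj'[symmetric])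
qed

lemma wavelet_S_adj_sum: "wavelet_S \<theta> 0 (wavelet_adj \<theta> 0 x) + wavelet_S \<theta> 1 (wavelet_adj \<theta> 1 x) = x"
proof -
  define R where "R x = wavelet_S \<theta> 0 (wavelet_adj \<theta> 0 x) + wavelet_S \<theta> 1 (wavelet_adj \<theta> 1 x)" for x
  have c: "cinner y (R x) = (\<Sum>i<2. cinner (wavelet_adj \<theta> i y) (wavelet_adj \<theta> i x))" for x y
    by (simp add: R_def sum_lessThan_2 cinner_add_right wavelet_adj')
  have "cinner (R y) x = cnj (\<Sum>i<2. cinner (wavelet_adj \<theta> i x) (wavelet_adj \<theta> i y))" for x y
    by (metis c cinner_commute)
  then have sym: "cinner y (R x) = cinner (R y) x" for x y
    unfolding c cnj_sum cinner_commute[symmetric] by simp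
  have id: "bounded_clinear_on UNIV UNIV (\<lambda>x::L2_circle. x)"
    unfolding bounded_clinear_on_def by (auto intro!: exI[of _ 1])
  have "R (fourier n) = fourier n" for n
    using sum_cinner_wavelet_adj[OF id]
    by (intro total_seq_eqI[OF total_fourier])
      (simp add: c cinner_fourier_fourier gram_step_delta)
  then have "R x = x"
    by (intro total_seq_eqI[OF total_fourier]) (simp add: sym)
  then show ?thesis by (simp add: R_def)
qed

lemma cuntz_operators_wavelet: "cuntz_operators (wavelet_S0 \<theta>) (wavelet_S1 \<theta>)"
proof -
  have S: "wavelet_S0 \<theta> = wavelet_S \<theta> 0" "wavelet_S1 \<theta> = wavelet_S \<theta> 1"
    by (auto simp: wavelet_S_def)
  show ?thesis
    unfolding cuntz_operators_def S
    by (simp add: cadjoint_wavelet_S wavelet_S_bounded_clinear wavelet_adj_S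
        wavelet_S_adj_sum[unfolded One_nat_def])
qed

section \<open>Invariant bilinear forms\<close>

text \<open>Real fixed points of \<open>gram_step\<close>; the matrices of intertwiners are complex, but as the coefficients
  are real, their real and imaginary parts can be treated separately.\<close>

definition invariant_form :: "real \<Rightarrow> real \<Rightarrow> (int \<Rightarrow> int \<Rightarrow> real) \<Rightarrow> bool" where
  "invariant_form \<theta>' \<theta> b \<longleftrightarrow> (\<forall>m n. b m n = gram_step \<theta>' \<theta> b m n)"

lemma invariant_form_eqs:
  fixes \<theta> \<theta>' :: real
  assumes "invariant_form \<theta>' \<theta> b"
  defines "c \<equiv> cos \<theta>" and "s \<equiv> sin \<theta>" and "c' \<equiv> cos \<theta>'" and "s' \<equiv> sin \<theta>'"
  shows "4 * b (2 * p) (2 * q) = ((1 + s') * (1 + s) + c' * c) * b p q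
     + ((1 + s') * (1 - s) - c' * c) * b p (q - 1) + ((1 - s') * (1 + s) - c' * c) * b (p - 1) q
     + ((1 - s') * (1 - s) + c' * c) * b (p - 1) (q - 1)"
  and "4 * b (2 * p) (2 * q + 1) = (- (1 + s') * c - c' * (1 - s)) * b p q
     + ((1 + s') * c - c' * (1 + s)) * b p (q - 1) + (c' * (1 - s) - (1 - s') * c) * b (p - 1) q
     + ((1 - s') * c + c' * (1 + s)) * b (p - 1) (q - 1)"
  and "4 * b (2 * p + 1) (2 * q) = (- (1 - s') * c - c' * (1 + s)) * b p q
     + ((1 - s') * c - c' * (1 - s)) * b p (q - 1) + (c' * (1 + s) - (1 + s') * c) * b (p - 1) q
     + ((1 + s') * c + c' * (1 - s)) * b (p - 1) (q - 1)"
  and "4 * b (2 * p + 1) (2 * q + 1) = ((1 - s') * (1 - s) + c' * c) * b p q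
     + ((1 - s') * (1 + s) - c' * c) * b p (q - 1) + ((1 + s') * (1 - s) - c' * c) * b (p - 1) q
     + ((1 + s') * (1 + s) + c' * c) * b (p - 1) (q - 1)"
proof -
  have b: "b m n = gram_step \<theta>' \<theta> b m n" for m n
    using assms(1) by (simp add: invariant_form_def)
  note e = b[of "2 * p" "2 * q"] b[of "2 * p" "2 * q + 1"] b[of "2 * p + 1" "2 * q"]
    b[of "2 * p + 1" "2 * q + 1"]
  note e = e[unfolded gram_step_parity filter_gram_eqs, folded c_def s_def c'_def s'_def]
  show "4 * b (2 * p) (2 * q) = ((1 + s') * (1 + s) + c' * c) * b p q
     + ((1 + s') * (1 - s) - c' * c) * b p (q - 1) + ((1 - s') * (1 + s) - c' * c) * b (p - 1) q
     + ((1 - s') * (1 - s) + c' * c) * b (p - 1) (q - 1)"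
    unfolding e(1) real_scaleR_def by (simp only: distrib_left)
  show "4 * b (2 * p) (2 * q + 1) = (- (1 + s') * c - c' * (1 - s)) * b p q
     + ((1 + s') * c - c' * (1 + s)) * b p (q - 1) + (c' * (1 - s) - (1 - s') * c) * b (p - 1) q
     + ((1 - s') * c + c' * (1 + s)) * b (p - 1) (q - 1)"
    unfolding e(2) real_scaleR_def by (simp only: distrib_left)
  show "4 * b (2 * p + 1) (2 * q) = (- (1 - s') * c - c' * (1 + s)) * b p q
     + ((1 - s') * c - c' * (1 - s)) * b p (q - 1) + (c' * (1 + s) - (1 + s') * c) * b (p - 1) q
     + ((1 + s') * c + c' * (1 - s)) * b (p - 1) (q - 1)"
    unfolding e(3) real_scaleR_def by (simp only: distrib_left)
  show "4 * b (2 * p + 1) (2 * q + 1) = ((1 - s') * (1 - s) + c' * c) * b p q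
     + ((1 - s') * (1 + s) - c' * c) * b p (q - 1) + ((1 + s') * (1 - s) - c' * c) * b (p - 1) q
     + ((1 + s') * (1 + s) + c' * c) * b (p - 1) (q - 1)"
    unfolding e(4) real_scaleR_def by (simp only: distrib_left)
qed

lemma invariant_form_transpose:
  assumes "invariant_form \<theta>' \<theta> b"
  shows "invariant_form \<theta> \<theta>' (\<lambda>m n. b n m)"
proof -
  have g: "filter_gram \<theta> \<theta>' j k = filter_gram \<theta>' \<theta> k j" for j k
    by (simp add: filter_gram_def mult.commute)
  have "b n m = gram_step \<theta> \<theta>' (\<lambda>m n. b n m) m n" for m n
  proof -
    have "b n m = gram_step \<theta>' \<theta> b n m"
      using assms by (simp add: invariant_form_def)
    then show ?thesis
      unfolding gram_step_def Let_def g by (simp only: add_ac)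
  qed
  then show ?thesis
    unfolding invariant_form_def by blast
qed

lemma invariant_form_diff_scale:
  assumes "invariant_form \<theta>' \<theta> b" "invariant_form \<theta>' \<theta> d"
  shows "invariant_form \<theta>' \<theta> (\<lambda>m n. b m n - k * d m n)"
  unfolding invariant_form_def
proof (intro allI)
  fix m n
  have "b m n - k * d m n = gram_step \<theta>' \<theta> b m n - k * gram_step \<theta>' \<theta> d m n"
    using assms by (simp add: invariant_form_def)
  also have "\<dots> = gram_step \<theta>' \<theta> (\<lambda>m n. b m n - k * d m n) m n"
    by (simp add: gram_step_def Let_def algebra_simps)
  finally show "b m n - k * d m n = gram_step \<theta>' \<theta> (\<lambda>m n. b m n - k * d m n) m n" .
qed

text \<open>An invariant form is determined by its values on \<open>{-3, \<dots>, 0}\<close>. The maps \<open>m \<mapsto> (m - j) / 2\<close> with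
  \<open>0 \<le> j \<le> 3\<close> have their fixed points in this window, whose centre is \<open>-3/2\<close>; the distance of an
  index outside the window to this centre decreases.\<close>

lemma invariant_form_zero:
  assumes b: "invariant_form \<theta>' \<theta> b"
    and box: "\<And>m n. m \<in> {-3..0} \<Longrightarrow> n \<in> {-3..0} \<Longrightarrow> b m n = 0"
  shows "b m n = 0"
proof (induction "nat (max \<bar>2 * m + 3\<bar> \<bar>2 * n + 3\<bar>)" arbitrary: m n rule: less_induct)
  case less
  show ?case
  proof (cases "m \<in> {-3..0} \<and> n \<in> {-3..0}")
    case False
    define M where "M = max \<bar>2 * m + 3\<bar> \<bar>2 * n + 3\<bar>"
    have M: "3 < M" using False by (auto simp: M_def)
    have dec: "\<bar>2 * (k div 2 - i) + 3\<bar> < M" if "i \<in> {0, 1}" "\<bar>2 * k + 3\<bar> \<le> M" for k i :: int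
    proof -
      obtain d r where "k div 2 = d" "k = 2 * d + r" "0 \<le> r" "r < 2"
        using that by (metis mult_div_mod_eq pos_mod_sign pos_mod_bound zero_less_numeral)
      moreover have "0 \<le> i" "i \<le> 1" using that by auto
      moreover have "2 * k + 3 \<le> M" "- (2 * k + 3) \<le> M" using that(2) by (simp_all add: abs_le_iff)
      ultimately have "2 * (k div 2 - i) + 3 < M" "- (2 * (k div 2 - i) + 3) < M"
        using M by simp_all
      then show ?thesis by (simp add: abs_less_iff)
    qed
    have 0: "b (m div 2 - i) (n div 2 - j) = 0" if "i \<in> {0, 1}" "j \<in> {0, 1}" for i j
    proof (rule less)
      have "max \<bar>2 * (m div 2 - i) + 3\<bar> \<bar>2 * (n div 2 - j) + 3\<bar> < M"
        using dec[OF that(1), of m] dec[OF that(2), of n] by (simp add: M_def)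
      then show "nat (max \<bar>2 * (m div 2 - i) + 3\<bar> \<bar>2 * (n div 2 - j) + 3\<bar>)
          < nat (max \<bar>2 * m + 3\<bar> \<bar>2 * n + 3\<bar>)"
        unfolding M_def[symmetric] using M by simp
    qed
    have "b m n = gram_step \<theta>' \<theta> b m n"
      using b by (simp add: invariant_form_def)
    also have "\<dots> = 0"
      using 0[of 0 0] 0[of 0 1] 0[of 1 0] 0[of 1 1] by (simp add: gram_step_def Let_def)
    finally show ?thesis .
  qed (use box in blast)
qed

text \<open>The indices \<open>-1\<close> and \<open>-2\<close> are only mapped to each other or themselves, so the four entries over them
  satisfy a closed system. It is simplest in terms of the sums and differences of the diagonal and of
  the off-diagonal entries.\<close>

lemma invariant_form_middle:
  assumes b: "invariant_form \<theta>' \<theta> b"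
  defines "c \<equiv> cos \<theta>" and "s \<equiv> sin \<theta>" and "c' \<equiv> cos \<theta>'" and "s' \<equiv> sin \<theta>'"
  defines "X \<equiv> b (-1) (-1)" and "Y \<equiv> b (-1) (-2)" and "Z \<equiv> b (-2) (-1)" and "W \<equiv> b (-2) (-2)"
  shows "(1 - (s' * s + c' * c)) * ((X + W) - (Y + Z)) = 0"
    and "(2 + s + s') * (X - W) = (s - s') * (Y - Z)"
    and "2 * (Y + Z) = - (c + c') * (X - W) + (c - c') * (Y - Z)"
    and "2 * (Y - Z) = (s * c' - s' * c) * ((Y + Z) - (X + W))"
proof -
  note e = invariant_form_eqs[OF b, of "-1" "-1", folded c_def s_def c'_def s'_def]
  have 1: "4 * X = ((1 - s') * (1 - s) + c' * c) * X + ((1 - s') * (1 + s) - c' * c) * Y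
      + ((1 + s') * (1 - s) - c' * c) * Z + ((1 + s') * (1 + s) + c' * c) * W"
    using e(4) by (simp add: X_def Y_def Z_def W_def)
  have 2: "4 * Y = (- (1 - s') * c - c' * (1 + s)) * X + ((1 - s') * c - c' * (1 - s)) * Y
      + (c' * (1 + s) - (1 + s') * c) * Z + ((1 + s') * c + c' * (1 - s)) * W"
    using e(3) by (simp add: X_def Y_def Z_def W_def)
  have 3: "4 * Z = (- (1 + s') * c - c' * (1 - s)) * X + ((1 + s') * c - c' * (1 + s)) * Y
      + (c' * (1 - s) - (1 - s') * c) * Z + ((1 - s') * c + c' * (1 + s)) * W"
    using e(2) by (simp add: X_def Y_def Z_def W_def)
  have 4: "4 * W = ((1 + s') * (1 + s) + c' * c) * X + ((1 + s') * (1 - s) - c' * c) * Y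
      + ((1 - s') * (1 + s) - c' * c) * Z + ((1 - s') * (1 - s) + c' * c) * W"
    using e(1) by (simp add: X_def Y_def Z_def W_def)
  show "(1 - (s' * s + c' * c)) * ((X + W) - (Y + Z)) = 0"
    using 1 4 by algebra
  show "(2 + s + s') * (X - W) = (s - s') * (Y - Z)"
    using 1 4 by algebra
  show "2 * (Y + Z) = - (c + c') * (X - W) + (c - c') * (Y - Z)"
    using 2 3 by algebra
  show "2 * (Y - Z) = (s * c' - s' * c) * ((Y + Z) - (X + W))"
    using 2 3 by algebra
qed

text \<open>The equations for the entries at \<open>(0, -1)\<close>, \<open>(0, -2)\<close>, and likewise for three further pairs,
  given that the entries over \<open>{-2, -1}\<close> vanish. With \<open>k = cos (\<theta> - \<theta>')\<close> the sum of the squares of the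
  right-hand sides is at most the sum of the squares of the left-hand sides, with equality for a
  nonzero pair only if \<open>s' = 1\<close> and \<open>s\<^sup>2 = 1\<close>. The absolute values in the first equation allow for
  the opposite sign that occurs at the index \<open>-3\<close>.\<close>

lemma outer_pair_zero:
  fixes s c s' c' x y :: real
  assumes u: "s\<^sup>2 + c\<^sup>2 = 1" "s'\<^sup>2 + c'\<^sup>2 = 1" and ex: "\<not> (s' = 1 \<and> s\<^sup>2 = 1)"
    and x: "\<bar>4 * x\<bar> = \<bar>(- (1 + s') * c - c' * (1 - s)) * x + ((1 + s') * c - c' * (1 + s)) * y\<bar>"
    and y: "4 * y = ((1 + s') * (1 + s) + c' * c) * x + ((1 + s') * (1 - s) - c' * c) * y"
  shows "x = 0 \<and> y = 0"
proof -
  define k where "k = s' * s + c' * c"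
  have "(s' * c - c' * s)\<^sup>2 + k\<^sup>2 = (s\<^sup>2 + c\<^sup>2) * (s'\<^sup>2 + c'\<^sup>2)"
    unfolding k_def by algebra
  then have kk: "(s' * c - c' * s)\<^sup>2 + k\<^sup>2 = 1" by (simp add: u)
  then have "k\<^sup>2 \<le> 1" by (metis le_add_same_cancel2 zero_le_power2)
  then have k: "-1 \<le> k" "k \<le> 1" by (auto simp: abs_square_le_1 abs_le_iff)
  have "s'\<^sup>2 \<le> 1" using u(2) by (metis le_add_same_cancel1 zero_le_power2)
  then have s': "-1 \<le> s'" "s' \<le> 1" by (auto simp: abs_square_le_1 abs_le_iff)
  have x2: "(4 * x)\<^sup>2 = ((- (1 + s') * c - c' * (1 - s)) * x + ((1 + s') * c - c' * (1 + s)) * y)\<^sup>2"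
    using x by (metis power2_abs)
  have "(4 * x)\<^sup>2 + (4 * y)\<^sup>2 = 4 * (1 + s') * ((1 + k) * x\<^sup>2 + (1 - k) * y\<^sup>2)"
    unfolding x2 y k_def using u by algebra
  then have eq: "x\<^sup>2 + y\<^sup>2 = (1 + s') / 2 * ((1 + k) / 2 * x\<^sup>2 + (1 - k) / 2 * y\<^sup>2)"
    by (simp add: field_simps)
  show ?thesis
  proof (rule ccontr)
    assume ne: "\<not> (x = 0 \<and> y = 0)"
    have a: "0 \<le> (1 + k) / 2 * x\<^sup>2 + (1 - k) / 2 * y\<^sup>2" using k by simp
    have "(1 + k) / 2 * x\<^sup>2 \<le> 1 * x\<^sup>2" "(1 - k) / 2 * y\<^sup>2 \<le> 1 * y\<^sup>2"
      using k by (intro mult_right_mono; simp)+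
    then have b: "(1 + k) / 2 * x\<^sup>2 + (1 - k) / 2 * y\<^sup>2 \<le> x\<^sup>2 + y\<^sup>2" by simp
    have pos: "0 < x\<^sup>2 + y\<^sup>2" using ne by (simp add: sum_power2_gt_zero_iff)
    have "s' = 1"
    proof (rule ccontr)
      assume "s' \<noteq> 1"
      then have "(1 + s') / 2 < 1" using s' by simp
      from mult_strict_right_mono[OF this pos]
      have "(1 + s') / 2 * (x\<^sup>2 + y\<^sup>2) < x\<^sup>2 + y\<^sup>2" by simp
      moreover have "(1 + s') / 2 * ((1 + k) / 2 * x\<^sup>2 + (1 - k) / 2 * y\<^sup>2) \<le> (1 + s') / 2 * (x\<^sup>2 + y\<^sup>2)"
        using s' by (intro mult_left_mono b) simp
      ultimately show False using eq by linarith
    qed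
    then have "c' = 0" using u(2) by simp
    then have "k = s" using \<open>s' = 1\<close> by (simp add: k_def)
    have "s\<^sup>2 \<noteq> 1" using ex \<open>s' = 1\<close> by simp
    then have "-1 < s" "s < 1"
      using k \<open>k = s\<close> by (auto simp: less_le)
    have "0 < (1 - s) / 2 * x\<^sup>2 + (1 + s) / 2 * y\<^sup>2"
    proof (cases "x = 0")
      case True
      then show ?thesis using ne \<open>-1 < s\<close> by simp
    next
      case False
      then show ?thesis using \<open>-1 < s\<close> \<open>s < 1\<close> by (intro add_pos_nonneg) auto
    qed
    then show False
      using eq \<open>s' = 1\<close> \<open>k = s\<close> by (simp add: field_simps)
  qed
qed

lemma invariant_form_side:
  assumes b: "invariant_form \<theta>' \<theta> b"
    and ex: "\<not> (sin \<theta>' = 1 \<and> (sin \<theta>)\<^sup>2 = 1)"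
    and mid: "\<And>m n. m \<in> {-2..-1} \<Longrightarrow> n \<in> {-2..-1} \<Longrightarrow> b m n = 0"
    and mn: "m \<in> {-3..0}" "n \<in> {-2..-1}"
  shows "b m n = 0"
proof -
  have m0: "b (-1) (-1) = 0" "b (-1) (-2) = 0" "b (-2) (-1) = 0" "b (-2) (-2) = 0"
    by (auto intro: mid)
  have "b 0 (-1) = 0 \<and> b 0 (-2) = 0"
  proof (rule outer_pair_zero[OF sin_cos_squared_add sin_cos_squared_add ex])
    show "\<bar>4 * b 0 (-1)\<bar> = \<bar>(- (1 + sin \<theta>') * cos \<theta> - cos \<theta>' * (1 - sin \<theta>)) * b 0 (-1)
        + ((1 + sin \<theta>') * cos \<theta> - cos \<theta>' * (1 + sin \<theta>)) * b 0 (-2)\<bar>"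
      using invariant_form_eqs(2)[OF b, of 0 "-1"] by (simp add: m0)
    show "4 * b 0 (-2) = ((1 + sin \<theta>') * (1 + sin \<theta>) + cos \<theta>' * cos \<theta>) * b 0 (-1)
        + ((1 + sin \<theta>') * (1 - sin \<theta>) - cos \<theta>' * cos \<theta>) * b 0 (-2)"
      using invariant_form_eqs(1)[OF b, of 0 "-1"] by (simp add: m0)
  qed
  moreover have "b (-3) (-2) = 0 \<and> b (-3) (-1) = 0"
  proof (rule outer_pair_zero[OF sin_cos_squared_add sin_cos_squared_add ex])
    have "4 * b (-3) (-2) = - ((- (1 + sin \<theta>') * cos \<theta> - cos \<theta>' * (1 - sin \<theta>)) * b (-3) (-2)
        + ((1 + sin \<theta>') * cos \<theta> - cos \<theta>' * (1 + sin \<theta>)) * b (-3) (-1))"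
      using invariant_form_eqs(3)[OF b, of "-2" "-1"] by (simp add: m0 algebra_simps)
    then show "\<bar>4 * b (-3) (-2)\<bar> = \<bar>(- (1 + sin \<theta>') * cos \<theta> - cos \<theta>' * (1 - sin \<theta>)) * b (-3) (-2)
        + ((1 + sin \<theta>') * cos \<theta> - cos \<theta>' * (1 + sin \<theta>)) * b (-3) (-1)\<bar>"
      by (simp only: abs_minus_cancel)
    show "4 * b (-3) (-1) = ((1 + sin \<theta>') * (1 + sin \<theta>) + cos \<theta>' * cos \<theta>) * b (-3) (-2)
        + ((1 + sin \<theta>') * (1 - sin \<theta>) - cos \<theta>' * cos \<theta>) * b (-3) (-1)"
      using invariant_form_eqs(4)[OF b, of "-2" "-1"] by (simp add: m0)
  qed
  moreover have "m = 0 \<or> m = -1 \<or> m = -2 \<or> m = -3" "n = -1 \<or> n = -2" using mn by auto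
  ultimately show ?thesis using m0 by auto
qed

text \<open>Besides the sides, the corners of the window remain; each satisfies an equation \<open>4 x = \<plusminus> A x\<close> or \<open>4 x = \<plusminus> G x\<close>
  with \<open>A\<^sup>2 + G\<^sup>2 < 16\<close>.\<close>

lemma invariant_form_zero_of_middle:
  assumes b: "invariant_form \<theta>' \<theta> b"
    and ex: "\<not> (sin \<theta>' = 1 \<and> (sin \<theta>)\<^sup>2 = 1)" "\<not> (sin \<theta> = 1 \<and> (sin \<theta>')\<^sup>2 = 1)"
    and mid: "\<And>m n. m \<in> {-2..-1} \<Longrightarrow> n \<in> {-2..-1} \<Longrightarrow> b m n = 0"
  shows "b m n = 0"
proof (rule invariant_form_zero[OF b])
  have col: "b m n = 0" if "m \<in> {-3..0}" "n \<in> {-2..-1}" for m n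
    by (rule invariant_form_side[OF b ex(1) _ that]) (rule mid)
  have row: "b m n = 0" if "m \<in> {-2..-1}" "n \<in> {-3..0}" for m n
    using invariant_form_side[OF invariant_form_transpose[OF b] ex(2) _ that(2,1)] mid by blast
  define A where "A = (1 + sin \<theta>') * (1 + sin \<theta>) + cos \<theta>' * cos \<theta>"
  define G where "G = (1 + sin \<theta>') * cos \<theta> - cos \<theta>' * (1 + sin \<theta>)"
  have sq: "(1 + sin t)\<^sup>2 + (cos t)\<^sup>2 = 2 * (1 + sin t)" for t :: real
    using sin_cos_squared_add[of t] by algebra
  have "A\<^sup>2 + G\<^sup>2 = ((1 + sin \<theta>')\<^sup>2 + (cos \<theta>')\<^sup>2) * ((1 + sin \<theta>)\<^sup>2 + (cos \<theta>)\<^sup>2)"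
    unfolding A_def G_def by algebra
  then have AG: "A\<^sup>2 + G\<^sup>2 = 4 * ((1 + sin \<theta>') * (1 + sin \<theta>))"
    unfolding sq by (simp add: algebra_simps)
  have "(1 + sin \<theta>') * (1 + sin \<theta>) < 4"
  proof -
    have le: "sin \<theta> \<le> 1" "sin \<theta>' \<le> 1" "-1 \<le> sin \<theta>" "-1 \<le> sin \<theta>'" by simp_all
    consider "sin \<theta> < 1" | "sin \<theta>' < 1" using ex le by (metis less_eq_real_def one_power2)
    then show ?thesis
    proof cases
      case 1
      have "(1 + sin \<theta>') * (1 + sin \<theta>) \<le> 2 * (1 + sin \<theta>)"
        using le by (intro mult_right_mono) linarith+
      with 1 show ?thesis by simp
    next
      case 2
      have "(1 + sin \<theta>') * (1 + sin \<theta>) \<le> (1 + sin \<theta>') * 2"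
        using le by (intro mult_left_mono) linarith+
      with 2 show ?thesis by simp
    qed
  qed
  then have "A\<^sup>2 + G\<^sup>2 < 4\<^sup>2" by (simp add: AG mult.commute)
  then have "A\<^sup>2 < 4\<^sup>2" "G\<^sup>2 < 4\<^sup>2"
    using zero_le_power2[of A] zero_le_power2[of G] by linarith+
  then have ne: "A \<noteq> 4" "G \<noteq> 4" "G \<noteq> - 4" by auto
  have "4 * b 0 0 = A * b 0 0" "4 * b (-3) (-3) = A * b (-3) (-3)"
    "4 * b 0 (-3) = G * b 0 (-3)" "4 * b (-3) 0 = - G * b (-3) 0"
    using invariant_form_eqs(1)[OF b, of 0 0] invariant_form_eqs(4)[OF b, of "-2" "-2"]
      invariant_form_eqs(2)[OF b, of 0 "-2"] invariant_form_eqs(3)[OF b, of "-2" 0]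
    by (simp_all add: col row mid A_def G_def)
  then have "(A - 4) * b 0 0 = 0" "(A - 4) * b (-3) (-3) = 0"
    "(G - 4) * b 0 (-3) = 0" "(G - - 4) * b (-3) 0 = 0"
    by (simp_all add: algebra_simps)
  then have c0: "b 0 0 = 0" "b (-3) (-3) = 0" "b 0 (-3) = 0" "b (-3) 0 = 0"
    using ne unfolding mult_eq_0_iff eq_iff_diff_eq_0[symmetric] by blast+
  fix m n :: int assume mn: "m \<in> {-3..0}" "n \<in> {-3..0}"
  then have "m \<in> {-2..-1} \<or> m = 0 \<or> m = -3" "n \<in> {-2..-1} \<or> n = 0 \<or> n = -3" by auto
  then show "b m n = 0" using c0 col[of m n] row[of m n] mn by blast
qed

lemma invariant_form_distinct:
  assumes b: "invariant_form \<theta>' \<theta> b"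
    and ne: "(sin \<theta>, cos \<theta>) \<noteq> (sin \<theta>', cos \<theta>')"
    and ex: "\<not> (sin \<theta> = 1 \<and> sin \<theta>' = - 1)" "\<not> (sin \<theta> = - 1 \<and> sin \<theta>' = 1)"
  shows "b m n = 0"
proof (rule invariant_form_zero_of_middle[OF b])
  define c where "c = cos \<theta>"
  define s where "s = sin \<theta>"
  define c' where "c' = cos \<theta>'"
  define s' where "s' = sin \<theta>'"
  have u: "s\<^sup>2 + c\<^sup>2 = 1" "s'\<^sup>2 + c'\<^sup>2 = 1" by (simp_all add: s_def c_def s'_def c'_def)
  have sb: "-1 \<le> s" "-1 \<le> s'" by (simp_all add: s_def s'_def)
  have ne': "s \<noteq> s' \<or> c \<noteq> c'" using ne by (auto simp: s_def c_def s'_def c'_def)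
  have k: "s' * s + c' * c \<noteq> 1"
  proof
    assume "s' * s + c' * c = 1"
    then have "(s - s')\<^sup>2 + (c - c')\<^sup>2 = 0" using u by algebra
    then show False using ne' by (simp add: sum_power2_eq_zero_iff)
  qed
  note mid = invariant_form_middle[OF b, folded c_def s_def c'_def s'_def]
  define X where "X = b (-1) (-1)"
  define Y where "Y = b (-1) (-2)"
  define Z where "Z = b (-2) (-1)"
  define W where "W = b (-2) (-2)"
  note mid = mid[folded X_def Y_def Z_def W_def]
  have p: "X + W = Y + Z" using mid(1) k by simp
  have t: "Y = Z" using mid(4) p by simp
  have "2 + s + s' \<noteq> 0"
  proof
    assume "2 + s + s' = 0"
    then have "s = -1" "s' = -1" using sb by linarith+
    then show False using u ne' by simp
  qed
  then have "X = W" using mid(2) t by simp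
  then have z: "X = 0" "Y = 0" "Z = 0" "W = 0" using mid(3) t p by simp_all
  fix m n :: int assume "m \<in> {-2..-1}" "n \<in> {-2..-1}"
  then have "m = -1 \<or> m = -2" "n = -1 \<or> n = -2" by auto
  then show "b m n = 0" using z by (auto simp: X_def Y_def Z_def W_def)
next
  have eq: "cos \<theta> = 0" if "(sin \<theta>)\<^sup>2 = 1" for \<theta> :: real
    using sin_cos_squared_add[of \<theta>] that by simp
  show "\<not> (sin \<theta>' = 1 \<and> (sin \<theta>)\<^sup>2 = 1)"
    using ne ex eq[of \<theta>] eq[of \<theta>'] by (auto simp: power2_eq_1_iff)
  show "\<not> (sin \<theta> = 1 \<and> (sin \<theta>')\<^sup>2 = 1)"
    using ne ex eq[of \<theta>] eq[of \<theta>'] by (auto simp: power2_eq_1_iff)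
qed

lemma invariant_form_delta: "invariant_form \<theta> \<theta> (\<lambda>m n. if m = n then 1 else 0)"
  unfolding invariant_form_def by (simp add: gram_step_delta)

lemma invariant_form_scalar:
  assumes b: "invariant_form \<theta> \<theta> b" and s: "(sin \<theta>)\<^sup>2 \<noteq> 1"
  shows "b m n = b (-1) (-1) * (if m = n then 1 else 0)"
proof -
  define d where "d m n = b m n - b (-1) (-1) * (if m = n then 1 else 0)" for m n
  have d: "invariant_form \<theta> \<theta> d"
    unfolding d_def[abs_def] by (rule invariant_form_diff_scale[OF b invariant_form_delta])
  note mid = invariant_form_middle[OF b]
  have t: "b (-1) (-2) = b (-2) (-1)" using mid(4) by simp
  have "sin \<theta> \<noteq> - 1" using s by auto
  then have q: "b (-1) (-1) = b (-2) (-2)" using mid(2) t by simp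
  then have r: "b (-1) (-2) = 0" "b (-2) (-1) = 0" using mid(3) t by simp_all
  have "d m n = 0"
  proof (rule invariant_form_zero_of_middle[OF d])
    fix m n :: int assume "m \<in> {-2..-1}" "n \<in> {-2..-1}"
    then have "m = -1 \<or> m = -2" "n = -1 \<or> n = -2" by auto
    then show "d m n = 0" using q r by (auto simp: d_def)
  qed (use s in auto)
  then show ?thesis by (simp add: d_def)
qed

text \<open>At the two exceptional parameters every index has a single predecessor with nonzero coefficient,
  and invariance only says that \<open>b m n\<close> equals the value of \<open>b\<close> at the predecessors when \<open>m\<close> and \<open>n\<close> have
  the same parity, and vanishes otherwise.\<close>

lemma invariant_form_exceptional:
  assumes b: "invariant_form \<theta> \<theta> b" and s: "(sin \<theta>)\<^sup>2 = 1"
  shows "m \<in> {-3..0} \<Longrightarrow> n \<in> {-3..0} \<Longrightarrow> m \<noteq> n \<Longrightarrow> b m n = 0"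
    and "sin \<theta> = 1 \<Longrightarrow> b (-2) (-2) = b (-1) (-1)"
    and "sin \<theta> = - 1 \<Longrightarrow> b 0 0 = b (-1) (-1) \<and> b (-3) (-3) = b (-2) (-2)"
proof -
  have c: "cos \<theta> = 0" using sin_cos_squared_add[of \<theta>] s by simp
  have s1: "sin \<theta> = 1 \<or> sin \<theta> = - 1" using s by (simp add: power2_eq_1_iff)
  note e = invariant_form_eqs[OF b]
  show "sin \<theta> = 1 \<Longrightarrow> b (-2) (-2) = b (-1) (-1)"
    using e(1)[of "-1" "-1"] by (simp add: c)
  show "sin \<theta> = - 1 \<Longrightarrow> b 0 0 = b (-1) (-1) \<and> b (-3) (-3) = b (-2) (-2)"
    using e(1)[of 0 0] e(4)[of "-2" "-2"] by (simp add: c)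
  assume mn: "m \<in> {-3..0}" "n \<in> {-3..0}" "m \<noteq> n"
  have 0: "b (2 * p) (2 * q + 1) = 0" "b (2 * p + 1) (2 * q) = 0" for p q
    using e(2)[of p q] e(3)[of p q] by (simp_all add: c)
  have z: "b 0 (-1) = 0" "b 0 (-3) = 0" "b (-2) (-1) = 0" "b (-2) (-3) = 0"
    "b (-1) 0 = 0" "b (-3) 0 = 0" "b (-1) (-2) = 0" "b (-3) (-2) = 0"
    using 0[of 0 "-1"] 0[of 0 "-2"] 0[of "-1" "-1"] 0[of "-1" "-2"] 0(2)[of "-1" 0] 0(2)[of "-2" 0]
      0(2)[of "-2" "-1"] by simp_all
  have "b 0 (-2) = 0" "b (-2) 0 = 0" "b (-1) (-3) = 0" "b (-3) (-1) = 0"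
    using s1 e(1)[of 0 "-1"] e(1)[of "-1" 0] e(4)[of "-1" "-2"] e(4)[of "-2" "-1"]
    by (auto simp: c z)
  moreover have "m = 0 \<or> m = -1 \<or> m = -2 \<or> m = -3" "n = 0 \<or> n = -1 \<or> n = -2 \<or> n = -3"
    using mn by auto
  ultimately show "b m n = 0" using z mn(3) by auto
qed

section \<open>Intertwiners of the wavelet representations\<close>

lemma bounded_clinear_on_compose:
  assumes A: "bounded_clinear_on K L A" and B: "bounded_clinear_on H K B"
  shows "bounded_clinear_on H L (\<lambda>x. A (B x))"
  unfolding bounded_clinear_on_def
proof (intro conjI ballI allI)
  fix x y c assume "x \<in> H"
  then show "A (B x) \<in> L" "A (B (c *\<^sub>C x)) = c *\<^sub>C A (B x)"
    by (simp_all add: bounded_clinear_onD[OF A] bounded_clinear_onD[OF B])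
  assume "y \<in> H"
  with \<open>x \<in> H\<close> show "A (B (x + y)) = A (B x) + A (B y)"
    by (simp add: bounded_clinear_onD[OF A] bounded_clinear_onD[OF B])
next
  obtain a where a: "\<And>x. x \<in> K \<Longrightarrow> norm (A x) \<le> a * norm x"
    using A unfolding bounded_clinear_on_def by blast
  obtain b where b: "\<And>x. x \<in> H \<Longrightarrow> norm (B x) \<le> b * norm x"
    using B unfolding bounded_clinear_on_def by blast
  have "norm (A (B x)) \<le> (\<bar>a\<bar> * b) * norm x" if "x \<in> H" for x
  proof -
    have "norm (A (B x)) \<le> a * norm (B x)"
      using that by (intro a bounded_clinear_onD(1)[OF B])
    also have "\<dots> \<le> \<bar>a\<bar> * norm (B x)"
      by (intro mult_right_mono) auto
    also have "\<dots> \<le> \<bar>a\<bar> * (b * norm x)"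
      by (intro mult_left_mono b that) auto
    finally show ?thesis by (simp add: mult.assoc)
  qed
  then show "\<exists>c. \<forall>x\<in>H. norm (A (B x)) \<le> c * norm x" by blast
qed

lemma bounded_clinear_on_scaleC:
  "bounded_clinear_on UNIV UNIV (\<lambda>x::'a::complex_inner. c *\<^sub>C x)"
  unfolding bounded_clinear_on_def
  by (auto simp: scaleC_add_right scaleC_scaleC mult.commute norm_scaleC_inner intro!: exI[of _ "cmod c"])

lemma bounded_clinear_eq_on_fourier:
  assumes "bounded_clinear_on UNIV UNIV A" "bounded_clinear_on UNIV UNIV B"
    and "\<And>m n. cinner (fourier m) (A (fourier n)) = cinner (fourier m) (B (fourier n))"
  shows "A x = B x"
  by (rule bounded_clinear_eq_on_total[OF orthonormal_fourier total_fourier assms(1,2)])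
    (rule total_seq_eqI[OF total_fourier assms(3)])

lemma wavelet_adj_bounded_clinear: "i < 2 \<Longrightarrow> bounded_clinear_on UNIV UNIV (wavelet_adj \<theta> i)"
  unfolding wavelet_adj_def
  by (intro orthonormal_map_bounded_clinear orthonormal_wavelet_S orthonormal_fourier)

lemma Re_gram_step: "Re (gram_step \<theta>' \<theta> b m n) = gram_step \<theta>' \<theta> (\<lambda>m n. Re (b m n)) m n"
  and Im_gram_step: "Im (gram_step \<theta>' \<theta> b m n) = gram_step \<theta>' \<theta> (\<lambda>m n. Im (b m n)) m n"
  by (simp_all add: gram_step_def Let_def)

lemma angle_inj:
  assumes "\<theta> \<in> {0..<2 * pi}" "\<theta>' \<in> {0..<2 * pi}" "sin \<theta> = sin \<theta>'" "cos \<theta> = cos \<theta>'"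
  shows "\<theta> = \<theta>'"
proof -
  obtain n :: int where n: "\<theta> = \<theta>' + 2 * pi * n"
    using assms(3,4) sin_cos_eq_iff[of \<theta> \<theta>'] by blast
  then have "2 * pi * n < 2 * pi * 1" "2 * pi * (- 1) < 2 * pi * n"
    using assms(1,2) n unfolding atLeastLessThan_iff by linarith+
  then have "real_of_int n < 1" "- 1 < real_of_int n"
    by (simp_all only: mult_less_cancel_left_pos pi_gt_zero zero_less_numeral mult_pos_pos)
  then have "n = 0" by linarith
  with n show ?thesis by simp
qed

lemma sin_3pi_half: "sin (3 * pi / 2) = - 1" "cos (3 * pi / 2) = 0"
  using sin_3over2_pi cos_3over2_pi by (simp_all add: mult.commute)

lemma angle_exceptional:
  assumes \<theta>: "\<theta> \<in> {0..<2 * pi}"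
  shows "sin \<theta> = 1 \<Longrightarrow> \<theta> = pi / 2" "sin \<theta> = - 1 \<Longrightarrow> \<theta> = 3 * pi / 2"
proof -
  have c: "cos \<theta> = 0" if "(sin \<theta>)\<^sup>2 = 1"
    using sin_cos_squared_add[of \<theta>] that by simp
  show "\<theta> = pi / 2" if "sin \<theta> = 1"
    by (rule angle_inj[OF \<theta>]) (use that c in auto)
  show "\<theta> = 3 * pi / 2" if "sin \<theta> = - 1"
    by (rule angle_inj[OF \<theta>]) (use that c in \<open>auto simp: sin_3pi_half\<close>)
qed

text \<open>The closed span of the \<open>e\<^sub>n\<close> with \<open>n \<in> I\<close>, described as the orthogonal complement of the other basis
  vectors.\<close>

definition coord_space :: "int set \<Rightarrow> L2_circle set" where
  "coord_space I = {x. \<forall>n. n \<notin> I \<longrightarrow> cinner (fourier n) x = 0}"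

lemma csubspace_coord_space: "csubspace (coord_space I)"
  by (auto simp: csubspace_def coord_space_def cinner_add_right cinner_scaleC_right)

lemma closed_coord_space: "closed (coord_space I)"
  unfolding closed_sequential_limits
proof (intro allI impI)
  fix x l assume *: "(\<forall>k. x k \<in> coord_space I) \<and> x \<longlonglongrightarrow> l"
  have "cinner (fourier n) l = 0" if "n \<notin> I" for n
  proof -
    have "(\<lambda>k. cinner (fourier n) (x k)) \<longlonglongrightarrow> cinner (fourier n) l"
      using * by (intro tendsto_cinner tendsto_const) auto
    moreover have "cinner (fourier n) (x k) = 0" for k
      using * that by (simp add: coord_space_def)
    ultimately show ?thesis by (simp add: LIMSEQ_const_iff)
  qed
  then show "l \<in> coord_space I" by (simp add: coord_space_def)
qed

lemma fourier_in_coord_space: "n \<in> I \<Longrightarrow> fourier n \<in> coord_space I"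
  by (auto simp: coord_space_def cinner_fourier_fourier)

lemma fourier_neq_0: "fourier n \<noteq> 0"
  using cinner_fourier_fourier[of n n] by auto

lemmas coord_proj = csubspace_coord_space closed_coord_space

lemma orth_proj_coord_space:
  "orth_proj (coord_space I) (fourier n) = (if n \<in> I then fourier n else 0)"
proof (rule orth_proj_unique[OF coord_proj])
  show "(if n \<in> I then fourier n else 0) \<in> coord_space I"
    using fourier_in_coord_space[of n I] csubspace_coord_space[of I] by (auto simp: csubspace_def)
  fix m assume "m \<in> coord_space I"
  then have "cinner m (fourier n) = 0" if "n \<notin> I"
    using that cinner_commute[of m "fourier n"] by (simp add: coord_space_def)
  then show "cinner m (fourier n - (if n \<in> I then fourier n else 0)) = 0"
    by simp
qed

lemma cinner_orth_proj_coord_space: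
  "cinner (fourier n) (orth_proj (coord_space I) x) = (if n \<in> I then cinner (fourier n) x else 0)"
  by (simp add: orth_proj_selfadjoint[OF coord_proj, symmetric] orth_proj_coord_space)

lemma coord_space_orthogonal:
  assumes "I \<inter> J = {}" "x \<in> coord_space I" "y \<in> coord_space J"
  shows "cinner x y = 0"
proof -
  have "orth_proj (coord_space I) y = 0"
  proof (rule total_seq_eqI[OF total_fourier])
    fix n
    have "cinner (fourier n) y = 0" if "n \<in> I"
      using assms that unfolding coord_space_def by blast
    then show "cinner (fourier n) (orth_proj (coord_space I) y) = cinner (fourier n) 0"
      by (simp add: cinner_orth_proj_coord_space)
  qed
  then show ?thesis
    using orth_proj_cinner[OF coord_proj assms(2), of y] by simp
qed

text \<open>Index sets closed, in both directions, under the maps \<open>m \<mapsto> 2 m + j\<close> for which the filters have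
  a nonzero coefficient; their coordinate spaces are invariant under the generators and their
  adjoints.\<close>

definition filter_invariant :: "real \<Rightarrow> int set \<Rightarrow> bool" where
  "filter_invariant \<theta> I \<longleftrightarrow>
     (\<forall>i<2. \<forall>j<4. filter_coeff \<theta> i j \<noteq> 0 \<longrightarrow> (\<forall>m. 2 * m + int j \<in> I \<longleftrightarrow> m \<in> I))"

lemma wavelet_S_coord_space:
  assumes I: "filter_invariant \<theta> I" and x: "x \<in> coord_space I" and i: "i < 2"
  shows "wavelet_S \<theta> i x \<in> coord_space I" "wavelet_adj \<theta> i x \<in> coord_space I"
proof -
  have x0: "cinner (fourier n) x = 0" if "n \<notin> I" for n
    using x that by (simp add: coord_space_def)
  have inv: "filter_coeff \<theta> i j = 0 \<or> (2 * m + int j \<in> I \<longleftrightarrow> m \<in> I)" if "j < 4" for j m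
    using I i that by (auto simp: filter_invariant_def)
  have "cinner (fourier n) (wavelet_adj \<theta> i x) = 0" if n: "n \<notin> I" for n
  proof -
    have "filter_coeff \<theta> i j = 0 \<or> cinner (fourier (2 * n + int j)) x = 0" if "j < 4" for j
      using inv[OF that, of n] n x0 by blast
    from this[of 0] this[of 1] this[of 2] this[of 3] show ?thesis
      by (auto simp: wavelet_adj[OF i, symmetric] wavelet_S_fourier cinner_add_left cinner_scaleC_left)
  qed
  then show "wavelet_adj \<theta> i x \<in> coord_space I" by (simp add: coord_space_def)
  have "cinner (fourier n) (wavelet_S \<theta> i x) = 0" if n: "n \<notin> I" for n
  proof -
    have e: "2 * (n div 2) + int (nat (n mod 2)) = n" "2 * (n div 2 - 1) + int (nat (n mod 2) + 2) = n"
      by simp_all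
    have "nat (n mod 2) < 2" by (simp add: nat_less_iff)
    then have l: "nat (n mod 2) < 4" "nat (n mod 2) + 2 < 4" by simp_all
    have "filter_coeff \<theta> i (nat (n mod 2)) = 0 \<or> cinner (fourier (n div 2)) x = 0"
      "filter_coeff \<theta> i (nat (n mod 2) + 2) = 0 \<or> cinner (fourier (n div 2 - 1)) x = 0"
      using inv[OF l(1), of "n div 2"] inv[OF l(2), of "n div 2 - 1"] n x0 unfolding e by blast+
    then show ?thesis
      by (auto simp: wavelet_adj'[OF i, symmetric] wavelet_adj_fourier[OF i] cinner_add_left
          cinner_scaleR_left)
  qed
  then show "wavelet_S \<theta> i x \<in> coord_space I" by (simp add: coord_space_def)
qed

context
  fixes s0 s1 :: "'a::cstar_algebra"
  assumes cuntz: "cuntz_algebra s0 s1"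
begin

abbreviation (input) wrep :: "real \<Rightarrow> 'a \<Rightarrow> L2_circle \<Rightarrow> L2_circle" where
  "wrep \<equiv> wavelet_rep s0 s1"

lemma generates: "generates_cstar {s0, s1}"
  using cuntz by (simp add: cuntz_algebra_def)

lemma is_wavelet_rep_ex1: "\<exists>!\<pi>. is_wavelet_rep s0 s1 \<theta> \<pi>"
proof (rule ex_ex1I)
  show "\<exists>\<pi>. is_wavelet_rep s0 s1 \<theta> \<pi>"
    using cuntz cuntz_operators_wavelet[of \<theta>] unfolding cuntz_algebra_def is_wavelet_rep_def by blast
  show "\<pi> = \<rho>" if "is_wavelet_rep s0 s1 \<theta> \<pi>" "is_wavelet_rep s0 s1 \<theta> \<rho>" for \<pi> \<rho>
    by (rule representation_unique[OF generates]) (use that in \<open>auto simp: is_wavelet_rep_def\<close>)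
qed

lemma wavelet_rep: "is_wavelet_rep s0 s1 \<theta> (wrep \<theta>)"
  unfolding wavelet_rep_def by (rule theI'[OF is_wavelet_rep_ex1])

lemma rep: "representation_on UNIV (wrep \<theta>)"
  and rep_S: "wrep \<theta> s0 = wavelet_S \<theta> 0" "wrep \<theta> s1 = wavelet_S \<theta> 1"
  using wavelet_rep[of \<theta>] by (auto simp: is_wavelet_rep_def wavelet_S_def)

lemma rep_adj: "wrep \<theta> (star s0) = wavelet_adj \<theta> 0" "wrep \<theta> (star s1) = wavelet_adj \<theta> 1"
proof -
  have "cinner (wrep \<theta> (star a) x) z = cinner x (wrep \<theta> a z)" for a z x
    by (rule representation_onD(8)[OF rep]) auto
  then have *: "cinner z (wrep \<theta> (star a) x) = cinner (wrep \<theta> a z) x" for a z x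
    by (metis cinner_commute)
  show "wrep \<theta> (star s0) = wavelet_adj \<theta> 0" "wrep \<theta> (star s1) = wavelet_adj \<theta> 1"
    by (intro ext cinner_eqI; simp add: * rep_S wavelet_adj)+
qed

lemma intertwiner_form:
  assumes T: "intertwiner UNIV (wrep \<theta>) UNIV (wrep \<theta>') T"
  defines "b \<equiv> \<lambda>m n. cinner (fourier m) (T (fourier n))"
  shows "invariant_form \<theta>' \<theta> (\<lambda>m n. Re (b m n))" "invariant_form \<theta>' \<theta> (\<lambda>m n. Im (b m n))"
proof -
  have Tb: "bounded_clinear_on UNIV UNIV T" and tw: "T (wrep \<theta> a x) = wrep \<theta>' a (T x)" for a x
    using T by (auto simp: intertwiner_def)
  have "b m n = gram_step \<theta>' \<theta> b m n" for m n
  proof -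
    have "b m n = cinner (fourier m) (T (wavelet_S \<theta> 0 (wavelet_adj \<theta> 0 (fourier n))
        + wavelet_S \<theta> 1 (wavelet_adj \<theta> 1 (fourier n))))"
      by (simp only: b_def wavelet_S_adj_sum)
    also have "\<dots> = (\<Sum>i<2. cinner (wavelet_adj \<theta>' i (fourier m)) (T (wavelet_adj \<theta> i (fourier n))))"
      using tw[of s0] tw[of s1]
      by (simp add: bounded_clinear_onD(2)[OF Tb] rep_S sum_lessThan_2 cinner_add_right wavelet_adj')
    also have "\<dots> = gram_step \<theta>' \<theta> b m n"
      unfolding b_def by (rule sum_cinner_wavelet_adj[OF Tb])
    finally show ?thesis .
  qed
  then show "invariant_form \<theta>' \<theta> (\<lambda>m n. Re (b m n))" "invariant_form \<theta>' \<theta> (\<lambda>m n. Im (b m n))"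
    unfolding invariant_form_def Re_gram_step[symmetric] Im_gram_step[symmetric] by metis+
qed

lemma orth_proj_intertwiner:
  assumes "csubspace M" "closed M" "\<And>a x. x \<in> M \<Longrightarrow> wrep \<theta> a x \<in> M"
  shows "intertwiner UNIV (wrep \<theta>) UNIV (wrep \<theta>) (orth_proj M)"
proof -
  have "bounded_clinear_on UNIV UNIV (orth_proj M)"
    using orth_proj_bounded_clinear[OF assms(1,2)] unfolding bounded_clinear_on_def by simp
  then show ?thesis
    using orth_proj_intertwines[OF rep assms] by (simp add: intertwiner_def)
qed

lemma disjoint_wavelet_reps:
  assumes "\<theta> \<in> {0..<2 * pi}" "\<theta>' \<in> {0..<2 * pi}" "\<theta> \<noteq> \<theta>'" "{\<theta>, \<theta>'} \<noteq> {pi / 2, 3 * pi / 2}"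
  shows "disjoint_reps UNIV (wrep \<theta>) UNIV (wrep \<theta>')"
  unfolding disjoint_reps_def
proof (intro allI impI ballI)
  fix T x assume T: "intertwiner UNIV (wrep \<theta>) UNIV (wrep \<theta>') T"
  have ne: "(sin \<theta>, cos \<theta>) \<noteq> (sin \<theta>', cos \<theta>')"
    using angle_inj[OF assms(1,2)] assms(3) by auto
  have ex: "\<not> (sin \<theta> = 1 \<and> sin \<theta>' = - 1)" "\<not> (sin \<theta> = - 1 \<and> sin \<theta>' = 1)"
    using assms angle_exceptional by blast+
  have "cinner (fourier m) (T (fourier n)) = 0" for m n
    using invariant_form_distinct[OF intertwiner_form(1)[OF T] ne ex, of m n]
      invariant_form_distinct[OF intertwiner_form(2)[OF T] ne ex, of m n]
    by (simp add: complex_eq_iff)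
  then show "T x = 0"
    using T bounded_clinear_on_scaleC[of 0]
    by (intro bounded_clinear_eq_on_fourier[of T "\<lambda>_. 0"]) (auto simp: intertwiner_def)
qed

text \<open>A subspace whose projection acts on \<open>H\<close> as a scalar is zero or all of \<open>H\<close>.\<close>

lemma irreducible_of_scalar_projections:
  assumes H: "representation_on H (wrep \<theta>)" "H \<noteq> {0}"
    and sc: "\<And>M. csubspace M \<Longrightarrow> closed M \<Longrightarrow> M \<subseteq> H \<Longrightarrow> (\<And>a x. x \<in> M \<Longrightarrow> wrep \<theta> a x \<in> M) \<Longrightarrow>
      \<exists>k. \<forall>x\<in>H. orth_proj M x = k *\<^sub>C x"
  shows "irreducible_on H (wrep \<theta>)"
  unfolding irreducible_on_def
proof (intro conjI H allI impI)
  fix M assume M: "M \<subseteq> H \<and> csubspace M \<and> closed M \<and> (\<forall>a. \<forall>x\<in>M. wrep \<theta> a x \<in> M)"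
  then obtain k where k: "\<And>x. x \<in> H \<Longrightarrow> orth_proj M x = k *\<^sub>C x"
    using sc[of M] by blast
  show "M = {0} \<or> M = H"
  proof (cases "M = {0}")
    case False
    moreover have "0 \<in> M" using M by (simp add: csubspace_def)
    ultimately obtain x where x: "x \<in> M" "x \<noteq> 0" by blast
    have "k *\<^sub>C x = x"
      using orth_proj_fixed[of M x] k[of x] x M by auto
    then have "(k - 1) *\<^sub>C x = 0"
      using scaleC_add_left[of "k - 1" 1 x] by simp
    then have "k = 1"
      using norm_scaleC_inner[of "k - 1" x] x(2) by simp
    then have "x \<in> M" if "x \<in> H" for x
      using orth_proj_mem[of M x] k[OF that] M by simp
    then show ?thesis using M by blast
  qed simp
qed

lemma irreducible_wavelet_rep:
  assumes "(sin \<theta>)\<^sup>2 \<noteq> 1"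
  shows "irreducible_on UNIV (wrep \<theta>)"
proof (rule irreducible_of_scalar_projections[OF rep])
  show "(UNIV :: L2_circle set) \<noteq> {0}" using fourier_neq_0 by blast
  fix M assume M: "csubspace M" "closed M" "\<And>a x. x \<in> M \<Longrightarrow> wrep \<theta> a x \<in> M"
  note P = orth_proj_intertwiner[OF M]
  define k where "k = cinner (fourier (-1)) (orth_proj M (fourier (-1)))"
  have "cinner (fourier m) (orth_proj M (fourier n)) = cinner (fourier m) (k *\<^sub>C fourier n)" for m n
    using invariant_form_scalar[OF intertwiner_form(1)[OF P] assms, of m n]
      invariant_form_scalar[OF intertwiner_form(2)[OF P] assms, of m n]
    by (simp add: k_def complex_eq_iff cinner_scaleC_right cinner_fourier_fourier)
  then have "orth_proj M x = k *\<^sub>C x" for x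
    using P bounded_clinear_on_scaleC
    by (intro bounded_clinear_eq_on_fourier) (auto simp: intertwiner_def)
  then show "\<exists>k. \<forall>x\<in>UNIV. orth_proj M x = k *\<^sub>C x" by blast
qed

lemma rep_coord_space:
  assumes "filter_invariant \<theta> I"
  shows "representation_on (coord_space I) (wrep \<theta>)"
proof (rule representation_invariant_subspace[OF generates rep coord_proj])
  fix g x assume "g \<in> {s0, s1, star s0, star s1}" "x \<in> coord_space I"
  then show "wrep \<theta> g x \<in> coord_space I"
    using wavelet_S_coord_space[OF assms, of x] by (auto simp: rep_S rep_adj)
qed

lemma direct_sum_coord_spaces:
  assumes inv: "\<And>i. i < N \<Longrightarrow> filter_invariant \<theta> (I i)"
    and part: "\<And>m. \<exists>!i. i < N \<and> m \<in> I i"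
  shows "direct_sum_of_reps UNIV (wrep \<theta>) N (\<lambda>i. coord_space (I i))"
  unfolding direct_sum_of_reps_def
proof (intro conjI allI impI ballI rep)
  fix i assume "i < N"
  then show "representation_on (coord_space (I i)) (wrep \<theta>)" by (intro rep_coord_space inv)
next
  fix i j x y assume "i < N" "j < N" "i \<noteq> j" "x \<in> coord_space (I i)" "y \<in> coord_space (I j)"
  moreover from this have "I i \<inter> I j = {}" using part by blast
  ultimately show "cinner x y = 0" using coord_space_orthogonal by blast
next
  fix x
  have "x = (\<Sum>i<N. orth_proj (coord_space (I i)) x)"
  proof (rule total_seq_eqI[OF total_fourier])
    fix m
    obtain k where k: "k < N" "m \<in> I k" "\<And>i. i < N \<Longrightarrow> m \<in> I i \<Longrightarrow> i = k"
      using part[of m] by blast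
    have "cinner (fourier m) (\<Sum>i<N. orth_proj (coord_space (I i)) x)
        = (\<Sum>i<N. if i = k then cinner (fourier m) x else 0)"
      unfolding cinner_sum_right cinner_orth_proj_coord_space
      using k by (intro sum.cong if_cong refl) blast
    also have "\<dots> = cinner (fourier m) x" using k(1) by simp
    finally show "cinner (fourier m) x = cinner (fourier m) (\<Sum>i<N. orth_proj (coord_space (I i)) x)"
      by simp
  qed
  then show "\<exists>y. (\<forall>i<N. y i \<in> coord_space (I i)) \<and> x = (\<Sum>i<N. y i)"
    by (intro exI[of _ "\<lambda>i. orth_proj (coord_space (I i)) x"]) (auto intro: orth_proj_mem[OF coord_proj])
qed simp

lemma coord_proj_intertwiner:
  assumes "filter_invariant \<theta> I"
  shows "intertwiner UNIV (wrep \<theta>) UNIV (wrep \<theta>) (orth_proj (coord_space I))"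
  by (intro orth_proj_intertwiner coord_proj representation_on_mem[OF rep_coord_space[OF assms]])

lemma disjoint_coord_spaces:
  assumes s: "(sin \<theta>)\<^sup>2 = 1" and I: "filter_invariant \<theta> I" and J: "filter_invariant \<theta> J"
    and IJ: "I \<inter> J = {}"
  shows "disjoint_reps (coord_space I) (wrep \<theta>) (coord_space J) (wrep \<theta>)"
  unfolding disjoint_reps_def
proof (intro allI impI ballI)
  fix T x assume T: "intertwiner (coord_space I) (wrep \<theta>) (coord_space J) (wrep \<theta>) T"
    and x: "x \<in> coord_space I"
  \<comment> \<open>Composition with the projection extends \<open>T\<close> to an intertwiner on the whole space.\<close>
  define P where "P = orth_proj (coord_space I)"
  have P: "intertwiner UNIV (wrep \<theta>) UNIV (wrep \<theta>) P"
    unfolding P_def by (rule coord_proj_intertwiner[OF I])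
  have Pm: "P y \<in> coord_space I" for y
    unfolding P_def by (rule orth_proj_mem[OF coord_proj])
  have Tb: "bounded_clinear_on (coord_space I) (coord_space J) T" using T by (simp add: intertwiner_def)
  have T0: "T 0 = 0" using Tb csubspace_coord_space by (rule bounded_clinear_on_zero)
  have Tm: "T (P y) \<in> coord_space J" for y by (rule bounded_clinear_onD(1)[OF Tb Pm])
  have TPb: "bounded_clinear_on UNIV UNIV (\<lambda>x. T (P x))"
    using bounded_clinear_on_compose[OF Tb orth_proj_bounded_clinear[OF coord_proj]]
    unfolding P_def bounded_clinear_on_def by simp
  have TP: "intertwiner UNIV (wrep \<theta>) UNIV (wrep \<theta>) (\<lambda>x. T (P x))"
    using T P Pm TPb by (simp add: intertwiner_def)
  have z: "cinner (fourier m) (T (P (fourier n))) = 0" if "n \<notin> I \<or> m \<notin> J" for m n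
  proof (cases "n \<in> I")
    case True
    then show ?thesis using that Tm[of "fourier n"] unfolding coord_space_def by blast
  qed (simp add: P_def orth_proj_coord_space T0)
  note F = intertwiner_form[OF TP]
  have "cinner (fourier m) (T (P (fourier n))) = 0" if "m \<in> {-3..0}" "n \<in> {-3..0}" for m n
  proof (cases "m = n")
    case True
    then show ?thesis using z IJ by blast
  next
    case False
    then show ?thesis
      using invariant_form_exceptional(1)[OF F(1) s that] invariant_form_exceptional(1)[OF F(2) s that]
      by (simp add: complex_eq_iff)
  qed
  then have "cinner (fourier m) (T (P (fourier n))) = 0" for m n
    using invariant_form_zero[OF F(1), of m n] invariant_form_zero[OF F(2), of m n]
    by (simp add: complex_eq_iff)
  then have "T (P x) = 0"
    using TPb bounded_clinear_on_scaleC[of 0]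
    by (intro bounded_clinear_eq_on_fourier[of "\<lambda>x. T (P x)" "\<lambda>_. 0"]) auto
  then show "T x = 0"
    using orth_proj_fixed[OF coord_proj x] by (simp add: P_def)
qed

text \<open>The projection onto an invariant subspace of \<open>coord_space I\<close> and \<open>\<kappa>\<close> times the projection onto
  \<open>coord_space I\<close> have the same matrix entries over the window, hence coincide.\<close>

lemma irreducible_coord_space:
  assumes s: "(sin \<theta>)\<^sup>2 = 1" and I: "filter_invariant \<theta> I" and k: "k \<in> I"
    and diag: "\<And>b n. invariant_form \<theta> \<theta> b \<Longrightarrow> n \<in> I \<Longrightarrow> n \<in> {-3..0} \<Longrightarrow> b n n = b k k"
  shows "irreducible_on (coord_space I) (wrep \<theta>)"
proof (rule irreducible_of_scalar_projections[OF rep_coord_space[OF I]])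
  show "coord_space I \<noteq> {0}"
    using fourier_in_coord_space[OF k] fourier_neq_0[of k] by blast
  fix M assume M: "csubspace M" "closed M" "M \<subseteq> coord_space I" "\<And>a x. x \<in> M \<Longrightarrow> wrep \<theta> a x \<in> M"
  define Q where "Q = orth_proj M"
  define P where "P = orth_proj (coord_space I)"
  have Q: "intertwiner UNIV (wrep \<theta>) UNIV (wrep \<theta>) Q"
    unfolding Q_def by (rule orth_proj_intertwiner[OF M(1,2,4)])
  have P: "intertwiner UNIV (wrep \<theta>) UNIV (wrep \<theta>) P"
    unfolding P_def by (rule coord_proj_intertwiner[OF I])
  have Pf: "cinner (fourier m) (P (fourier n)) = (if m = n \<and> n \<in> I then 1 else 0)" for m n
    by (simp add: P_def orth_proj_coord_space cinner_fourier_fourier)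
  have Q0: "Q (fourier n) = 0" if "n \<notin> I" for n
    unfolding Q_def
  proof (rule orth_proj_unique[OF M(1,2)])
    show "0 \<in> M" using M(1) by (simp add: csubspace_def)
    show "cinner m (fourier n - 0) = 0" if "m \<in> M" for m
      using M(3) that \<open>n \<notin> I\<close> cinner_commute[of m "fourier n"] by (auto simp: coord_space_def)
  qed
  define \<kappa> where "\<kappa> = cinner (fourier k) (Q (fourier k))"
  note FQ = intertwiner_form[OF Q] and FP = intertwiner_form(1)[OF P]
  note FR = invariant_form_diff_scale[OF FQ(1) FP, of "Re \<kappa>"]
  note FI = invariant_form_diff_scale[OF FQ(2) FP, of "Im \<kappa>"]
  have box: "cinner (fourier m) (Q (fourier n)) = \<kappa> * cinner (fourier m) (P (fourier n))"
    if mn: "m \<in> {-3..0}" "n \<in> {-3..0}" for m n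
  proof (cases "m = n")
    case False
    then show ?thesis
      using invariant_form_exceptional(1)[OF FQ(1) s mn] invariant_form_exceptional(1)[OF FQ(2) s mn]
      by (simp add: complex_eq_iff Pf)
  next
    case True
    show ?thesis
    proof (cases "n \<in> I")
      case in_I: True
      show ?thesis
        using diag[OF FQ(1) in_I mn(2)] diag[OF FQ(2) in_I mn(2)] True in_I
        by (simp add: complex_eq_iff Pf \<kappa>_def)
    qed (simp add: Pf Q0)
  qed
  have "cinner (fourier m) (Q (fourier n)) = \<kappa> * cinner (fourier m) (P (fourier n))" for m n
    using invariant_form_zero[OF FR, of m n] invariant_form_zero[OF FI, of m n] box
    by (simp add: complex_eq_iff Pf)
  then have "Q x = \<kappa> *\<^sub>C P x" for x
    using Q P bounded_clinear_on_compose[OF bounded_clinear_on_scaleC, of UNIV P \<kappa>]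
    by (intro bounded_clinear_eq_on_fourier[of Q "\<lambda>x. \<kappa> *\<^sub>C P x"])
      (auto simp: intertwiner_def cinner_scaleC_right)
  then have "orth_proj M x = \<kappa> *\<^sub>C x" if "x \<in> coord_space I" for x
    using orth_proj_fixed[OF coord_proj that] by (simp add: P_def Q_def)
  then show "\<exists>k. \<forall>x\<in>coord_space I. orth_proj M x = k *\<^sub>C x" by blast
qed

end

section \<open>The two reducible representations\<close>

lemma less_two_cases: "(i::nat) < 2 \<Longrightarrow> i = 0 \<or> i = 1"
  by auto

lemma filter_coeff_exceptional:
  assumes i: "i < 2"
  shows "filter_coeff (pi / 2) i 1 = 0" "filter_coeff (pi / 2) i 2 = 0"
    "filter_coeff (3 * pi / 2) i 0 = 0" "filter_coeff (3 * pi / 2) i 3 = 0"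
    "filter_coeff (3 * pi / 2) i 2 = filter_coeff (pi / 2) i 0"
    "filter_coeff (3 * pi / 2) i 1 = filter_coeff (pi / 2) i 3"
  using less_two_cases[OF i]
  by (auto simp: filter_coeff_def coeff_a_def sin_3pi_half numeral_2_eq_2 numeral_3_eq_3)

lemma less_four_cases: "(j::nat) < 4 \<Longrightarrow> j = 0 \<or> j = 1 \<or> j = 2 \<or> j = 3"
  by auto

lemma filter_invariant_pi_half:
  assumes "\<And>m. 2 * m \<in> I \<longleftrightarrow> m \<in> I" "\<And>m. 2 * m + 3 \<in> I \<longleftrightarrow> m \<in> I"
  shows "filter_invariant (pi / 2) I"
  unfolding filter_invariant_def
proof (intro allI impI)
  fix i j m assume "i < (2::nat)" "j < (4::nat)" "filter_coeff (pi / 2) i j \<noteq> 0"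
  then have "j = 0 \<or> j = 3"
    using less_four_cases[of j] filter_coeff_exceptional(1,2)[of i] by blast
  then show "2 * m + int j \<in> I \<longleftrightarrow> m \<in> I"
    using assms[of m] by (elim disjE) simp_all
qed

lemma filter_invariant_3pi_half:
  assumes "\<And>m. 2 * m + 1 \<in> I \<longleftrightarrow> m \<in> I" "\<And>m. 2 * m + 2 \<in> I \<longleftrightarrow> m \<in> I"
  shows "filter_invariant (3 * pi / 2) I"
  unfolding filter_invariant_def
proof (intro allI impI)
  fix i j m assume "i < (2::nat)" "j < (4::nat)" "filter_coeff (3 * pi / 2) i j \<noteq> 0"
  then have "j = 1 \<or> j = 2"
    using less_four_cases[of j] filter_coeff_exceptional(3,4)[of i] by blast
  then show "2 * m + int j \<in> I \<longleftrightarrow> m \<in> I"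
    using assms[of m] by (elim disjE) simp_all
qed

text \<open>The index sets of the irreducible summands, in an order for which equivalent summands have the
  same number. The last clause of each definition also covers the numbers that do not occur.\<close>

definition index_3pi_half :: "nat \<Rightarrow> int set" where
  "index_3pi_half i = (if i = 0 then {n. - 1 \<le> n} else {n. n \<le> - 2})"

definition index_pi_half :: "nat \<Rightarrow> int set" where
  "index_pi_half i = (if i = 0 then {n. 3 dvd n \<and> n < 0} else if i = 1 then {n. 3 dvd n \<and> 0 \<le> n}
     else {n. \<not> 3 dvd n})"

lemma filter_invariant_index_3pi_half: "filter_invariant (3 * pi / 2) (index_3pi_half i)"
  by (rule filter_invariant_3pi_half) (auto simp: index_3pi_half_def)

lemma filter_invariant_index_pi_half: "filter_invariant (pi / 2) (index_pi_half i)"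
proof -
  have "3 dvd 2 * m \<longleftrightarrow> 3 dvd m" "3 dvd 2 * m + 3 \<longleftrightarrow> 3 dvd m"
    "3 dvd m \<and> 2 * m + 3 < 0 \<longleftrightarrow> 3 dvd m \<and> m < 0" "3 dvd m \<and> 0 \<le> 2 * m + 3 \<longleftrightarrow> 3 dvd m \<and> 0 \<le> m"
    for m :: int
    by presburger+
  then show ?thesis
    by (intro filter_invariant_pi_half) (auto simp: index_pi_half_def)
qed

lemma index_3pi_half_partition: "\<exists>!i. i < 2 \<and> m \<in> index_3pi_half i"
proof (cases "- 1 \<le> m")
  case True
  then show ?thesis by (intro ex1I[of _ 0]) (auto simp: index_3pi_half_def split: if_splits)
next
  case False
  then show ?thesis by (intro ex1I[of _ 1]) (auto simp: index_3pi_half_def split: if_splits)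
qed

lemma index_pi_half_partition: "\<exists>!i. i < 3 \<and> m \<in> index_pi_half i"
proof -
  consider "3 dvd m" "m < 0" | "3 dvd m" "0 \<le> m" | "\<not> 3 dvd m" by linarith
  then show ?thesis
  proof cases
    case 1
    then show ?thesis by (intro ex1I[of _ 0]) (auto simp: index_pi_half_def split: if_splits)
  next
    case 2
    then show ?thesis by (intro ex1I[of _ 1]) (auto simp: index_pi_half_def split: if_splits)
  next
    case 3
    then show ?thesis by (intro ex1I[of _ 2]) (auto simp: index_pi_half_def split: if_splits)
  qed
qed

text \<open>The isometry \<open>e\<^sub>n \<mapsto> e\<^bsub>-3(n+2)\<^esub>\<close>, that is, \<open>\<xi> \<mapsto> z\<^bsup>-6\<^esup> \<xi>(z\<^bsup>-3\<^esup>)\<close>, and its adjoint \<open>codilation\<close>.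
  It works because \<open>dilate\<close> carries \<open>2 n + 1\<close> and \<open>2 n + 2\<close>, the indices reached from \<open>n\<close> at \<open>3\<pi>/2\<close>, to
  \<open>2 (dilate n) + 3\<close> and \<open>2 (dilate n)\<close>, the indices reached from \<open>dilate n\<close> at \<open>\<pi>/2\<close>, with matching
  coefficients.\<close>

definition dilate :: "int \<Rightarrow> int" where
  "dilate n = - 3 * (n + 2)"

lemma dilate_eq_iff: "dilate m = dilate n \<longleftrightarrow> m = n"
  by (auto simp: dilate_def)

lemma dilate_image: "i < 2 \<Longrightarrow> dilate ` index_3pi_half i = index_pi_half i"
proof (intro set_eqI iffI)
  fix n assume i: "i < 2" and "n \<in> dilate ` index_3pi_half i"
  then show "n \<in> index_pi_half i"
    using less_two_cases[OF i] by (auto simp: dilate_def index_3pi_half_def index_pi_half_def)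
next
  fix n assume i: "i < 2" and n: "n \<in> index_pi_half i"
  then have "3 dvd n" using less_two_cases[OF i] by (auto simp: index_pi_half_def)
  then obtain k where k: "n = 3 * k" by blast
  then have "n = dilate (- k - 2)" by (simp add: dilate_def)
  moreover have "- k - 2 \<in> index_3pi_half i"
    using n k less_two_cases[OF i] by (auto simp: index_3pi_half_def index_pi_half_def)
  ultimately show "n \<in> dilate ` index_3pi_half i" by blast
qed

definition dilation :: "L2_circle \<Rightarrow> L2_circle" where
  "dilation = orthonormal_map fourier (\<lambda>n. fourier (dilate n))"

lemma orthonormal_dilate: "orthonormal_seq (\<lambda>n. fourier (dilate n))"
  by (simp add: orthonormal_seq_def cinner_fourier_fourier dilate_eq_iff)

lemma dilation_bounded_clinear: "bounded_clinear_on UNIV UNIV dilation"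
  unfolding dilation_def by (rule orthonormal_map_bounded_clinear[OF orthonormal_fourier orthonormal_dilate])

lemma dilation_fourier: "dilation (fourier n) = fourier (dilate n)"
  unfolding dilation_def by (rule orthonormal_map_apply[OF orthonormal_fourier orthonormal_dilate])

lemma dilation_coeff: "cinner (fourier (dilate n)) (dilation x) = cinner (fourier n) x"
  unfolding dilation_def by (rule orthonormal_map_coeff[OF orthonormal_fourier orthonormal_dilate])

definition codilation :: "L2_circle \<Rightarrow> L2_circle" where
  "codilation = orthonormal_map (\<lambda>n. fourier (dilate n)) fourier"

lemma codilation_coeff: "cinner (fourier n) (codilation x) = cinner (fourier (dilate n)) x"
  unfolding codilation_def by (rule orthonormal_map_coeff[OF orthonormal_dilate orthonormal_fourier])

lemma cinner_dilation: "cinner (dilation x) y = cinner x (codilation y)"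
  unfolding dilation_def codilation_def
  by (rule orthonormal_map_adjoint[OF orthonormal_fourier orthonormal_dilate])

lemma dilation_isometry: "cinner (dilation x) (dilation y) = cinner x y"
proof -
  have "codilation (dilation y) = y"
    by (rule total_seq_eqI[OF total_fourier]) (simp add: codilation_coeff dilation_coeff)
  then show ?thesis by (simp add: cinner_dilation)
qed

lemma dilation_coeff_outside:
  assumes "n \<notin> range dilate"
  shows "cinner (fourier n) (dilation x) = 0"
proof -
  have "codilation (fourier n) = 0"
    using assms by (intro total_seq_eqI[OF total_fourier])
      (auto simp: codilation_coeff cinner_fourier_fourier)
  then have "cinner (dilation x) (fourier n) = 0" by (simp add: cinner_dilation)
  then show ?thesis using cinner_commute[of "fourier n" "dilation x"] by simp
qed

lemma dilation_coord_space: "dilation ` coord_space I = coord_space (dilate ` I)"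
proof (intro set_eqI iffI)
  fix y assume "y \<in> dilation ` coord_space I"
  then obtain x where x: "x \<in> coord_space I" "y = dilation x" by blast
  have "cinner (fourier n) y = 0" if "n \<notin> dilate ` I" for n
  proof (cases "n \<in> range dilate")
    case True
    then obtain k where "n = dilate k" by blast
    then show ?thesis using that x by (auto simp: dilation_coeff coord_space_def)
  qed (simp add: x dilation_coeff_outside)
  then show "y \<in> coord_space (dilate ` I)" by (simp add: coord_space_def)
next
  fix y assume y: "y \<in> coord_space (dilate ` I)"
  have y0: "cinner (fourier n) y = 0" if "n \<notin> dilate ` I" for n
    using y that by (simp add: coord_space_def)
  have "dilate n \<notin> dilate ` I" if "n \<notin> I" for n
    using that by (auto simp: dilate_eq_iff)
  then have "codilation y \<in> coord_space I"
    by (simp add: coord_space_def codilation_coeff y0)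
  moreover have "dilation (codilation y) = y"
  proof (rule total_seq_eqI[OF total_fourier])
    fix n show "cinner (fourier n) (dilation (codilation y)) = cinner (fourier n) y"
    proof (cases "n \<in> range dilate")
      case True
      then show ?thesis by (auto simp: dilation_coeff codilation_coeff)
    next
      case False
      then have "n \<notin> dilate ` I" by blast
      then show ?thesis by (simp add: dilation_coeff_outside False y0)
    qed
  qed
  ultimately show "y \<in> dilation ` coord_space I" by (metis image_eqI)
qed

lemma dilation_wavelet_S:
  assumes i: "i < 2"
  shows "dilation (wavelet_S (3 * pi / 2) i x) = wavelet_S (pi / 2) i (dilation x)"
proof (rule bounded_clinear_eq_on_total[OF orthonormal_fourier total_fourier,
      where A = "\<lambda>x. dilation (wavelet_S (3 * pi / 2) i x)" and B = "\<lambda>x. wavelet_S (pi / 2) i (dilation x)"])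
  show "bounded_clinear_on UNIV UNIV (\<lambda>x. dilation (wavelet_S (3 * pi / 2) i x))"
    "bounded_clinear_on UNIV UNIV (\<lambda>x. wavelet_S (pi / 2) i (dilation x))"
    by (intro bounded_clinear_on_compose[OF dilation_bounded_clinear wavelet_S_bounded_clinear]
        bounded_clinear_on_compose[OF wavelet_S_bounded_clinear dilation_bounded_clinear])+
  fix n
  have "dilate (2 * n + 2) = 2 * dilate n" "dilate (2 * n + 1) = 2 * dilate n + 3"
    by (simp_all add: dilate_def)
  then show "dilation (wavelet_S (3 * pi / 2) i (fourier n)) = wavelet_S (pi / 2) i (dilation (fourier n))"
    unfolding wavelet_S_fourier dilation_fourier filter_coeff_exceptional[OF i]
    by (simp add: bounded_clinear_onD[OF dilation_bounded_clinear] dilation_fourier)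
qed

lemma dilation_wavelet_adj:
  assumes i: "i < 2"
  shows "dilation (wavelet_adj (3 * pi / 2) i x) = wavelet_adj (pi / 2) i (dilation x)"
proof (rule bounded_clinear_eq_on_total[OF orthonormal_fourier total_fourier,
      where A = "\<lambda>x. dilation (wavelet_adj (3 * pi / 2) i x)" and B = "\<lambda>x. wavelet_adj (pi / 2) i (dilation x)"])
  show "bounded_clinear_on UNIV UNIV (\<lambda>x. dilation (wavelet_adj (3 * pi / 2) i x))"
    "bounded_clinear_on UNIV UNIV (\<lambda>x. wavelet_adj (pi / 2) i (dilation x))"
    by (intro bounded_clinear_on_compose[OF dilation_bounded_clinear wavelet_adj_bounded_clinear[OF i]]
        bounded_clinear_on_compose[OF wavelet_adj_bounded_clinear[OF i] dilation_bounded_clinear])+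
  fix n
  have R: "dilation (r *\<^sub>R x) = r *\<^sub>R dilation x" for r x
    using bounded_clinear_onD(3)[OF dilation_bounded_clinear, of x "of_real r"]
    by (simp add: scaleC_of_real)
  note c = filter_coeff_exceptional[OF i]
  show "dilation (wavelet_adj (3 * pi / 2) i (fourier n)) = wavelet_adj (pi / 2) i (dilation (fourier n))"
  proof (cases n rule: int_parity_cases)
    case (even r)
    have d: "dilate (2 * r) div 2 = dilate (r - 1)" "nat (dilate (2 * r) mod 2) = 0"
      by (simp_all add: dilate_def)
    have "nat (2 * r mod 2) = 0" "2 * r div 2 = r" "(0::nat) + 2 = 2" by simp_all
    then show ?thesis
      unfolding even dilation_fourier wavelet_adj_fourier[OF i] d
      by (simp only: c scaleR_zero_left add_0_left add_0_right R dilation_fourier)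
  next
    case (odd r)
    have "dilate (2 * r + 1) = 2 * (dilate r + 1) + 1" by (simp add: dilate_def)
    then have d: "dilate (2 * r + 1) div 2 - 1 = dilate r" "nat (dilate (2 * r + 1) mod 2) = 1"
      by simp_all
    have "nat ((2 * r + 1) mod 2) = 1" "(2 * r + 1) div 2 = r" "(1::nat) + 2 = 3" by simp_all
    then show ?thesis
      unfolding odd dilation_fourier wavelet_adj_fourier[OF i] d
      by (simp only: c scaleR_zero_left add_0_left add_0_right R dilation_fourier)
  qed
qed

lemma unitarily_equivalent_summands:
  fixes s0 s1 :: "'a::cstar_algebra"
  assumes C: "cuntz_algebra s0 s1" and i: "i < 2"
  shows "unitarily_equivalent
    (coord_space (index_3pi_half i)) (wavelet_rep s0 s1 (3 * pi / 2))
    (coord_space (index_pi_half i)) (wavelet_rep s0 s1 (pi / 2))"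
  unfolding unitarily_equivalent_def
proof (intro exI[of _ dilation] conjI ballI)
  show im: "dilation ` coord_space (index_3pi_half i) = coord_space (index_pi_half i)"
    by (simp add: dilation_coord_space dilate_image[OF i])
  show "intertwiner (coord_space (index_3pi_half i)) (wavelet_rep s0 s1 (3 * pi / 2))
      (coord_space (index_pi_half i)) (wavelet_rep s0 s1 (pi / 2)) dilation"
  proof (rule intertwiner_generators[OF generates[OF C] rep_coord_space[OF C] rep_coord_space[OF C]])
    show "bounded_clinear_on (coord_space (index_3pi_half i)) (coord_space (index_pi_half i)) dilation"
    proof -
      have "dilation x \<in> coord_space (index_pi_half i)" if "x \<in> coord_space (index_3pi_half i)" for x
        using im that by blast
      then show ?thesis
        using dilation_bounded_clinear unfolding bounded_clinear_on_def by (simp, blast)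
    qed
    fix g x assume "g \<in> {s0, s1, star s0, star s1}"
    then show "dilation (wavelet_rep s0 s1 (3 * pi / 2) g x) = wavelet_rep s0 s1 (pi / 2) g (dilation x)"
      by (auto simp: rep_S[OF C] rep_adj[OF C] dilation_wavelet_S dilation_wavelet_adj)
  qed (rule filter_invariant_index_3pi_half filter_invariant_index_pi_half)+
qed (rule dilation_isometry)

lemma irreducible_summand_3pi_half:
  fixes s0 s1 :: "'a::cstar_algebra"
  assumes C: "cuntz_algebra s0 s1"
  shows "irreducible_on (coord_space (index_3pi_half i)) (wavelet_rep s0 s1 (3 * pi / 2))"
proof (rule irreducible_coord_space[OF C _ filter_invariant_index_3pi_half])
  show s: "(sin (3 * pi / 2))\<^sup>2 = 1" by (simp add: sin_3pi_half)
  define k :: int where "k = (if i = 0 then - 1 else - 2)"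
  show "k \<in> index_3pi_half i" by (simp add: k_def index_3pi_half_def)
  fix b n assume b: "invariant_form (3 * pi / 2) (3 * pi / 2) b"
    and n: "n \<in> index_3pi_half i" "n \<in> {-3..0}"
  then have "n \<in> (if i = 0 then {-1, 0} else {-3, -2})" by (auto simp: index_3pi_half_def split: if_splits)
  then show "b n n = b k k"
    using invariant_form_exceptional(3)[OF b s] by (auto simp: sin_3pi_half k_def split: if_splits)
qed

lemma irreducible_summand_pi_half:
  fixes s0 s1 :: "'a::cstar_algebra"
  assumes C: "cuntz_algebra s0 s1"
  shows "irreducible_on (coord_space (index_pi_half i)) (wavelet_rep s0 s1 (pi / 2))"
proof (rule irreducible_coord_space[OF C _ filter_invariant_index_pi_half])
  show s: "(sin (pi / 2))\<^sup>2 = 1" by simp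
  define k :: int where "k = (if i = 0 then - 3 else if i = 1 then 0 else - 1)"
  show "k \<in> index_pi_half i" by (simp add: k_def index_pi_half_def)
  fix b n assume b: "invariant_form (pi / 2) (pi / 2) b"
    and n: "n \<in> index_pi_half i" "n \<in> {-3..0}"
  have "n = 0 \<or> n = -1 \<or> n = -2 \<or> n = -3" using n(2) by auto
  then have "n \<in> (if i = 0 then {-3} else if i = 1 then {0} else {-2, -1})"
    using n(1) by (auto simp: index_pi_half_def split: if_splits)
  then show "b n n = b k k"
    using invariant_form_exceptional(2)[OF b s] by (auto simp: k_def split: if_splits)
qed

lemma partition_disjoint:
  assumes "\<And>m. \<exists>!i. i < (N::nat) \<and> m \<in> I i" "i < N" "j < N" "i \<noteq> j"
  shows "I i \<inter> I j = {}"
proof -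
  have False if "m \<in> I i" "m \<in> I j" for m
    using assms(1)[of m] assms(2-4) that by blast
  then show ?thesis by blast
qed

theorem mainTheorem1:
  fixes s0 s1 :: "'a::cstar_algebra"
  assumes "cuntz_algebra s0 s1"
  shows
    "(\<forall>\<theta>\<in>{0..<2 * pi}. \<exists>!\<pi>. is_wavelet_rep s0 s1 \<theta> \<pi>) \<and>
     (\<forall>\<theta>\<in>{0..<2 * pi}. \<theta> \<notin> {pi / 2, 3 * pi / 2} \<longrightarrow>
        irreducible_on UNIV (wavelet_rep s0 s1 \<theta>)) \<and>
     (\<forall>\<theta>\<in>{0..<2 * pi}. \<forall>\<theta>'\<in>{0..<2 * pi}.
        \<theta> \<noteq> \<theta>' \<and> {\<theta>, \<theta>'} \<noteq> {pi / 2, 3 * pi / 2} \<longrightarrow>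
        disjoint_reps UNIV (wavelet_rep s0 s1 \<theta>) UNIV (wavelet_rep s0 s1 \<theta>')) \<and>
     (\<exists>K L.
        direct_sum_of_reps UNIV (wavelet_rep s0 s1 (3 * pi / 2)) 2 K \<and>
        (\<forall>i<2. irreducible_on (K i) (wavelet_rep s0 s1 (3 * pi / 2))) \<and>
        (\<forall>i<2. \<forall>j<2. i \<noteq> j \<longrightarrow>
           disjoint_reps (K i) (wavelet_rep s0 s1 (3 * pi / 2))
                         (K j) (wavelet_rep s0 s1 (3 * pi / 2))) \<and>
        direct_sum_of_reps UNIV (wavelet_rep s0 s1 (pi / 2)) 3 L \<and>
        (\<forall>i<3. irreducible_on (L i) (wavelet_rep s0 s1 (pi / 2))) \<and>
        (\<forall>i<3. \<forall>j<3. i \<noteq> j \<longrightarrow>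
           disjoint_reps (L i) (wavelet_rep s0 s1 (pi / 2))
                         (L j) (wavelet_rep s0 s1 (pi / 2))) \<and>
        (\<forall>i<2. \<exists>j<3.
           unitarily_equivalent (K i) (wavelet_rep s0 s1 (3 * pi / 2))
                                (L j) (wavelet_rep s0 s1 (pi / 2))))"
proof (intro conjI ballI impI)
  fix \<theta> :: real
  show "\<exists>!\<pi>. is_wavelet_rep s0 s1 \<theta> \<pi>" by (rule is_wavelet_rep_ex1[OF assms])
next
  fix \<theta> assume \<theta>: "\<theta> \<in> {0..<2 * pi}" "\<theta> \<notin> {pi / 2, 3 * pi / 2}"
  then have "(sin \<theta>)\<^sup>2 \<noteq> 1"
    using angle_exceptional[OF \<theta>(1)] by (auto simp: power2_eq_1_iff)
  then show "irreducible_on UNIV (wavelet_rep s0 s1 \<theta>)"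
    by (rule irreducible_wavelet_rep[OF assms])
next
  fix \<theta> \<theta>' assume "\<theta> \<in> {0..<2 * pi}" "\<theta>' \<in> {0..<2 * pi}"
    "\<theta> \<noteq> \<theta>' \<and> {\<theta>, \<theta>'} \<noteq> {pi / 2, 3 * pi / 2}"
  then show "disjoint_reps UNIV (wavelet_rep s0 s1 \<theta>) UNIV (wavelet_rep s0 s1 \<theta>')"
    by (intro disjoint_wavelet_reps[OF assms]) auto
next
  let ?K = "\<lambda>i. coord_space (index_3pi_half i)"
  let ?L = "\<lambda>i. coord_space (index_pi_half i)"
  show "\<exists>K L.
        direct_sum_of_reps UNIV (wavelet_rep s0 s1 (3 * pi / 2)) 2 K \<and>
        (\<forall>i<2. irreducible_on (K i) (wavelet_rep s0 s1 (3 * pi / 2))) \<and>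
        (\<forall>i<2. \<forall>j<2. i \<noteq> j \<longrightarrow>
           disjoint_reps (K i) (wavelet_rep s0 s1 (3 * pi / 2))
                         (K j) (wavelet_rep s0 s1 (3 * pi / 2))) \<and>
        direct_sum_of_reps UNIV (wavelet_rep s0 s1 (pi / 2)) 3 L \<and>
        (\<forall>i<3. irreducible_on (L i) (wavelet_rep s0 s1 (pi / 2))) \<and>
        (\<forall>i<3. \<forall>j<3. i \<noteq> j \<longrightarrow>
           disjoint_reps (L i) (wavelet_rep s0 s1 (pi / 2))
                         (L j) (wavelet_rep s0 s1 (pi / 2))) \<and>
        (\<forall>i<2. \<exists>j<3.
           unitarily_equivalent (K i) (wavelet_rep s0 s1 (3 * pi / 2))
                                (L j) (wavelet_rep s0 s1 (pi / 2)))"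
  proof (rule exI[of _ ?K], rule exI[of _ ?L], intro conjI allI impI)
    show "direct_sum_of_reps UNIV (wavelet_rep s0 s1 (3 * pi / 2)) 2 ?K"
      by (intro direct_sum_coord_spaces[OF assms] filter_invariant_index_3pi_half index_3pi_half_partition)
    show "direct_sum_of_reps UNIV (wavelet_rep s0 s1 (pi / 2)) 3 ?L"
      by (intro direct_sum_coord_spaces[OF assms] filter_invariant_index_pi_half index_pi_half_partition)
    show "irreducible_on (?K i) (wavelet_rep s0 s1 (3 * pi / 2))" for i
      by (rule irreducible_summand_3pi_half[OF assms])
    show "irreducible_on (?L i) (wavelet_rep s0 s1 (pi / 2))" for i
      by (rule irreducible_summand_pi_half[OF assms])
    show "disjoint_reps (?K i) (wavelet_rep s0 s1 (3 * pi / 2)) (?K j) (wavelet_rep s0 s1 (3 * pi / 2))"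
      if "i < 2" "j < 2" "i \<noteq> j" for i j
      by (intro disjoint_coord_spaces[OF assms] filter_invariant_index_3pi_half
          partition_disjoint[OF index_3pi_half_partition that]) (simp add: sin_3pi_half)
    show "disjoint_reps (?L i) (wavelet_rep s0 s1 (pi / 2)) (?L j) (wavelet_rep s0 s1 (pi / 2))"
      if "i < 3" "j < 3" "i \<noteq> j" for i j
      by (intro disjoint_coord_spaces[OF assms] filter_invariant_index_pi_half
          partition_disjoint[OF index_pi_half_partition that]) simp
    show "\<exists>j<3. unitarily_equivalent (?K i) (wavelet_rep s0 s1 (3 * pi / 2))
        (?L j) (wavelet_rep s0 s1 (pi / 2))" if "i < 2" for i
      using unitarily_equivalent_summands[OF assms that] that by (intro exI[of _ i]) simp
  qed
qed

end
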